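(* Let $\mu_0\in\mathcal P$. There exist constants $\tilde C>0$ and $\widehat C>0$, independent of the POD dimension $\ell$, of the temporal discretization parameter $m$, and of the perturbation magnitude $\delta=|\mu_1-\mu_0|$, such that for every $\mu_1\in\mathcal P$, every $m$ satisfying the time step condition (S), and every $\ell\in\{1,\dots,n\}$, the following holds. Let $V^\ell$ be the POD space constructed from the snapshots at the reference parameter $\mu_0$, and let $\{U_k^1\}_{k=0}^m\subset V^\ell$ be the Backward Euler--Galerkin POD solution at the query parameter $\mu_1$, computed in the same reduced space $V^\ell$. Then $$\left(\frac1m\sum_{k=1}^m\|u_1(t_k)-U_k^1\|_H^2\right)^{1/2}\le \tilde C^{1/2}\left(\|\phi-P^\ell\phi\|_H^2+\sum_{j=\ell+1}^n\lambda_j+(\Delta t)^2\right)^{1/2}+\widehat C\,\rho_{\mathcal P}(\delta).$$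
   Context: **Spaces.** $V,H$ are real separable Hilbert spaces, $V$ densely and compactly embedded in $H$; identifying $H\cong H^*$ gives a Gelfand triple $V\hookrightarrow H\cong H^*\hookrightarrow V^*$. $\alpha>0$ is a constant with $\|\varphi\|_H^2\le\alpha\|\varphi\|_V^2$ for all $\varphi\in V$. $T>0$ is fixed and $W(0,T;V)=\{u\in L^2(0,T;V):\partial_t u\in L^2(0,T;V^* )\}$. **Problem.** $\mathcal P\subset(0,\infty)$ is a fixed compact set, $f\in C([0,T];H)$, $\phi\in V$, $a:V\times V\times\mathbb R_{>0}\to\mathbb R$ is bilinear in its first two arguments, and $F:V\times\mathbb R_{>0}\to H$. For $\mu\in\mathcal P$, $u_\mu\in W(0,T;V)$ solves $$\langle\partial_t u_\mu(t),\psi\rangle_{V^*,V}+a(u_\mu(t),\psi;\mu)+\langle F(u_\mu(t);\mu),\psi\rangle_H=\langle f(t),\psi\rangle_H\quad\forall\psi\in V,\ \text{a.e. }t\in(0,T),\qquad u_\mu(0)=\phi.$$ **Standing assumptions.** A modulus of continuity is a nondecreasing $\omega:[0,\infty)\to[0,\infty)$ with $\omega(0)=0$ and $\lim_{r\to0}\omega(r)=0$. There are continuous functions $\beta,\kappa:\mathcal P\to(0,\infty)$, $L_F:\mathcal P\to[0,\infty)$ and moduli of continuity $\omega_a^{\mathcal P},\omega_F^{\mathcal P}$ such that for all $\mu,\nu\in\mathcal P$, $\varphi,\psi,u,v\in V$: - (A1) $|a(\varphi,\psi;\mu)|\le\beta(\mu)\|\varphi\|_V\|\psi\|_V$; - (A2)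 $a(\varphi,\varphi;\mu)\ge\kappa(\mu)\|\varphi\|_V^2$; - (A3) $|a(\varphi,\psi;\mu)-a(\varphi,\psi;\nu)|\le\omega_a^{\mathcal P}(|\mu-\nu|)\|\varphi\|_V\|\psi\|_V$; - (F1) $\|F(u;\mu)-F(v;\mu)\|_H\le L_F(\mu)\|u-v\|_V$; - (F2) $\|F(u;\mu)-F(u;\nu)\|_H\le\omega_F^{\mathcal P}(|\mu-\nu|)(\|u\|_V+1)$. For every $\mu\in\mathcal P$ the problem has a unique solution $u_\mu\in W(0,T;V)\cap C([0,T];H)$, and moreover $u_\mu\in W^{2,2}(0,T;H)\cap C([0,T];V)$ (so $\partial_tu_\mu\in C([0,T];H)$ and the duality pairing is identified with the $H$-inner product). **Notation.** $\underline\kappa_{\mathcal P}=\inf_{\mathcal P}\kappa>0$, $\overline L_{F,\mathcal P}=\sup_{\mathcal P}L_F<\infty$, $\rho_{\mathcal P}(s)=\omega_a^{\mathcal P}(s)+\omega_F^{\mathcal P}(s)$ for $s\ge0$. For $\mu_0,\mu_1\in\mathcal P$: $\delta=|\mu_1-\mu_0|$, $u_i=u_{\mu_i}$. For a positive integer $m$: $\Delta t=T/m$, $t_k=k\Delta t$, and $\overline\partial w_k=(w_k-w_{k-1})/\Delta t$ (with $w_k=w(t_k)$ for a function $w$ of time). **Time step condition (S).** $1-\frac{\overline L_{F,\mathcal P}^2}{\underline\kappa_{\mathcal P}}\Delta t\ge\frac12$ and $1-\left(1+L_F(\mu_0)+\frac{L_F(\mu_0)^2}{2\kappa(\mu_0)}\right)\Delta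 t\ge\frac12$. **POD space.** The snapshots are $y_j=u_0(t_j)$ for $j=0,\dots,m$ and $y_j=\overline\partial u_0(t_{j-m})=(u_0(t_{j-m})-u_0(t_{j-m-1}))/\Delta t$ for $j=m+1,\dots,2m$. Let $n$ be the dimension of their span, and let $\lambda_1\ge\dots\ge\lambda_n>0$ be the positive eigenvalues of the $(2m+1)\times(2m+1)$ matrix $K_{ij}=\frac1{2m+1}\langle y_i,y_j\rangle_V$, with corresponding orthonormal eigenvectors $v_1,\dots,v_n$. The POD basis is $\psi_k=\frac1{\sqrt{(2m+1)\lambda_k}}\sum_{j=0}^{2m}(v_k)_jy_j$, $1\le k\le\ell$, $\ell\in\{1,\dots,n\}$; it is $V$-orthonormal and minimizes $\frac1{2m+1}\sum_{j=0}^{2m}\|y_j-\sum_{k=1}^\ell\langle y_j,\psi_k\rangle_V\psi_k\|_V^2$ over $V$-orthonormal families, with minimum value $\sum_{j=\ell+1}^n\lambda_j$. Set $V^\ell=\mathrm{span}\{\psi_1,\dots,\psi_\ell\}$. **Ritz projection.** $P^\ell:V\to V^\ell$ is defined by $a(P^\ell v,\psi;\mu_0)=a(v,\psi;\mu_0)$ for all $\psi\in V^\ell$. **Reduced-order scheme.** For $i=0,1$, $\{U_k^i\}_{k=0}^m\subset V^\ell$ (the same $V^\ell$, built at $\mu_0$, for both $i$) satisfies, for all $\psi\in V^\ell$, $\langle U_0^i,\psi\rangle_H=\langle\phi,\psi\rangle_H$ and, for $k=1,\dots,m$, $$\langle\overline\partial U_k^i,\psi\rangle_H+a(U_k^i,\psi;\mu_i)+\langle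 F(U_k^i;\mu_i),\psi\rangle_H=\langle f(t_k),\psi\rangle_H.$$ *)

theory Defs
  imports "HOL-Analysis.Analysis" "Jordan_Normal_Form.Char_Poly"
begin

text \<open>
  The Gelfand triple is given by two Hilbert space types 'v (for V) and 'h (for H) and the
  embedding \<open>\<iota> : V \<rightarrow> H\<close>.  The dual of V is the type of bounded linear functionals on 'v, and
  \<open>h\<close> in H acts on V as \<open>\<psi> \<mapsto> inner h (\<iota> \<psi>)\<close>.  Separability is the type class
  second_countable_topology.  The notation for the infix dot is ambiguous between inner products
  and products of coordinate vectors, so inner and scalar_prod are written out.
\<close>

definition dense_compact_embedding :: "('v::real_normed_vector \<Rightarrow> 'h::real_normed_vector) \<Rightarrow> bool" where
  "dense_compact_embedding \<iota> \<longleftrightarrow>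
     bounded_linear \<iota> \<and> inj \<iota> \<and> closure (range \<iota>) = UNIV \<and>
     (\<forall>S. bounded S \<longrightarrow> compact (closure (\<iota> ` S)))"

definition modulus_of_continuity :: "(real \<Rightarrow> real) \<Rightarrow> bool" where
  "modulus_of_continuity \<omega> \<longleftrightarrow>
     mono_on {0..} \<omega> \<and> (\<forall>r\<ge>0. 0 \<le> \<omega> r) \<and> \<omega> 0 = 0 \<and> (\<omega> \<longlongrightarrow> 0) (at_right 0)"


subsection \<open>Bochner and Sobolev spaces in time\<close>

text \<open>
  For a separable target space Borel measurability is strong measurability, so this is the usual
  Bochner space.  It is used with values in V, in H and in the (separable) dual of V.
\<close>

definition L2_time :: "real \<Rightarrow> (real \<Rightarrow> 'b::real_normed_vector) \<Rightarrow> bool" where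
  "L2_time T w \<longleftrightarrow>
     w \<in> borel_measurable (lebesgue_on {0<..<T}) \<and>
     integrable (lebesgue_on {0<..<T}) (\<lambda>t. (norm (w t))\<^sup>2)"

definition test_function :: "real \<Rightarrow> (real \<Rightarrow> real) \<Rightarrow> bool" where
  "test_function T \<eta> \<longleftrightarrow>
     (\<forall>n t. ((deriv ^^ n) \<eta>) differentiable (at t)) \<and>
     (\<exists>c d. 0 < c \<and> c \<le> d \<and> d < T \<and> (\<forall>t. t \<notin> {c..d} \<longrightarrow> \<eta> t = 0))"

definition has_weak_deriv ::
  "real \<Rightarrow> (real \<Rightarrow> 'b::{banach, second_countable_topology}) \<Rightarrow> (real \<Rightarrow> 'b) \<Rightarrow> bool" where
  "has_weak_deriv T w g \<longleftrightarrow>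
     (\<forall>\<eta>. test_function T \<eta> \<longrightarrow>
        (LINT t|lebesgue_on {0<..<T}. deriv \<eta> t *\<^sub>R w t) =
        - (LINT t|lebesgue_on {0<..<T}. \<eta> t *\<^sub>R g t))"

definition W22 :: "real \<Rightarrow> (real \<Rightarrow> 'b::{banach, second_countable_topology}) \<Rightarrow> bool" where
  "W22 T w \<longleftrightarrow>
     L2_time T w \<and>
     (\<exists>w1 w2. L2_time T w1 \<and> has_weak_deriv T w w1 \<and> L2_time T w2 \<and> has_weak_deriv T w1 w2)"

text \<open>
  The distributional derivative of \<open>u\<close> with values in the dual of V.  The library's Bochner integral
  needs a second countable target type, which is not available for the type of bounded linear
  functionals; the identity between the two dual-valued integrals is therefore evaluated at each
  \<open>\<psi>\<close> in V.
\<close>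

definition has_weak_deriv_dual ::
  "real \<Rightarrow> ('v::real_normed_vector \<Rightarrow> 'h::real_inner) \<Rightarrow> (real \<Rightarrow> 'v) \<Rightarrow> (real \<Rightarrow> 'v \<Rightarrow>\<^sub>L real) \<Rightarrow> bool" where
  "has_weak_deriv_dual T \<iota> u g \<longleftrightarrow>
     (\<forall>\<eta> \<psi>. test_function T \<eta> \<longrightarrow>
        (LINT t|lebesgue_on {0<..<T}. deriv \<eta> t * inner (\<iota> (u t)) (\<iota> \<psi>)) =
        - (LINT t|lebesgue_on {0<..<T}. \<eta> t * blinfun_apply (g t) \<psi>))"

text \<open>
  Elements of W(0,T;V) are determined almost everywhere; the initial condition refers to the
  H-valued continuous representative \<open>w\<close>.
\<close>

definition weak_solution ::
  "real \<Rightarrow> ('v::real_inner \<Rightarrow> 'h::real_inner) \<Rightarrow> (real \<Rightarrow> 'h) \<Rightarrow> 'v \<Rightarrow>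
   ('v \<Rightarrow> 'v \<Rightarrow> real \<Rightarrow> real) \<Rightarrow> ('v \<Rightarrow> real \<Rightarrow> 'h) \<Rightarrow> real \<Rightarrow> (real \<Rightarrow> 'v) \<Rightarrow> bool" where
  "weak_solution T \<iota> f \<phi> a F \<mu> u \<longleftrightarrow>
     L2_time T u \<and>
     (\<exists>g. L2_time T g \<and> has_weak_deriv_dual T \<iota> u g \<and>
        (AE t in lebesgue_on {0<..<T}. \<forall>\<psi>.
           blinfun_apply (g t) \<psi> + a (u t) \<psi> \<mu> + inner (F (u t) \<mu>) (\<iota> \<psi>) = inner (f t) (\<iota> \<psi>))) \<and>
     (\<exists>w. continuous_on {0..T} w \<and> (AE t in lebesgue_on {0<..<T}. w t = \<iota> (u t)) \<and> w 0 = \<iota> \<phi>)"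


subsection \<open>Time grid and proper orthogonal decomposition\<close>

definition tstep :: "real \<Rightarrow> nat \<Rightarrow> real" where
  "tstep T m = T / real m"

definition tgrid :: "real \<Rightarrow> nat \<Rightarrow> nat \<Rightarrow> real" where
  "tgrid T m k = real k * tstep T m"

definition bdiff :: "real \<Rightarrow> nat \<Rightarrow> (nat \<Rightarrow> 'b::real_vector) \<Rightarrow> nat \<Rightarrow> 'b" where
  "bdiff T m w k = (1 / tstep T m) *\<^sub>R (w k - w (k - 1))"

definition snapshot :: "real \<Rightarrow> nat \<Rightarrow> (real \<Rightarrow> 'v::real_vector) \<Rightarrow> nat \<Rightarrow> 'v" where
  "snapshot T m u j =
     (if j \<le> m then u (tgrid T m j) else bdiff T m (\<lambda>k. u (tgrid T m k)) (j - m))"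

definition snapshot_rank :: "real \<Rightarrow> nat \<Rightarrow> (real \<Rightarrow> 'v::real_vector) \<Rightarrow> nat" where
  "snapshot_rank T m u = dim (span (snapshot T m u ` {0..2*m}))"

definition correlation_matrix :: "real \<Rightarrow> nat \<Rightarrow> (real \<Rightarrow> 'v::real_inner) \<Rightarrow> real mat" where
  "correlation_matrix T m u =
     mat (2*m+1) (2*m+1)
       (\<lambda>(i, j). inner (snapshot T m u i) (snapshot T m u j) / real (2*m+1))"

text \<open>
  The \<open>n\<close> positive eigenvalues (with multiplicity) and orthonormal eigenvectors of the correlation
  matrix, indexed by 1..n.  Since the matrix has rank \<open>n\<close>, no positive eigenvalue is left out.
\<close>

definition pod_eigensystem ::
  "real \<Rightarrow> nat \<Rightarrow> (real \<Rightarrow> 'v::real_inner) \<Rightarrow> (nat \<Rightarrow> real) \<Rightarrow> (nat \<Rightarrow> real Matrix.vec) \<Rightarrow> bool" where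
  "pod_eigensystem T m u lam v \<longleftrightarrow>
     (let n = snapshot_rank T m u in
       (\<forall>k\<in>{1..n}. 0 < lam k \<and> eigenvector (correlation_matrix T m u) (v k) (lam k)) \<and>
       (\<forall>j\<in>{1..n}. \<forall>k\<in>{1..n}. j \<le> k \<longrightarrow> lam k \<le> lam j) \<and>
       (\<forall>j\<in>{1..n}. \<forall>k\<in>{1..n}. scalar_prod (v j) (v k) = (if j = k then 1 else 0)))"

definition pod_basis ::
  "real \<Rightarrow> nat \<Rightarrow> (real \<Rightarrow> 'v::real_inner) \<Rightarrow> (nat \<Rightarrow> real) \<Rightarrow> (nat \<Rightarrow> real Matrix.vec) \<Rightarrow> nat \<Rightarrow> 'v" where
  "pod_basis T m u lam v k =
     (1 / sqrt (real (2*m+1) * lam k)) *\<^sub>R (\<Sum>j=0..2*m. vec_index (v k) j *\<^sub>R snapshot T m u j)"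

definition pod_space ::
  "real \<Rightarrow> nat \<Rightarrow> (real \<Rightarrow> 'v::real_inner) \<Rightarrow> (nat \<Rightarrow> real) \<Rightarrow> (nat \<Rightarrow> real Matrix.vec) \<Rightarrow> nat \<Rightarrow> 'v set" where
  "pod_space T m u lam v l = span (pod_basis T m u lam v ` {1..l})"

definition ritz_projection ::
  "('v \<Rightarrow> 'v \<Rightarrow> real \<Rightarrow> real) \<Rightarrow> real \<Rightarrow> 'v set \<Rightarrow> 'v \<Rightarrow> 'v" where
  "ritz_projection a \<mu> S x = (THE p. p \<in> S \<and> (\<forall>\<psi>\<in>S. a p \<psi> \<mu> = a x \<psi> \<mu>))"

definition rom_solution ::
  "real \<Rightarrow> nat \<Rightarrow> ('v::real_inner \<Rightarrow> 'h::real_inner) \<Rightarrow> (real \<Rightarrow> 'h) \<Rightarrow> 'v \<Rightarrow>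
   ('v \<Rightarrow> 'v \<Rightarrow> real \<Rightarrow> real) \<Rightarrow> ('v \<Rightarrow> real \<Rightarrow> 'h) \<Rightarrow> real \<Rightarrow> 'v set \<Rightarrow> (nat \<Rightarrow> 'v) \<Rightarrow> bool" where
  "rom_solution T m \<iota> f \<phi> a F \<mu> S U \<longleftrightarrow>
     (\<forall>k\<in>{0..m}. U k \<in> S) \<and>
     (\<forall>\<psi>\<in>S. inner (\<iota> (U 0)) (\<iota> \<psi>) = inner (\<iota> \<phi>) (\<iota> \<psi>)) \<and>
     (\<forall>k\<in>{1..m}. \<forall>\<psi>\<in>S.
        inner (\<iota> (bdiff T m U k)) (\<iota> \<psi>) + a (U k) \<psi> \<mu> + inner (F (U k) \<mu>) (\<iota> \<psi>)
          = inner (f (tgrid T m k)) (\<iota> \<psi>))"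

definition time_step_condition ::
  "real \<Rightarrow> nat \<Rightarrow> real set \<Rightarrow> (real \<Rightarrow> real) \<Rightarrow> (real \<Rightarrow> real) \<Rightarrow> real \<Rightarrow> bool" where
  "time_step_condition T m P \<kappa> LF \<mu>0 \<longleftrightarrow>
     1 - (SUP \<mu>\<in>P. LF \<mu>)\<^sup>2 / (INF \<mu>\<in>P. \<kappa> \<mu>) * tstep T m \<ge> 1/2 \<and>
     1 - (1 + LF \<mu>0 + (LF \<mu>0)\<^sup>2 / (2 * \<kappa> \<mu>0)) * tstep T m \<ge> 1/2"

end

theory Submission
  imports Defs
begin

text \<open>
  The error is measured against the Ritz projection of the reference solution. Write \<open>u\<^sub>0\<close> and \<open>u\<^sub>1\<close> for the
  solutions at \<open>\<mu>0\<close> and \<open>\<mu>1\<close>, and \<open>R\<close> for the Ritz projection at \<open>\<mu>0\<close> onto the POD space. Then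
  \<open>u\<^sub>1 - U\<close> is the sum of \<open>u\<^sub>1 - u\<^sub>0\<close>, of \<open>u\<^sub>0 - R u\<^sub>0\<close> and of \<open>R u\<^sub>0 - U\<close>, at every grid point.
  
  The first part is of the size of the moduli of continuity by the energy method and Gronwall's inequality
  (\<open>parameter_stability\<close>). The second part is controlled by the neglected eigenvalues, because by Cea's
  lemma the Ritz projection is the best approximation up to a constant factor, and the grid values of \<open>u\<^sub>0\<close> are
  snapshots (\<open>pod_ritz_error\<close>). The third part lies in the reduced space and satisfies the implicit Euler
  scheme at \<open>\<mu>1\<close> up to a residual, so that a discrete energy estimate and a discrete Gronwall inequality
  apply to it (\<open>rom_error_step\<close>, \<open>rom_error_bound\<close>). The residual contains the change of the parameter,
  evaluated at \<open>u\<^sub>0\<close> and \<open>R u\<^sub>0\<close>; the Ritz projection errors of the values and of the difference quotients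
  of \<open>u\<^sub>0\<close>, which the snapshots cover; and the error of the backward difference.
  
  Two facts about the exact solution are needed that its definition by weak derivatives does not
  state directly: the equation holds at every grid point, and the error of the backward difference is of first
  order in the mean square. Both follow from the square integrability of the second weak
  derivative. Testing with smoothed hat functions bounds the difference of two divided differences by the
  integral of the norm of the second weak derivative (\<open>div_diff_difference_bound_interior\<close>).
  Hence the difference quotients converge, the solution is continuously differentiable in time with values in H, and
  its classical derivative obeys the equation at every time (\<open>W22_imp_C1\<close>, \<open>pointwise_equation\<close>).
\<close>

section \<open>Smooth functions and bumps\<close>

text \<open>
  Infinitely differentiable functions, as the largest class that is closed under differentiation.
  With this form a closure property of the class needs a single derivative instead of a formula for
  all higher ones.
\<close>

coinductive smooth :: "(real \<Rightarrow> real) \<Rightarrow> bool" where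
  "(\<And>x. (f has_real_derivative f' x) (at x)) \<Longrightarrow> smooth f' \<Longrightarrow> smooth f"

lemma smooth_cases:
  assumes "smooth f"
  obtains f' where "\<And>x. (f has_real_derivative f' x) (at x)" "smooth f'"
  using assms by (rule smooth.cases) (use that in blast)

lemma smooth_higher_deriv: "smooth f \<Longrightarrow> smooth ((deriv ^^ n) f)"
proof (induction n)
  case (Suc n)
  then obtain f' where f': "\<And>x. ((deriv ^^ n) f has_real_derivative f' x) (at x)" "smooth f'"
    using smooth_cases by blast
  then have "deriv ((deriv ^^ n) f) = f'" using DERIV_imp_deriv by blast
  then show ?case using f' by simp
qed auto

lemma smooth_imp_differentiable: "smooth f \<Longrightarrow> f differentiable (at x)"
  by (metis smooth_cases real_differentiable_def)

lemma smooth_add: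
  assumes "smooth f" "smooth g"
  shows "smooth (\<lambda>x. f x + g x)"
proof -
  have "\<exists>f g. smooth f \<and> smooth g \<and> h = (\<lambda>x. f x + g x) \<Longrightarrow> smooth h" for h
  proof (coinduction arbitrary: h)
    case smooth
    then obtain f g where h: "smooth f" "smooth g" "h = (\<lambda>x. f x + g x)" by blast
    obtain f' where f': "\<And>x. (f has_real_derivative f' x) (at x)" "smooth f'" using h(1) smooth_cases by blast
    obtain g' where g': "\<And>x. (g has_real_derivative g' x) (at x)" "smooth g'" using h(2) smooth_cases by blast
    have "(h has_real_derivative f' x + g' x) (at x)" for x
      unfolding h by (intro DERIV_add f' g')
    then show ?case using f'(2) g'(2) by (intro exI[of _ h] exI[of _ "\<lambda>x. f' x + g' x"]) auto
  qed
  then show ?thesis using assms by blast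
qed

lemma smooth_affine:
  assumes "smooth f"
  shows "smooth (\<lambda>x. c * f (p * x + q))"
proof -
  have "\<exists>f c. smooth f \<and> h = (\<lambda>x. c * f (p * x + q)) \<Longrightarrow> smooth h" for h
  proof (coinduction arbitrary: h)
    case smooth
    then obtain f c where h: "smooth f" "h = (\<lambda>x. c * f (p * x + q))" by blast
    obtain f' where f': "\<And>x. (f has_real_derivative f' x) (at x)" "smooth f'" using h(1) smooth_cases by blast
    have "(h has_real_derivative (c * p) * f' (p * x + q)) (at x)" for x
      unfolding h by (auto intro!: derivative_eq_intros DERIV_chain2[where f=f, OF f'(1)])
    then show ?case using f'(2) 
      by (intro exI[of _ h] exI[of _ "\<lambda>x. (c * p) * f' (p * x + q)"]) blast
  qed
  then show ?thesis using assms by blast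
qed

text \<open>
  The Leibniz rule does not turn a product into a product, so products alone are no invariant for
  the coinduction. Finite sums of products are closed under differentiation.
\<close>

inductive sum_of_smooth_products :: "(real \<Rightarrow> real) \<Rightarrow> bool" where
  prod: "smooth f \<Longrightarrow> smooth g \<Longrightarrow> sum_of_smooth_products (\<lambda>x. f x * g x)"
| add: "sum_of_smooth_products f \<Longrightarrow> sum_of_smooth_products g \<Longrightarrow> sum_of_smooth_products (\<lambda>x. f x + g x)"

lemma smooth_mult:
  assumes "smooth f" "smooth g"
  shows "smooth (\<lambda>x. f x * g x)"
proof -
  have *: "\<exists>h'. (\<forall>x. (h has_real_derivative h' x) (at x)) \<and> sum_of_smooth_products h'"
    if "sum_of_smooth_products h" for h
    using that
  proof induction
    case (prod f g)
    obtain f' where f': "\<And>x. (f has_real_derivative f' x) (at x)" "smooth f'" using prod(1) smooth_cases by blast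
    obtain g' where g': "\<And>x. (g has_real_derivative g' x) (at x)" "smooth g'" using prod(2) smooth_cases by blast
    have "((\<lambda>x. f x * g x) has_real_derivative f' x * g x + g' x * f x) (at x)" for x
      by (intro DERIV_mult f' g')
    moreover have "sum_of_smooth_products (\<lambda>x. f' x * g x + g' x * f x)"
      using prod f' g' by (intro sum_of_smooth_products.intros)
    ultimately show ?case by (intro exI[of _ "\<lambda>x. f' x * g x + g' x * f x"]) auto
  next
    case (add f g)
    then obtain f' g' where
      "\<And>x. (f has_real_derivative f' x) (at x)" "sum_of_smooth_products f'" 
      "\<And>x. (g has_real_derivative g' x) (at x)" "sum_of_smooth_products g'" by blast
    then show ?case
      by (intro exI[of _ "\<lambda>x. f' x + g' x"]) (auto intro!: DERIV_add sum_of_smooth_products.add)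
  qed
  have "sum_of_smooth_products h \<Longrightarrow> smooth h" for h
  proof (coinduction arbitrary: h)
    case smooth
    from *[OF this] show ?case by blast
  qed
  then show ?thesis using assms sum_of_smooth_products.prod by blast
qed

text \<open>
  The standard example of a smooth function that vanishes on a half line but not identically.
\<close>

definition flat_exp :: "real \<Rightarrow> real" where
  "flat_exp x = (if 0 < x then exp (- (1 / x)) else 0)"

text \<open>
  In the variable \<open>1 / x\<close> this is the decay of a polynomial times \<open>exp (- y)\<close> at infinity. It makes
  all difference quotients below vanish at 0.
\<close>

lemma poly_times_flat_tendsto_0:
  "((\<lambda>x. poly p (1 / x) * exp (- (1 / x))) \<longlongrightarrow> (0::real)) (at_right 0)"
proof -
  have "((\<lambda>y. poly p y * exp (- y)) \<longlongrightarrow> 0) at_top"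
  proof -
    have "((\<lambda>y::real. \<Sum>i\<le>degree p. coeff p i * (y ^ i / exp y)) \<longlongrightarrow> (\<Sum>i\<le>degree p. coeff p i * 0)) at_top"
      by (intro tendsto_intros tendsto_power_div_exp_0)
    moreover have "(\<Sum>i\<le>degree p. coeff p i * (y ^ i / exp y)) = poly p y * exp (- y)" for y :: real
      by (simp add: poly_altdef sum_distrib_right exp_minus divide_inverse mult.assoc)
    ultimately show ?thesis by simp
  qed
  moreover have "filterlim (\<lambda>x::real. 1 / x) at_top (at_right 0)"
    using filterlim_inverse_at_top_right by (simp add: inverse_eq_divide)
  ultimately show ?thesis by (rule filterlim_compose)
qed

text \<open>
  On the positive half line every derivative is a polynomial in \<open>1 / x\<close> times \<open>exp (- 1 / x)\<close>, and
  the class of these functions, extended by 0, is closed under differentiation.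
\<close>

lemma smooth_flat_exp: "smooth flat_exp"
proof -
  define H where "H p = (\<lambda>x. if 0 < x then poly p (1 / x) * exp (- (1 / x)) else (0::real))" for p
  define D where "D p = monom 1 2 * (p - pderiv p)" for p :: "real poly"
  have der: "(H p has_real_derivative H (D p) x) (at x)" for p x
  proof -
    consider "x < 0" | "x = 0" | "x > 0" by linarith
    then show ?thesis
    proof cases
      case 1
      have "((\<lambda>x. 0) has_real_derivative 0) (at x)" by simp
      then have "(H p has_real_derivative 0) (at x)"
        by (rule has_field_derivative_transform_within_open[where S="{..<0}"]) (use 1 in \<open>auto simp: H_def\<close>)
      then show ?thesis using 1 by (simp add: H_def)
    next
      case 2
      have R: "((\<lambda>h. H p h / h) \<longlongrightarrow> 0) (at_right 0)"
      proof (rule Lim_transform_eventually[OF poly_times_flat_tendsto_0[of "monom 1 1 * p"]])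
        show "\<forall>\<^sub>F x in at_right 0. poly (monom 1 1 * p) (1 / x) * exp (- (1 / x)) = H p x / x"
          by (auto simp: eventually_at_right_less H_def poly_monom intro!: eventually_at_rightI[of 0 1])
      qed
      have L: "((\<lambda>h. H p h / h) \<longlongrightarrow> 0) (at_left 0)"
        by (rule Lim_transform_eventually[OF tendsto_const])
           (auto simp: H_def intro!: eventually_at_leftI[of "-1" 0])
      from filterlim_split_at[OF L R] show ?thesis
        using 2 by (simp add: DERIV_def) (simp add: H_def)
    next
      case 3
      have "((\<lambda>x. poly p (1 / x) * exp (- (1 / x))) has_real_derivative 
             poly (D p) (1 / x) * exp (- (1 / x))) (at x)"
        using 3 by (auto intro!: derivative_eq_intros DERIV_chain2[OF poly_DERIV] 
            simp: D_def poly_monom field_simps power2_eq_square)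
      then have "(H p has_real_derivative poly (D p) (1 / x) * exp (- (1 / x))) (at x)"
        by (rule has_field_derivative_transform_within_open[where S="{0<..}"]) (use 3 in \<open>auto simp: H_def\<close>)
      then show ?thesis using 3 by (simp add: H_def)
    qed
  qed
  have "\<exists>p. h = H p \<Longrightarrow> smooth h" for h
  proof (coinduction arbitrary: h)
    case smooth
    then show ?case using der by blast
  qed
  moreover have "flat_exp = H 1" by (auto simp: H_def flat_exp_def)
  ultimately show ?thesis by blast
qed

text \<open>
  After rescaling, \<open>\<rho>\<close> approximates a point mass, \<open>S\<close> the step function and \<open>G\<close> the ramp
  \<open>max x 0\<close>. To the right of 1 the function \<open>G\<close> is affine with slope 1, so a combination of shifted
  copies of \<open>G\<close> in which slopes and constants cancel has compact support: it is a smoothed piecewise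
  linear test function whose second derivative is a combination of approximate point masses.
\<close>

lemma smooth_bump_with_antiderivatives:
  obtains \<rho> S G :: "real \<Rightarrow> real" where
    "smooth \<rho>" "\<And>x. 0 \<le> \<rho> x" "\<And>x. x \<notin> {0..1} \<Longrightarrow> \<rho> x = 0"
    "\<And>x. (S has_real_derivative \<rho> x) (at x)" "\<And>x. x \<le> 0 \<Longrightarrow> S x = 0" "\<And>x. 1 \<le> x \<Longrightarrow> S x = 1"
    "\<And>x. (G has_real_derivative S x) (at x)" "\<And>x. x \<le> 0 \<Longrightarrow> G x = 0"
    "\<And>x. \<bar>max x 0 - G x\<bar> \<le> 1" "\<And>x. 1 \<le> x \<Longrightarrow> G x = x - (1 - G 1)"
proof -
  define b where "b x = flat_exp x * flat_exp (1 - x)" for x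
  have sb: "smooth b"
    using smooth_mult[OF smooth_flat_exp smooth_affine[OF smooth_flat_exp, of 1 "-1" 1]]
    by (simp add: b_def[abs_def])
  have bpos: "0 \<le> b x" for x by (simp add: b_def flat_exp_def)
  have b0: "x \<notin> {0..1} \<Longrightarrow> b x = 0" for x by (auto simp: b_def flat_exp_def)
  have antider: "\<exists>F. (\<forall>x. (F has_real_derivative f x) (at x)) \<and> F 0 = 0"
    if "\<And>x. isCont f x" for f :: "real \<Rightarrow> real"
  proof -
    have "\<exists>F. \<forall>x::real. - \<infinity> < ereal x \<longrightarrow> ereal x < \<infinity> \<longrightarrow> (F has_vector_derivative f x) (at x)"
      by (rule einterval_antiderivative) (use that in auto)
    then obtain F where "\<And>x. (F has_vector_derivative f x) (at x)" by auto
    then have "\<And>x. ((\<lambda>x. F x - F 0) has_real_derivative f x) (at x)"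
      by (auto intro!: derivative_eq_intros simp: has_real_derivative_iff_has_vector_derivative)
    then show ?thesis by (intro exI[of _ "\<lambda>x. F x - F 0"]) auto
  qed
  have contb: "isCont b x" for x using sb by (meson DERIV_isCont smooth_cases)
  obtain B where B: "\<And>x. (B has_real_derivative b x) (at x)" "B 0 = 0" using antider[OF contb] by blast
  have Bl: "B x = 0" if "x \<le> 0" for x
  proof (cases "x = 0")
    case False
    have "\<exists>z. x < z \<and> z < 0 \<and> B 0 - B x = (0 - x) * b z"
      using MVT2[of x 0 B b] B that False by auto
    then show ?thesis using b0 B(2) by force
  qed (use B in auto)
  have Br: "B x = B 1" if "1 \<le> x" for x
  proof (cases "x = 1")
    case False
    have "\<exists>z. 1 < z \<and> z < x \<and> B x - B 1 = (x - 1) * b z"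
      using MVT2[of 1 x B b] B that False by auto
    then show ?thesis using b0 by force
  qed auto
  have "\<exists>z>0. z < 1 \<and> B 1 - B 0 = (1 - 0) * b z"
    by (rule MVT2) (use B(1) in auto)
  then obtain z where "0 < z" "z < 1" "B 1 - B 0 = (1 - 0) * b z" by blast
  then have B1: "B 1 > 0" using B(2) by (simp add: b_def flat_exp_def)
  define \<rho> where "\<rho> x = (1 / B 1) * b (1 * x + 0)" for x
  define S where "S x = B x / B 1" for x
  have "smooth \<rho>" unfolding \<rho>_def by (intro smooth_affine sb)
  have S: "(S has_real_derivative \<rho> x) (at x)" for x
    unfolding S_def \<rho>_def using B(1) B1 by (auto intro!: derivative_eq_intros)
  then have "isCont S x" for x using DERIV_isCont by blast
  then obtain G where G: "\<And>x. (G has_real_derivative S x) (at x)" "G 0 = 0" using antider by blast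
  have Sl: "S x = 0" if "x \<le> 0" for x using Bl that by (simp add: S_def)
  have Sr: "S x = 1" if "1 \<le> x" for x using Br[OF that] B1 by (simp add: S_def)
  have rpos: "0 \<le> \<rho> x" for x using bpos B1 by (simp add: \<rho>_def)
  have Smono: "S x \<le> S y" if "x \<le> y" for x y
    by (rule DERIV_nonneg_imp_nondecreasing[OF that]) (use S rpos in blast)
  have S01: "0 \<le> S x" "S x \<le> 1" for x
    using Smono[of 0 x] Smono[of x 1] Sl[of 0] Sr[of 1] Sl[of x] Sr[of x]
    by (cases "x \<le> 0"; cases "1 \<le> x"; simp)+
  have Gl: "G x = 0" if "x \<le> 0" for x
  proof (cases "x = 0")
    case False
    have "\<exists>z>x. z < 0 \<and> G 0 - G x = (0 - x) * S z"
      by (rule MVT2) (use G(1) that False in auto)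
    then obtain z where "z < 0" "G 0 - G x = (0 - x) * S z" by blast
    then show ?thesis using Sl[of z] G(2) by simp
  qed (use G in auto)
  have Gr: "G x = x - (1 - G 1)" if "1 \<le> x" for x
  proof (cases "x = 1")
    case False
    have "\<exists>z>1. z < x \<and> G x - G 1 = (x - 1) * S z"
      by (rule MVT2) (use G(1) that False in auto)
    then obtain z where "z > 1" "G x - G 1 = (x - 1) * S z" by blast
    then show ?thesis using Sr[of z] by simp
  qed auto
  have G01: "0 \<le> G x \<and> G x \<le> x" if "0 \<le> x" for x
  proof (cases "x = 0")
    case False
    have "\<exists>z>0. z < x \<and> G x - G 0 = (x - 0) * S z"
      by (rule MVT2) (use G(1) that False in auto)
    then obtain z where "G x = x * S z" using G(2) by auto
    then show ?thesis using S01[of z] that by (simp add: mult_left_le)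
  qed (use G in auto)
  have Gb: "\<bar>max x 0 - G x\<bar> \<le> 1" for x
  proof -
    consider "x \<le> 0" | "0 < x" "x \<le> 1" | "1 < x" by linarith
    then show ?thesis
    proof cases
      case 1 then show ?thesis using Gl by simp
    next
      case 2 then show ?thesis using G01[of x] by simp
    next
      case 3 then show ?thesis using Gr[of x] G01[of 1] by simp
    qed
  qed
  show ?thesis
  proof (rule that)
    show "smooth \<rho>" "\<And>x. 0 \<le> \<rho> x" by fact+
    show "\<rho> x = 0" if "x \<notin> {0..1}" for x using b0[OF that] by (simp add: \<rho>_def)
  qed (fact S Sl Sr G(1) Gl Gb Gr)+
qed

section \<open>Divided differences and weak derivatives\<close>

lemma continuous_integrable_lebesgue_on:
  fixes p :: "real \<Rightarrow> 'b::{banach, second_countable_topology}"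
  assumes "continuous_on {0..T} p"
  shows "integrable (lebesgue_on {0<..<T}) p"
proof -
  have m: "p \<in> borel_measurable (lebesgue_on {0<..<T})"
    by (rule continuous_imp_measurable_on_sets_lebesgue[OF continuous_on_subset[OF assms]]) auto
  have "bounded (p ` {0..T})"
    by (intro compact_imp_bounded compact_continuous_image assms) auto
  then obtain B where B: "\<And>x. x \<in> {0..T} \<Longrightarrow> norm (p x) \<le> B" unfolding bounded_iff by blast
  have "integrable (lebesgue_on {0<..<T}) (\<lambda>x. B)"
    by (intro finite_measure.integrable_const finite_measure_lebesgue_on) simp
  then show ?thesis
    by (rule Bochner_Integration.integrable_bound) (use m in \<open>auto intro!: AE_I2 simp: space_restrict_space order_trans[OF B]\<close>)
qed

text \<open>
  The kernels have mass 1 and their supports \<open>{a..a + e}\<close> shrink to \<open>a\<close>, so the integral differs from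
  \<open>p a\<close> by at most the oscillation of \<open>p\<close> on the support.
\<close>

lemma approximate_identity_tendsto:
  fixes p :: "real \<Rightarrow> 'b::{banach, second_countable_topology}"
  assumes \<rho>: "continuous_on UNIV \<rho>" "\<And>x. 0 \<le> \<rho> x" "\<And>x. x \<notin> {0..1} \<Longrightarrow> \<rho> x = 0"
    and S: "\<And>x. (S has_real_derivative \<rho> x) (at x)" "\<And>x. x \<le> 0 \<Longrightarrow> S x = 0" "\<And>x. 1 \<le> x \<Longrightarrow> S x = 1"
    and p: "continuous_on {0..T} p" and a: "0 < a" "a < T"
  shows "((\<lambda>e. LINT x|lebesgue_on {0<..<T}. (\<rho> ((x - a) / e) / e) *\<^sub>R p x) \<longlongrightarrow> p a) (at_right 0)"
proof (rule tendstoI)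
  fix r :: real assume "0 < r"
  have "isCont p a" by (rule continuous_on_interior[OF p]) (use a in simp)
  then have "\<exists>d>0. \<forall>x. dist x a < d \<longrightarrow> dist (p x) (p a) < r / 2"
    using half_gt_zero[OF \<open>0 < r\<close>] unfolding continuous_at_eps_delta by blast
  then obtain d where d: "0 < d" "\<And>x. dist x a < d \<Longrightarrow> dist (p x) (p a) < r / 2" by blast
  show "\<forall>\<^sub>F e in at_right 0. dist (LINT x|lebesgue_on {0<..<T}. (\<rho> ((x - a) / e) / e) *\<^sub>R p x) (p a) < r"
  proof (rule eventually_at_rightI[of 0 "min d (T - a)"])
    show "0 < min d (T - a)" using d a by auto
    fix e assume "e \<in> {0<..<min d (T - a)}"
    then have e: "0 < e" "e < d" "a + e < T" by auto
    define k where "k x = \<rho> ((x - a) / e) / e" for x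
    have k0: "0 \<le> k x" for x using \<rho> e by (simp add: k_def)
    have ksupp: "k x = 0" if "x \<notin> {a..a+e}" for x
      using that e \<rho>(3)[of "(x - a) / e"] by (auto simp: k_def field_simps)
    have kc: "continuous_on UNIV k" unfolding k_def
      by (intro continuous_intros continuous_on_compose2[OF \<rho>(1)]) (use e in auto)
    have kint: "integrable (lebesgue_on {0<..<T}) k"
      by (rule continuous_integrable_lebesgue_on) (use kc continuous_on_subset in blast)
    have kpint: "integrable (lebesgue_on {0<..<T}) (\<lambda>x. k x *\<^sub>R p x)"
      by (rule continuous_integrable_lebesgue_on) (intro continuous_intros p continuous_on_subset[OF kc], auto)
    have "((\<lambda>x. S ((x - a) / e)) has_real_derivative k x) (at x)" for x
    proof -
      have "((\<lambda>x. (x - a) / e) has_real_derivative 1 / e) (at x)"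
        using e by (auto intro!: derivative_eq_intros)
      from DERIV_chain2[OF S(1) this] show ?thesis by (simp add: k_def)
    qed
    then have "((\<lambda>x. k x) has_integral (S ((T - a) / e) - S ((0 - a) / e))) {0..T}"
      by (intro fundamental_theorem_of_calculus[where f="\<lambda>x. S ((x - a) / e)"])
        (use a in \<open>auto simp: has_real_derivative_iff_has_vector_derivative[symmetric]
           intro: has_field_derivative_at_within\<close>)
    moreover have "S ((T - a) / e) = 1" using S(3) e by (simp add: field_simps)
    moreover have "S ((0 - a) / e) = 0" using S(2) e a by (simp add: field_simps)
    ultimately have "(k has_integral 1) {0..T}" by simp
    then have "(k has_integral 1) {0<..<T}"
      using has_integral_open_interval[of k 1 0 T] by simp
    then have k1: "(LINT x|lebesgue_on {0<..<T}. k x) = 1"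
      using lebesgue_integral_eq_integral[OF kint] by (simp add: integral_unique)
    have "(LINT x|lebesgue_on {0<..<T}. k x *\<^sub>R p x) - p a =
          (LINT x|lebesgue_on {0<..<T}. k x *\<^sub>R p x) - (LINT x|lebesgue_on {0<..<T}. k x *\<^sub>R p a)"
      using kint k1 by simp
    also have "\<dots> = (LINT x|lebesgue_on {0<..<T}. k x *\<^sub>R p x - k x *\<^sub>R p a)"
      using kpint kint by simp
    finally have eq: "(LINT x|lebesgue_on {0<..<T}. k x *\<^sub>R p x) - p a = 
      (LINT x|lebesgue_on {0<..<T}. k x *\<^sub>R p x - k x *\<^sub>R p a)" .
    have "norm (LINT x|lebesgue_on {0<..<T}. k x *\<^sub>R p x - k x *\<^sub>R p a)
       \<le> (LINT x|lebesgue_on {0<..<T}. norm (k x *\<^sub>R p x - k x *\<^sub>R p a))"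
      by simp
    also have "\<dots> \<le> (LINT x|lebesgue_on {0<..<T}. k x * (r / 2))"
    proof (rule integral_mono)
      show "integrable (lebesgue_on {0<..<T}) (\<lambda>x. norm (k x *\<^sub>R p x - k x *\<^sub>R p a))" 
        using kpint kint by simp
      show "integrable (lebesgue_on {0<..<T}) (\<lambda>x. k x * (r / 2))" using kint by simp
      fix x
      show "norm (k x *\<^sub>R p x - k x *\<^sub>R p a) \<le> k x * (r / 2)"
      proof (cases "x \<in> {a..a+e}")
        case True
        then have "norm (p x - p a) \<le> r / 2" using d(2)[of x] e by (simp add: dist_norm)
        then have "k x * norm (p x - p a) \<le> k x * (r / 2)" using k0[of x] by (rule mult_left_mono)
        then show ?thesis using k0[of x] by (simp only: scaleR_diff_right[symmetric] norm_scaleR abs_of_nonneg)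
      qed (simp add: ksupp)
    qed
    also have "\<dots> = r / 2" using k1 by simp
    finally show "dist (LINT x|lebesgue_on {0<..<T}. (\<rho> ((x - a) / e) / e) *\<^sub>R p x) (p a) < r"
      using \<open>0 < r\<close> eq by (simp add: k_def[symmetric] dist_norm)
  qed
qed

definition div_diff :: "(real \<Rightarrow> 'b::real_vector) \<Rightarrow> real \<Rightarrow> real \<Rightarrow> 'b" where
  "div_diff z s t = (1 / (t - s)) *\<^sub>R (z t - z s)"

lemma test_function_deriv:
  assumes "test_function T \<eta>"
  shows "test_function T (deriv \<eta>)"
proof -
  obtain c d where cd: "0 < c" "c \<le> d" "d < T" "\<And>t. t \<notin> {c..d} \<Longrightarrow> \<eta> t = 0" and 
     sm: "\<And>n t. ((deriv ^^ n) \<eta>) differentiable (at t)"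
    using assms unfolding test_function_def by blast
  have "deriv \<eta> t = 0" if "t \<notin> {c..d}" for t
  proof (rule DERIV_imp_deriv)
    have "((\<lambda>x. 0) has_real_derivative 0) (at t)" by simp
    then show "(\<eta> has_real_derivative 0) (at t)"
      by (rule has_field_derivative_transform_within_open[where S="- {c..d}"]) (use that cd(4) in auto)
  qed
  moreover have "((deriv ^^ n) (deriv \<eta>)) differentiable (at t)" for n t
    using sm[of "Suc n" t] by (simp add: funpow_swap1)
  ultimately show ?thesis unfolding test_function_def using cd by blast
qed

lemma smooth_test_function:
  assumes "smooth \<eta>" "0 < c" "c \<le> d" "d < T" "\<And>t. t \<notin> {c..d} \<Longrightarrow> \<eta> t = 0"
  shows "test_function T \<eta>"
  unfolding test_function_def using assms smooth_higher_deriv smooth_imp_differentiable by blast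

text \<open>
  Test the second weak derivative with a smoothed hat function whose kinks are at \<open>a\<close>, \<open>b\<close> and \<open>c\<close>. On
  one side its second derivative concentrates at the three kinks and yields the difference of the two
  divided differences of \<open>z\<close>; on the other side the hat function takes values in \<open>{0..1}\<close> and vanishes
  outside \<open>{a..c}\<close>. The bound involves \<open>z\<close> and the second weak derivative alone, because the first
  one is only known up to null sets.
\<close>

lemma div_diff_difference_bound_interior:
  fixes z w2 :: "real \<Rightarrow> 'b::{banach, second_countable_topology}"
  assumes z: "continuous_on {0..T} z"
    and weak: "has_weak_deriv T z w1" "has_weak_deriv T w1 w2" 
    and w2: "w2 \<in> borel_measurable (lebesgue_on {0<..<T})"
            "integrable (lebesgue_on {0<..<T}) (\<lambda>x. norm (w2 x))"
    and ord: "0 < a" "a < b" "b < c" "c < T"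
  shows "norm (div_diff z b c - div_diff z a b) \<le> integral {a..c} (\<lambda>x. norm (w2 x))"
proof -
  obtain \<rho> S G :: "real \<Rightarrow> real" where
    \<rho>: "smooth \<rho>" "\<And>x. 0 \<le> \<rho> x" "\<And>x. x \<notin> {0..1} \<Longrightarrow> \<rho> x = 0" and
    S: "\<And>x. (S has_real_derivative \<rho> x) (at x)" "\<And>x. x \<le> 0 \<Longrightarrow> S x = 0" "\<And>x. 1 \<le> x \<Longrightarrow> S x = 1" and
    G: "\<And>x. (G has_real_derivative S x) (at x)" "\<And>x. x \<le> 0 \<Longrightarrow> G x = 0"
      "\<And>x. \<bar>max x 0 - G x\<bar> \<le> 1" "\<And>x. 1 \<le> x \<Longrightarrow> G x = x - (1 - G 1)"
    by (rule smooth_bump_with_antiderivatives) blast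
  have smG: "smooth G" using G(1) S(1) \<rho>(1) by (blast intro: smooth.intros)
  have contrho: "continuous_on UNIV \<rho>"
    using \<rho>(1) by (meson DERIV_isCont smooth_cases continuous_at_imp_continuous_on)
  \<comment> \<open>The slopes of the hat function are \<open>p\<close>, \<open>- q\<close>, and the jumps of its derivative \<open>p\<close>, \<open>- (p + q)\<close>, \<open>q\<close>.\<close>
  define p q where "p = 1 / (b - a)" and "q = 1 / (c - b)"
  have pq: "0 < p" "0 < q" using ord by (auto simp: p_def q_def)
  have pq_id: "p * (b - a) = 1" "q * (c - b) = 1" using ord by (auto simp: p_def q_def)
  define hat where "hat x = p * max (x - a) 0 - (p + q) * max (x - b) 0 + q * max (x - c) 0" for x
  have hat: "\<bar>hat x\<bar> \<le> indicat_real {a..c} x" for x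
  proof -
    consider "x < a" | "a \<le> x" "x \<le> b" | "b < x" "x \<le> c" | "c < x" by linarith
    then show ?thesis
    proof cases
      case 2
      then have "hat x = p * (x - a)" using ord by (simp add: hat_def)
      moreover have "0 \<le> p * (x - a)" using pq 2 by simp
      moreover have "p * (x - a) \<le> p * (b - a)" using pq 2 by (intro mult_left_mono) auto
      ultimately show ?thesis using 2 ord pq_id by simp
    next
      case 3
      then have "hat x = p * (b - a) - q * (x - b)" using ord by (simp add: hat_def algebra_simps)
      moreover have "0 \<le> q * (x - b)" using pq 3 by simp
      moreover have "q * (x - b) \<le> q * (c - b)" using pq 3 by (intro mult_left_mono) auto
      ultimately show ?thesis using 3 ord pq_id by simp
    next
      case 4
      then have "hat x = p * (b - a) - q * (c - b)" using ord by (simp add: hat_def algebra_simps)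
      then show ?thesis using 4 pq_id by simp
    qed (use ord in \<open>simp add: hat_def\<close>)
  qed
  have "{a..c} \<in> sets (lebesgue_on {0<..<T})"
    by (subst sets_restrict_space_iff) (use ord in auto)
  then have iwi: "integrable (lebesgue_on {0<..<T}) (\<lambda>x. indicat_real {a..c} x * norm (w2 x))"
    by (intro Bochner_Integration.integrable_bound[OF w2(2)] borel_measurable_times borel_measurable_indicator AE_I2)
      (use w2(1) in \<open>auto simp: indicator_def\<close>)
  define I where "I = integral {a..c} (\<lambda>x. norm (w2 x))"
  define J where "J = (LINT x|lebesgue_on {0<..<T}. norm (w2 x))"
  define M where "M e = (LINT x|lebesgue_on {0<..<T}.
      ((p * (\<rho> ((x - a) / e) / e) - (p + q) * (\<rho> ((x - b) / e) / e) + q * (\<rho> ((x - c) / e) / e))) *\<^sub>R z x)" for e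
  have key: "norm (M e) \<le> I + 2 * (p + q) * e * J" if e: "0 < e" "c + e < T" for e
  proof -
    \<comment> \<open>The smoothed hat function: the ramps in \<open>hat\<close> are replaced by rescaled copies of \<open>G\<close>, up to an error of \<open>e\<close>.\<close>
    define g where "g a x = e * G ((x - a) / e)" for a x
    define \<eta> where "\<eta> x = p * g a x - (p + q) * g b x + q * g c x" for x
    define \<eta>1 where "\<eta>1 x = p * S ((x - a) / e) - (p + q) * S ((x - b) / e) + q * S ((x - c) / e)" for x
    define \<eta>2 where "\<eta>2 x = p * (\<rho> ((x - a) / e) / e) - (p + q) * (\<rho> ((x - b) / e) / e) + q * (\<rho> ((x - c) / e) / e)" for x
    have smg: "smooth (\<lambda>x. k * g s x)" for k s
      using smooth_affine[OF smG, of "k * e" "1 / e" "- s / e"] by (simp add: g_def diff_divide_distrib mult.assoc)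
    have sm\<eta>: "smooth \<eta>" unfolding \<eta>_def
      using smooth_add[OF smooth_add[OF smg[of p a] smg[of "-(p+q)" b]] smg[of q c]]
      by (simp only: mult_minus_left add_uminus_conv_diff)
    have gle: "g s x = 0" if "x \<le> s" for s x 
      using G(2)[of "(x - s) / e"] that e by (simp add: g_def field_simps)
    have gge: "g s x = x - s - e * (1 - G 1)" if "x \<ge> s + e" for s x
      using G(4)[of "(x - s) / e"] that e by (simp add: g_def field_simps)
    have gmax: "\<bar>max (x - s) 0 - g s x\<bar> \<le> e" for s x
    proof -
      have "max (x - s) 0 = e * max ((x - s) / e) 0" using e by (auto simp: max_def field_simps)
      then have "\<bar>max (x - s) 0 - g s x\<bar> = e * \<bar>max ((x - s) / e) 0 - G ((x - s) / e)\<bar>"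
        using e by (simp add: g_def abs_mult right_diff_distrib[symmetric])
      then show ?thesis using G(3)[of "(x - s) / e"] e by (simp add: mult_left_le)
    qed
    \<comment> \<open>To the right of \<open>c + e\<close> all three copies of \<open>G\<close> are affine and cancel.\<close>
    have supp: "\<eta> x = 0" if "x \<notin> {a..c+e}" for x
    proof (cases "x < a")
      case False
      then have "x > c + e" using that by auto
      then have "\<eta> x = p * (b - a) - q * (c - b)"
        using ord e by (simp add: \<eta>_def gge algebra_simps)
      then show ?thesis using pq_id by simp
    qed (use ord gle in \<open>simp add: \<eta>_def\<close>)
    have tf: "test_function T \<eta>"
      by (rule smooth_test_function[OF sm\<eta>, of a "c + e"]) (use ord e supp in auto)
    have d1: "deriv \<eta> = \<eta>1"
    proof
      fix x show "deriv \<eta> x = \<eta>1 x"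
        unfolding \<eta>_def g_def \<eta>1_def
        by (rule DERIV_imp_deriv) (use e in \<open>auto intro!: derivative_eq_intros DERIV_chain2[OF G(1)]\<close>)
    qed
    have d2: "deriv \<eta>1 = \<eta>2"
    proof
      fix x show "deriv \<eta>1 x = \<eta>2 x"
        unfolding \<eta>1_def \<eta>2_def
        by (rule DERIV_imp_deriv) (use e in \<open>auto intro!: derivative_eq_intros DERIV_chain2[OF S(1)] simp: mult.commute\<close>)
    qed
    have "M e = (LINT x|lebesgue_on {0<..<T}. deriv (deriv \<eta>) x *\<^sub>R z x)"
      unfolding M_def d1 d2 \<eta>2_def ..
    also have "\<dots> = (LINT x|lebesgue_on {0<..<T}. \<eta> x *\<^sub>R w2 x)"
      using weak tf test_function_deriv[OF tf] unfolding has_weak_deriv_def by simp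
    also have "norm \<dots> \<le> (LINT x|lebesgue_on {0<..<T}. norm (\<eta> x *\<^sub>R w2 x))"
      by (rule integral_norm_bound)
    also have "\<dots> \<le> (LINT x|lebesgue_on {0<..<T}. indicat_real {a..c} x * norm (w2 x) + 2 * (p + q) * e * norm (w2 x))"
    proof (rule integral_mono')
      show "integrable (lebesgue_on {0<..<T}) (\<lambda>x. indicat_real {a..c} x * norm (w2 x) + 2 * (p + q) * e * norm (w2 x))"
        using iwi w2 by simp
      fix x
      have "\<eta> x - hat x = p * (g a x - max (x - a) 0) + (p + q) * (max (x - b) 0 - g b x) + q * (g c x - max (x - c) 0)"
        by (simp add: \<eta>_def hat_def algebra_simps)
      also have "\<bar>\<dots>\<bar> \<le> p * e + (p + q) * e + q * e"
      proof -
        have "\<bar>k * y\<bar> \<le> k * e" if "0 < k" "\<bar>y\<bar> \<le> e" for k y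
          using that by (simp add: abs_mult)
        note scale = this
        have "0 < p + q" using pq by simp
        have gmax': "\<bar>g s x - max (x - s) 0\<bar> \<le> e" for s
          using gmax[of x s] by (subst abs_minus_commute)
        show ?thesis
          using scale[OF pq(1) gmax'[of a]] scale[OF \<open>0 < p + q\<close> gmax[of x b]] scale[OF pq(2) gmax'[of c]]
          by (intro order_trans[OF abs_triangle_ineq] add_mono) auto
      qed
      also have "\<dots> = 2 * (p + q) * e" by (simp add: algebra_simps)
      finally have "\<bar>\<eta> x\<bar> \<le> indicat_real {a..c} x + 2 * (p + q) * e" using hat[of x] by linarith
      from mult_right_mono[OF this norm_ge_zero[of "w2 x"]]
      show "norm (\<eta> x *\<^sub>R w2 x) \<le> indicat_real {a..c} x * norm (w2 x) + 2 * (p + q) * e * norm (w2 x)"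
        by (simp only: distrib_right norm_scaleR)
    qed (use e pq in simp)
    also have "\<dots> = I + 2 * (p + q) * e * J"
    proof -
      have "(LINT x|lebesgue_on {0<..<T}. indicat_real {a..c} x * norm (w2 x)) = 
        integral {0<..<T} (\<lambda>x. indicat_real {a..c} x * norm (w2 x))"
        by (rule lebesgue_integral_eq_integral[OF iwi]) simp
      also have "\<dots> = integral {0<..<T} (\<lambda>x. if x \<in> {a..c} then norm (w2 x) else 0)"
        by (rule integral_cong) (simp add: indicator_def)
      also have "\<dots> = integral ({a..c} \<inter> {0<..<T}) (\<lambda>x. norm (w2 x))"
        by (rule Henstock_Kurzweil_Integration.integral_restrict_Int)
      also have "{a..c} \<inter> {0<..<T} = {a..c}" using ord by auto
      finally show ?thesis using iwi w2 by (simp add: I_def J_def)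
    qed
    finally show ?thesis .
  qed
  have "((\<lambda>e. p *\<^sub>R (LINT x|lebesgue_on {0<..<T}. (\<rho> ((x - a) / e) / e) *\<^sub>R z x)
      - (p + q) *\<^sub>R (LINT x|lebesgue_on {0<..<T}. (\<rho> ((x - b) / e) / e) *\<^sub>R z x)
      + q *\<^sub>R (LINT x|lebesgue_on {0<..<T}. (\<rho> ((x - c) / e) / e) *\<^sub>R z x)) \<longlongrightarrow>
      p *\<^sub>R z a - (p + q) *\<^sub>R z b + q *\<^sub>R z c) (at_right 0)"
    by (intro tendsto_intros approximate_identity_tendsto[OF contrho \<rho>(2,3) S z]) (use ord in auto)
  note l0 = this
  have eq: "p *\<^sub>R z a - (p + q) *\<^sub>R z b + q *\<^sub>R z c = div_diff z b c - div_diff z a b"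
    by (simp add: div_diff_def p_def q_def algebra_simps)
  have ev: "\<forall>\<^sub>F e in at_right 0. p *\<^sub>R (LINT x|lebesgue_on {0<..<T}. (\<rho> ((x - a) / e) / e) *\<^sub>R z x)
      - (p + q) *\<^sub>R (LINT x|lebesgue_on {0<..<T}. (\<rho> ((x - b) / e) / e) *\<^sub>R z x)
      + q *\<^sub>R (LINT x|lebesgue_on {0<..<T}. (\<rho> ((x - c) / e) / e) *\<^sub>R z x) = M e"
  proof (rule eventually_at_rightI[of 0 1])
    fix e :: real assume e: "e \<in> {0<..<1}"
    have int: "integrable (lebesgue_on {0<..<T}) (\<lambda>x. (\<rho> ((x - s) / e) / e) *\<^sub>R z x)" for s
      by (rule continuous_integrable_lebesgue_on)
        (intro continuous_intros z continuous_on_compose2[OF contrho], use e in auto)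
    show "p *\<^sub>R (LINT x|lebesgue_on {0<..<T}. (\<rho> ((x - a) / e) / e) *\<^sub>R z x)
      - (p + q) *\<^sub>R (LINT x|lebesgue_on {0<..<T}. (\<rho> ((x - b) / e) / e) *\<^sub>R z x)
      + q *\<^sub>R (LINT x|lebesgue_on {0<..<T}. (\<rho> ((x - c) / e) / e) *\<^sub>R z x) = M e"
      unfolding M_def scaleR_add_left scaleR_diff_left scaleR_scaleR[symmetric]
      using int by (simp del: scaleR_scaleR)
  qed auto
  have lim: "(M \<longlongrightarrow> div_diff z b c - div_diff z a b) (at_right 0)"
    using Lim_transform_eventually[OF l0 ev] unfolding eq .
  have lim2: "((\<lambda>e. I + 2 * (p + q) * e * J) \<longlongrightarrow> I + 2 * (p + q) * 0 * J) (at_right 0)"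
    by (intro tendsto_intros)
  have "\<forall>\<^sub>F e in at_right 0. norm (M e) \<le> I + 2 * (p + q) * e * J"
    by (rule eventually_at_rightI[of 0 "T - c"]) (use key ord in auto)
  from tendsto_le[OF _ lim2 tendsto_norm[OF lim] this]
  show ?thesis by (simp add: I_def)
qed

lemma div_diff_sym: "div_diff z s t = div_diff z t s"
proof -
  have "(1 / (t - s)) *\<^sub>R (z t - z s) = (- (1 / (t - s))) *\<^sub>R (z s - z t)"
    by (simp add: scaleR_minus_left scaleR_minus_right[symmetric])
  also have "- (1 / (t - s)) = 1 / (s - t)" by (simp add: minus_divide_right)
  finally show ?thesis by (simp add: div_diff_def)
qed

lemma div_diff_convex_combination:
  assumes "a < b" "b < c"
  shows "div_diff z a c = ((b - a) / (c - a)) *\<^sub>R div_diff z a b + ((c - b) / (c - a)) *\<^sub>R div_diff z b c"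
  using assms by (simp add: div_diff_def scaleR_add_right[symmetric])

text \<open>
  The assumption compares the divided differences over two adjacent intervals. The divided difference
  over their union is a convex combination of these two, hence obeys the same bound, which covers
  every position of the common point \<open>t\<close> relative to \<open>s\<close> and \<open>r\<close>.
\<close>

lemma div_diff_common_point_bound:
  fixes z :: "real \<Rightarrow> 'b::real_normed_vector"
  assumes bound: "\<And>a b c. 0 \<le> a \<Longrightarrow> a < b \<Longrightarrow> b < c \<Longrightarrow> c \<le> T \<Longrightarrow>
       norm (div_diff z b c - div_diff z a b) \<le> \<Phi> c - \<Phi> a"
    and mono: "mono_on {0..T} \<Phi>"
    and mem: "{t, s, r} \<subseteq> {0..T}" "s \<noteq> t" "r \<noteq> t"
    and lo: "lo \<in> {0..T}" "lo \<le> t" "lo \<le> s" "lo \<le> r"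
    and hi: "hi \<in> {0..T}" "t \<le> hi" "s \<le> hi" "r \<le> hi"
  shows "norm (div_diff z t s - div_diff z t r) \<le> \<Phi> hi - \<Phi> lo"
  using mem lo hi
proof (induction s r rule: linorder_wlog)
  case (le s r)
  have \<Phi>: "\<Phi> y - \<Phi> x \<le> \<Phi> hi - \<Phi> lo" if "lo \<le> x" "x \<le> y" "y \<le> hi" for x y
    using mono_onD[OF mono, of y hi] mono_onD[OF mono, of lo x] that le by (auto simp: algebra_simps)
  have tri: "norm (div_diff z c b - div_diff z a b) \<le> \<Phi> c - \<Phi> a \<and>
    norm (div_diff z a c - div_diff z a b) \<le> \<Phi> c - \<Phi> a \<and> norm (div_diff z a c - div_diff z b c) \<le> \<Phi> c - \<Phi> a"
    if "0 \<le> a" "a < b" "b < c" "c \<le> T" for a b c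
  proof -
    define x y where "x = div_diff z a b" and "y = div_diff z b c"
    define p q where "p = (b - a) / (c - a)" and "q = (c - b) / (c - a)"
    have pq: "0 \<le> p" "0 \<le> q" "p + q = 1"
      using that by (auto simp: p_def q_def add_divide_distrib[symmetric])
    then have "p \<le> 1" "q \<le> 1" by auto
    have ac: "div_diff z a c = p *\<^sub>R x + q *\<^sub>R y"
      using div_diff_convex_combination[of a b c z] that by (simp add: x_def y_def p_def q_def)
    have xy: "norm (y - x) \<le> \<Phi> c - \<Phi> a" using bound that by (simp add: x_def y_def)
    have p1: "p = 1 - q" using pq by simp
    have q1: "q = 1 - p" using pq by simp
    have "div_diff z a c - x = q *\<^sub>R (y - x)" unfolding ac p1 by (simp add: algebra_simps)
    then have "norm (div_diff z a c - x) \<le> norm (y - x)" using pq \<open>p \<le> 1\<close> \<open>q \<le> 1\<close> by (simp add: mult_left_le_one_le)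
    moreover have "div_diff z a c - y = p *\<^sub>R (x - y)" unfolding ac q1 by (simp add: algebra_simps)
    then have "norm (div_diff z a c - y) \<le> norm (x - y)" using pq \<open>p \<le> 1\<close> \<open>q \<le> 1\<close> by (simp add: mult_left_le_one_le)
    ultimately show ?thesis using xy by (simp add: x_def y_def norm_minus_commute div_diff_sym[of z c b])
  qed
  have pos: "0 \<le> \<Phi> hi - \<Phi> lo" using \<Phi>[of lo lo] le by simp
  consider "s = r" | "t < s" "s < r" | "s < t" "t < r" | "s < r" "r < t" using le by fastforce
  then show ?case
  proof cases
    case 2
    have "norm (div_diff z t s - div_diff z t r) \<le> \<Phi> r - \<Phi> t"
      using tri[of t s r] 2 le by (simp add: norm_minus_commute)
    then show ?thesis using \<Phi>[of t r] 2 le by simp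
  next
    case 3
    have "norm (div_diff z t s - div_diff z t r) \<le> \<Phi> r - \<Phi> s"
      using tri[of s t r] 3 le by (simp add: norm_minus_commute div_diff_sym[of z t])
    then show ?thesis using \<Phi>[of s r] 3 le by simp
  next
    case 4
    have "norm (div_diff z t s - div_diff z t r) \<le> \<Phi> t - \<Phi> s"
      using tri[of s r t] 4 le by (simp add: norm_minus_commute div_diff_sym[of z t])
    then show ?thesis using \<Phi>[of s t] 4 le by simp
  qed (use pos in simp)
next
  case (sym s r)
  then show ?case by (simp add: norm_minus_commute insert_commute)
qed

text \<open>
  By the previous bound and the continuity of \<open>\<Phi>\<close> the difference quotients at \<open>t\<close> form a Cauchy filter;
  its limit is the derivative. Letting one of the two points tend to \<open>t\<close> bounds the distance between
  a divided difference and the derivative by the increment of \<open>\<Phi>\<close>, and continuity of the derivative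
  follows by comparing two derivatives with the same divided difference.
\<close>

lemma C1_if_div_diff_bound:
  fixes z :: "real \<Rightarrow> 'b::banach"
  assumes T: "0 < T"
    and bound: "\<And>a b c. 0 \<le> a \<Longrightarrow> a < b \<Longrightarrow> b < c \<Longrightarrow> c \<le> T \<Longrightarrow>
       norm (div_diff z b c - div_diff z a b) \<le> \<Phi> c - \<Phi> a"
    and mono: "mono_on {0..T} \<Phi>" and cont: "continuous_on {0..T} \<Phi>"
  obtains v where "continuous_on {0..T} v"
    "\<And>t. t \<in> {0..T} \<Longrightarrow> (z has_vector_derivative v t) (at t within {0..T})"
    "\<And>s t. 0 \<le> s \<Longrightarrow> s < t \<Longrightarrow> t \<le> T \<Longrightarrow> norm (div_diff z s t - v t) \<le> \<Phi> t - \<Phi> s"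
proof -
  note common = div_diff_common_point_bound[of T z \<Phi>, OF bound mono]
  have nt: "at t within {0..T} \<noteq> bot" if "t \<in> {0..T}" for t
    using T that by (simp add: trivial_limit_within islimpt_Icc)
  have ex: "\<exists>l. (div_diff z t \<longlongrightarrow> l) (at t within {0..T})" if t: "t \<in> {0..T}" for t
  proof -
    have "cauchy_filter (filtermap (div_diff z t) (at t within {0..T}))"
      unfolding cauchy_filter_metric_filtermap
    proof (intro allI impI)
      fix e :: real assume "0 < e"
      then obtain d where d: "0 < d" "\<And>x. x \<in> {0..T} \<Longrightarrow> dist x t < d \<Longrightarrow> dist (\<Phi> x) (\<Phi> t) < e / 2"
        using cont t unfolding continuous_on_iff by (meson half_gt_zero)
      define Q where "Q x \<longleftrightarrow> x \<in> {0..T} \<and> x \<noteq> t \<and> dist x t < d" for x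
      have "eventually Q (at t within {0..T})"
        unfolding eventually_at Q_def using d(1) by blast
      moreover have "dist (div_diff z t x) (div_diff z t y) < e" if "Q x" "Q y" for x y
      proof -
        define lo hi where "lo = min t (min x y)" and "hi = max t (max x y)"
        have "norm (div_diff z t x - div_diff z t y) \<le> \<Phi> hi - \<Phi> lo"
          by (rule common) (use that t in \<open>auto simp: Q_def lo_def hi_def\<close>)
        moreover have "dist (\<Phi> hi) (\<Phi> t) < e / 2" "dist (\<Phi> lo) (\<Phi> t) < e / 2"
          using that t d by (auto simp: Q_def lo_def hi_def max_def min_def)
        ultimately show ?thesis unfolding dist_norm real_norm_def by linarith
      qed
      ultimately show "\<exists>P. eventually P (at t within {0..T}) \<and> (\<forall>x y. P x \<and> P y \<longrightarrow> dist (div_diff z t x) (div_diff z t y) < e)"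
        by blast
    qed
    then have "\<exists>l. filtermap (div_diff z t) (at t within {0..T}) \<le> nhds l"
      by (rule cauchy_filter_complete_converges[OF _ complete_UNIV]) (use nt[OF t] in \<open>auto simp: filtermap_bot_iff\<close>)
    then obtain l where "filtermap (div_diff z t) (at t within {0..T}) \<le> nhds l" by blast
    then show ?thesis unfolding filterlim_def by blast
  qed
  then obtain v where v: "\<And>t. t \<in> {0..T} \<Longrightarrow> (div_diff z t \<longlongrightarrow> v t) (at t within {0..T})" by metis
  have near: "norm (div_diff z t s - v t) \<le> \<Phi> hi - \<Phi> lo"
    if "t \<in> {0..T}" "s \<in> {0..T}" "s \<noteq> t" "lo = min s t" "hi = max s t" for s t lo hi
  proof -
    have phi: "((\<lambda>r. \<Phi> (max hi r) - \<Phi> (min lo r)) \<longlongrightarrow> \<Phi> (max hi t) - \<Phi> (min lo t)) (at t within {0..T})"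
    proof (intro tendsto_diff)
      show "((\<lambda>r. \<Phi> (max hi r)) \<longlongrightarrow> \<Phi> (max hi t)) (at t within {0..T})"
      proof (rule continuous_on_tendsto_compose[OF cont])
        show "((\<lambda>r. max hi r) \<longlongrightarrow> max hi t) (at t within {0..T})"
          by (intro tendsto_max tendsto_const tendsto_ident_at)
        show "\<forall>\<^sub>F r in at t within {0..T}. max hi r \<in> {0..T}"
          unfolding eventually_at_filter using that by (intro always_eventually) auto
      qed (use that in auto)
      show "((\<lambda>r. \<Phi> (min lo r)) \<longlongrightarrow> \<Phi> (min lo t)) (at t within {0..T})"
      proof (rule continuous_on_tendsto_compose[OF cont])
        show "((\<lambda>r. min lo r) \<longlongrightarrow> min lo t) (at t within {0..T})"
          by (intro tendsto_min tendsto_const tendsto_ident_at)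
        show "\<forall>\<^sub>F r in at t within {0..T}. min lo r \<in> {0..T}"
          unfolding eventually_at_filter using that by (intro always_eventually) auto
      qed (use that in auto)
    qed
    have "norm (div_diff z t s - v t) \<le> \<Phi> (max hi t) - \<Phi> (min lo t)"
    proof (rule tendsto_le[OF nt[OF that(1)] phi])
      show "((\<lambda>r. norm (div_diff z t s - div_diff z t r)) \<longlongrightarrow> norm (div_diff z t s - v t)) (at t within {0..T})"
        by (intro tendsto_intros v that)
      show "\<forall>\<^sub>F r in at t within {0..T}. norm (div_diff z t s - div_diff z t r) \<le> \<Phi> (max hi r) - \<Phi> (min lo r)"
        unfolding eventually_at_filter
      proof (intro always_eventually allI impI)
        fix r assume "r \<noteq> t" "r \<in> {0..T}"
        then show "norm (div_diff z t s - div_diff z t r) \<le> \<Phi> (max hi r) - \<Phi> (min lo r)"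
          by (intro common) (use that in auto)
      qed
    qed
    moreover have "max hi t = hi" "min lo t = lo" using that by auto
    ultimately show ?thesis by simp
  qed
  have close: "norm (v t - v s) \<le> 2 * \<bar>\<Phi> t - \<Phi> s\<bar>" if "t \<in> {0..T}" "s \<in> {0..T}" for s t
  proof (cases "s = t")
    case False
    define lo hi where "lo = min s t" and "hi = max s t"
    have "norm (div_diff z t s - v t) \<le> \<Phi> hi - \<Phi> lo"
      by (rule near) (use that False in \<open>auto simp: lo_def hi_def\<close>)
    moreover have "norm (div_diff z s t - v s) \<le> \<Phi> hi - \<Phi> lo"
      by (rule near) (use that False in \<open>auto simp: lo_def hi_def\<close>)
    ultimately have "norm (v t - v s) \<le> 2 * (\<Phi> hi - \<Phi> lo)"
      using norm_triangle_ineq4[of "div_diff z s t - v s" "div_diff z t s - v t"]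
      by (simp add: div_diff_sym[of z s t])
    moreover have "\<Phi> hi - \<Phi> lo \<le> \<bar>\<Phi> t - \<Phi> s\<bar>" by (auto simp: lo_def hi_def max_def min_def)
    ultimately show ?thesis by (meson mult_left_mono order_trans zero_le_numeral)
  qed auto
  show ?thesis
  proof (rule that)
    show "continuous_on {0..T} v"
      unfolding continuous_on_iff
    proof (intro ballI allI impI)
      fix x and e :: real assume x: "x \<in> {0..T}" and "0 < e"
      then obtain d where d: "0 < d" "\<And>x'. x' \<in> {0..T} \<Longrightarrow> dist x' x < d \<Longrightarrow> dist (\<Phi> x') (\<Phi> x) < e / 2"
        using cont unfolding continuous_on_iff by (meson half_gt_zero)
      have "dist (v x') (v x) < e" if "x' \<in> {0..T}" "dist x' x < d" for x'
        using close[OF that(1) x] d(2)[OF that] by (simp add: dist_norm)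
      then show "\<exists>d>0. \<forall>x'\<in>{0..T}. dist x' x < d \<longrightarrow> dist (v x') (v x) < e" using d(1) by blast
    qed
    show "(z has_vector_derivative v t) (at t within {0..T})" if "t \<in> {0..T}" for t
      unfolding has_vector_derivative_def has_derivative_at_within
    proof (intro conjI bounded_linear_scaleR_left)
      have "((\<lambda>y. norm (div_diff z t y - v t)) \<longlongrightarrow> 0) (at t within {0..T})"
        using v[OF that] by (intro tendsto_norm_zero) (simp add: LIM_zero_iff)
      moreover have "norm (div_diff z t y - v t) = norm ((z y - z t - (y - t) *\<^sub>R v t) /\<^sub>R norm (y - t))"
        if "y \<noteq> t" for y
      proof -
        have "z y - z t - (y - t) *\<^sub>R v t = (y - t) *\<^sub>R (div_diff z t y - v t)"
          using that by (simp add: div_diff_def scaleR_diff_right)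
        then show ?thesis using that by (simp add: divide_inverse[symmetric] norm_divide abs_mult)
      qed
      then have "\<forall>\<^sub>F y in at t within {0..T}. norm (div_diff z t y - v t) = norm ((z y - z t - (y - t) *\<^sub>R v t) /\<^sub>R norm (y - t))"
        by (simp add: eventually_at_filter)
      ultimately have "((\<lambda>y. norm ((z y - z t - (y - t) *\<^sub>R v t) /\<^sub>R norm (y - t))) \<longlongrightarrow> 0) (at t within {0..T})"
        by (rule Lim_transform_eventually)
      then show "((\<lambda>y. (z y - z t - (y - t) *\<^sub>R v t) /\<^sub>R norm (y - t)) \<longlongrightarrow> 0) (at t within {0..T})"
        by (rule tendsto_norm_zero_cancel)
    qed
    show "norm (div_diff z s t - v t) \<le> \<Phi> t - \<Phi> s" if "0 \<le> s" "s < t" "t \<le> T" for s t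
      using near[of t s s t] that by (simp add: div_diff_sym)
  qed
qed

lemma L2_time_norm_integrable:
  assumes "L2_time T w"
  shows "integrable (lebesgue_on {0<..<T}) (\<lambda>x. norm (w x))"
proof -
  have "integrable (lebesgue_on {0<..<T}) (\<lambda>x. 1 :: real)"
    by (intro finite_measure.integrable_const finite_measure_lebesgue_on) simp
  then have "integrable (lebesgue_on {0<..<T}) (\<lambda>x. 1 + (norm (w x))\<^sup>2)"
    using assms unfolding L2_time_def by (intro Bochner_Integration.integrable_add) auto
  then show ?thesis
  proof (rule Bochner_Integration.integrable_bound)
    show "(\<lambda>x. norm (w x)) \<in> borel_measurable (lebesgue_on {0<..<T})"
      using assms unfolding L2_time_def by auto
    have "norm (w x) \<le> 1 + (norm (w x))\<^sup>2" for x
      using zero_le_power2[of "norm (w x) - 1"] by (simp add: power2_diff) (smt (verit) norm_ge_zero)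
    then show "AE x in lebesgue_on {0<..<T}. norm (norm (w x)) \<le> norm (1 + (norm (w x))\<^sup>2)"
      by (intro AE_I2) (metis abs_ge_self norm_ge_zero abs_of_nonneg order_trans real_norm_def)
  qed
qed

text \<open>
  The integral of \<open>(g x - c)\<^sup>2\<close> is nonnegative, where \<open>c\<close> is the mean value of \<open>g\<close>.
\<close>

lemma integral_squared_le:
  fixes g :: "real \<Rightarrow> real"
  assumes "s < t" "g integrable_on {s..t}" "(\<lambda>x. (g x)\<^sup>2) integrable_on {s..t}"
  shows "(integral {s..t} g)\<^sup>2 \<le> (t - s) * integral {s..t} (\<lambda>x. (g x)\<^sup>2)"
proof -
  define A B c where "A = integral {s..t} g" and "B = integral {s..t} (\<lambda>x. (g x)\<^sup>2)" and "c = A / (t - s)"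
  have "((\<lambda>x. (g x)\<^sup>2 - 2 * c * g x + c\<^sup>2) has_integral B - 2 * c * A + (t - s) * c\<^sup>2) {s..t}"
    unfolding A_def B_def using assms has_integral_const_real[of "c\<^sup>2" s t]
    by (intro has_integral_add has_integral_diff has_integral_mult_right integrable_integral) auto
  moreover have "0 \<le> (g x)\<^sup>2 - 2 * c * g x + c\<^sup>2" for x
    using zero_le_power2[of "g x - c"] by (simp add: power2_diff algebra_simps)
  ultimately have "0 \<le> B - 2 * c * A + (t - s) * c\<^sup>2" by (rule has_integral_nonneg)
  also have "(t - s) * c\<^sup>2 = c * A" using assms(1) by (simp add: c_def power2_eq_square)
  finally have "A * c \<le> B" by (simp add: algebra_simps)
  then have "A\<^sup>2 \<le> (t - s) * B" using assms(1) by (simp add: c_def power2_eq_square field_simps)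
  then show ?thesis by (simp add: A_def B_def)
qed

text \<open>
  Take for \<open>\<Phi>\<close> the primitive of the norm of the second weak derivative; the end points of the time
  interval are reached by continuity. The function \<open>\<Psi>\<close> is the primitive of the squared norm, and the
  last estimate is the Cauchy--Schwarz inequality for the increment of \<open>\<Phi>\<close>. It is the consistency
  estimate of the backward difference, in a form that telescopes when summed over a time grid.
\<close>

lemma W22_imp_C1:
  fixes z :: "real \<Rightarrow> 'b::{banach, second_countable_topology}"
  assumes T: "0 < T" and z: "continuous_on {0..T} z" and W: "W22 T z"
  obtains v \<Psi> where "continuous_on {0..T} v"
    "\<And>t. t \<in> {0..T} \<Longrightarrow> (z has_vector_derivative v t) (at t within {0..T})"
    "\<And>s t. 0 \<le> s \<Longrightarrow> s < t \<Longrightarrow> t \<le> T \<Longrightarrow> (norm (div_diff z s t - v t))\<^sup>2 \<le> (t - s) * (\<Psi> t - \<Psi> s)"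
proof -
  obtain w1 w2 where w: "has_weak_deriv T z w1" "L2_time T w2" "has_weak_deriv T w1 w2"
    using W unfolding W22_def by blast
  have i1: "integrable (lebesgue_on {0<..<T}) (\<lambda>x. norm (w2 x))" using L2_time_norm_integrable w by blast
  have i2: "integrable (lebesgue_on {0<..<T}) (\<lambda>x. (norm (w2 x))\<^sup>2)" using w unfolding L2_time_def by blast
  have hk: "g integrable_on {0..T}" if "integrable (lebesgue_on {0<..<T}) g" for g :: "real \<Rightarrow> real"
    using integrable_on_lebesgue_on[OF that] by (simp add: integrable_on_open_interval_real)
  define g1 g2 where "g1 x = norm (w2 x)" and "g2 x = (g1 x)\<^sup>2" for x
  have g1: "g1 integrable_on {0..T}" using hk[OF i1] by (simp add: g1_def[abs_def])
  have g2: "g2 integrable_on {0..T}" using hk[OF i2] by (simp add: g2_def[abs_def] g1_def)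
  define \<Phi> \<Psi> where "\<Phi> t = integral {0..t} g1" and "\<Psi> t = integral {0..t} g2" for t
  have sub: "g integrable_on {s..t}" if "g integrable_on {0..T}" "0 \<le> s" "t \<le> T" for g :: "real \<Rightarrow> real" and s t
    using integrable_on_subinterval[OF that(1)] that by auto
  have diff: "integral {0..t} g - integral {0..s} g = integral {s..t} g"
    if "g integrable_on {0..T}" "0 \<le> s" "s \<le> t" "t \<le> T" for g :: "real \<Rightarrow> real" and s t
    using Henstock_Kurzweil_Integration.integral_combine[of 0 s t g] sub[OF that(1), of 0 t] that by simp
  have cont: "continuous_on {0..T} \<Phi>" unfolding \<Phi>_def
    using indefinite_integral_continuous_1[OF g1] .
  have mono: "mono_on {0..T} \<Phi>"
  proof (rule mono_onI)
    fix r s assume "r \<in> {0..T}" "s \<in> {0..T}" "r \<le> s"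
    then have "\<Phi> s - \<Phi> r = integral {r..s} g1" unfolding \<Phi>_def by (intro diff g1) auto
    also have "\<dots> \<ge> 0" by (rule integral_nonneg) (use sub[OF g1] \<open>r \<in> _\<close> \<open>s \<in> _\<close> in \<open>auto simp: g1_def\<close>)
    finally show "\<Phi> r \<le> \<Phi> s" by simp
  qed
  have interior: "norm (div_diff z b c - div_diff z a b) \<le> \<Phi> c - \<Phi> a" if "0 < a" "a < b" "b < c" "c < T" for a b c
  proof -
    have "norm (div_diff z b c - div_diff z a b) \<le> integral {a..c} g1"
      unfolding g1_def
      by (rule div_diff_difference_bound_interior[OF z w(1,3) _ i1 that]) (use w in \<open>simp add: L2_time_def\<close>)
    also have "\<dots> = \<Phi> c - \<Phi> a" unfolding \<Phi>_def by (rule diff[OF g1, symmetric]) (use that in auto)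
    finally show ?thesis .
  qed
  have bound: "norm (div_diff z b c - div_diff z a b) \<le> \<Phi> c - \<Phi> a" if "0 \<le> a" "a < b" "b < c" "c \<le> T" for a b c
  proof (rule tendsto_le)
    define d where "d = min (b - a) (c - b)"
    have d: "0 < d" "d \<le> b - a" "d \<le> c - b" using that by (auto simp: d_def)
    have ev: "\<forall>\<^sub>F e in at_right 0. 0 < e \<and> e < d"
      using d(1) by (intro eventually_at_rightI[of 0 d]) auto
    have lim: "((\<lambda>e. g (c - e)) \<longlongrightarrow> g c) (at_right 0)" "((\<lambda>e. g (a + e)) \<longlongrightarrow> g a) (at_right 0)"
      if "continuous_on {0..T} g" for g :: "real \<Rightarrow> 'c::topological_space"
    proof -
      have "((\<lambda>e. c - e) \<longlongrightarrow> c - 0) (at_right 0)" "((\<lambda>e. a + e) \<longlongrightarrow> a + 0) (at_right 0)"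
        by (intro tendsto_intros)+
      moreover have "\<forall>\<^sub>F e in at_right 0. c - e \<in> {0..T}" "\<forall>\<^sub>F e in at_right 0. a + e \<in> {0..T}"
        using ev by (eventually_elim, use d \<open>0 \<le> a\<close> \<open>a < b\<close> \<open>b < c\<close> \<open>c \<le> T\<close> in auto)+
      ultimately show "((\<lambda>e. g (c - e)) \<longlongrightarrow> g c) (at_right 0)" "((\<lambda>e. g (a + e)) \<longlongrightarrow> g a) (at_right 0)"
        using \<open>0 \<le> a\<close> \<open>a < b\<close> \<open>b < c\<close> \<open>c \<le> T\<close>
        by (auto intro!: continuous_on_tendsto_compose[OF that])
    qed
    have "((\<lambda>e. norm (div_diff z b (c - e) - div_diff z (a + e) b)) \<longlongrightarrow>
      norm ((1 / ((c - 0) - b)) *\<^sub>R (z c - z b) - (1 / (b - (a + 0))) *\<^sub>R (z b - z a))) (at_right 0)"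
      unfolding div_diff_def by (intro tendsto_intros lim z) (use that in auto)
    then show "((\<lambda>e. norm (div_diff z b (c - e) - div_diff z (a + e) b)) \<longlongrightarrow> norm (div_diff z b c - div_diff z a b)) (at_right 0)"
      by (simp add: div_diff_def)
    show "((\<lambda>e. \<Phi> (c - e) - \<Phi> (a + e)) \<longlongrightarrow> \<Phi> c - \<Phi> a) (at_right 0)"
      by (intro tendsto_intros lim cont)
    show "\<forall>\<^sub>F e in at_right 0. norm (div_diff z b (c - e) - div_diff z (a + e) b) \<le> \<Phi> (c - e) - \<Phi> (a + e)"
      using ev by eventually_elim (rule interior, use d that in auto)
  qed simp
  obtain v where v: "continuous_on {0..T} v"
    "\<And>t. t \<in> {0..T} \<Longrightarrow> (z has_vector_derivative v t) (at t within {0..T})"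
    "\<And>s t. 0 \<le> s \<Longrightarrow> s < t \<Longrightarrow> t \<le> T \<Longrightarrow> norm (div_diff z s t - v t) \<le> \<Phi> t - \<Phi> s"
    using C1_if_div_diff_bound[OF T bound mono cont] by blast
  show ?thesis
  proof (rule that[OF v(1,2)])
    fix s t assume st: "0 \<le> s" "s < t" "t \<le> T"
    have "(norm (div_diff z s t - v t))\<^sup>2 \<le> (\<Phi> t - \<Phi> s)\<^sup>2" using v(3)[OF st] by (intro power_mono) auto
    also have "\<Phi> t - \<Phi> s = integral {s..t} g1" unfolding \<Phi>_def using st by (intro diff g1) auto
    also have "(integral {s..t} g1)\<^sup>2 \<le> (t - s) * integral {s..t} (\<lambda>x. (g1 x)\<^sup>2)"
      using st sub[OF g1] sub[OF g2] by (intro integral_squared_le) (auto simp: g2_def[abs_def])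
    also have "integral {s..t} (\<lambda>x. (g1 x)\<^sup>2) = \<Psi> t - \<Psi> s"
      unfolding \<Psi>_def g2_def[symmetric] using st by (intro diff[symmetric] g2) auto
    finally show "(norm (div_diff z s t - v t))\<^sup>2 \<le> (t - s) * (\<Psi> t - \<Psi> s)" .
  qed
qed

text \<open>
  Integration by parts shows that \<open>p' - G\<close> is orthogonal to all test functions. Test functions that
  concentrate at an interior point show that it vanishes there, and continuity gives the end points.
\<close>

lemma weak_derivative_eq_derivative:
  fixes p p' G :: "real \<Rightarrow> real"
  assumes T: "0 < T" 
    and der: "\<And>t. t \<in> {0..T} \<Longrightarrow> (p has_real_derivative p' t) (at t within {0..T})"
    and p': "continuous_on {0..T} p'" and G: "continuous_on {0..T} G"
    and weak: "\<And>\<eta>. test_function T \<eta> \<Longrightarrow>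
      (LINT t|lebesgue_on {0<..<T}. deriv \<eta> t * p t) = - (LINT t|lebesgue_on {0<..<T}. \<eta> t * G t)"
    and t: "t \<in> {0..T}"
  shows "p' t = G t"
proof -
  obtain \<rho> S Q :: "real \<Rightarrow> real" where
    \<rho>: "smooth \<rho>" "\<And>x. 0 \<le> \<rho> x" "\<And>x. x \<notin> {0..1} \<Longrightarrow> \<rho> x = 0" and
    S: "\<And>x. (S has_real_derivative \<rho> x) (at x)" "\<And>x. x \<le> 0 \<Longrightarrow> S x = 0" "\<And>x. 1 \<le> x \<Longrightarrow> S x = 1"
    by (rule smooth_bump_with_antiderivatives) blast
  obtain \<rho>' where \<rho>': "\<And>x. (\<rho> has_real_derivative \<rho>' x) (at x)" "smooth \<rho>'" using \<rho>(1) smooth_cases by blast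
  have contrho: "continuous_on A \<rho>" "continuous_on A \<rho>'" for A
    using \<rho>(1) \<rho>'(2) by (meson DERIV_isCont smooth_cases continuous_at_imp_continuous_on)+
  have contp: "continuous_on {0..T} p"
    using der by (meson DERIV_continuous_on)
  have inner_eq: "p' a - G a = 0" if a: "0 < a" "a < T" for a
  proof -
    have "((\<lambda>e. LINT x|lebesgue_on {0<..<T}. (\<rho> ((x - a) / e) / e) *\<^sub>R (p' x - G x)) \<longlongrightarrow> p' a - G a) (at_right 0)"
      by (intro approximate_identity_tendsto[OF contrho(1) \<rho>(2,3) S] continuous_intros p' G a)
    moreover have "\<forall>\<^sub>F e in at_right 0. (LINT x|lebesgue_on {0<..<T}. (\<rho> ((x - a) / e) / e) *\<^sub>R (p' x - G x)) = 0"
    proof (rule eventually_at_rightI[of 0 "T - a"])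
      fix e assume "e \<in> {0<..<T - a}"
      then have e: "0 < e" "a + e < T" by auto
      define \<eta> where "\<eta> x = \<rho> ((x - a) / e) / e" for x
      define \<eta>1 where "\<eta>1 x = \<rho>' ((x - a) / e) / e / e" for x
      have supp: "\<eta> x = 0" if "x \<notin> {a..a+e}" for x
        using that e \<rho>(3)[of "(x - a) / e"] by (auto simp: \<eta>_def field_simps)
      have "smooth \<eta>"
        using smooth_affine[OF \<rho>(1), of "1 / e" "1 / e" "- a / e"] by (simp add: \<eta>_def[abs_def] diff_divide_distrib)
      then have tf: "test_function T \<eta>"
        by (rule smooth_test_function[of _ a "a + e"]) (use a e supp in auto)
      have d\<eta>: "(\<eta> has_real_derivative \<eta>1 x) (at x)" for x
      proof -
        have "((\<lambda>x. (x - a) / e) has_real_derivative 1 / e) (at x)"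
          using e by (auto intro!: derivative_eq_intros)
        from DERIV_cdivide[OF DERIV_chain2[OF \<rho>'(1) this], of e] show ?thesis by (simp add: \<eta>_def[abs_def] \<eta>1_def)
      qed
      then have deriv: "deriv \<eta> = \<eta>1" using DERIV_imp_deriv by blast
      have c\<eta>: "continuous_on A \<eta>" for A using d\<eta> by (meson DERIV_isCont continuous_at_imp_continuous_on)
      have c\<eta>1: "continuous_on {0..T} \<eta>1" unfolding \<eta>1_def
        by (intro continuous_intros continuous_on_compose2[OF contrho(2)[of UNIV]]) (use e in auto)
      have int: "integrable (lebesgue_on {0<..<T}) (\<lambda>x. \<eta>1 x * p x)" "integrable (lebesgue_on {0<..<T}) (\<lambda>x. \<eta> x * p' x)"
        "integrable (lebesgue_on {0<..<T}) (\<lambda>x. \<eta> x * G x)"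
        by (intro continuous_integrable_lebesgue_on continuous_intros c\<eta> c\<eta>1 p' G contp)+
      have "((\<lambda>x. \<eta>1 x * p x + \<eta> x * p' x) has_integral \<eta> T * p T - \<eta> 0 * p 0) {0..T}"
      proof (rule fundamental_theorem_of_calculus)
        fix x assume x: "x \<in> {0..T}"
        have "((\<lambda>x. \<eta> x * p x) has_real_derivative \<eta>1 x * p x + p' x * \<eta> x) (at x within {0..T})"
          by (intro DERIV_mult has_field_derivative_at_within[OF d\<eta>] der x)
        then show "((\<lambda>x. \<eta> x * p x) has_vector_derivative \<eta>1 x * p x + \<eta> x * p' x) (at x within {0..T})"
          by (simp add: has_real_derivative_iff_has_vector_derivative mult.commute)
      qed (use T in simp)
      moreover have "\<eta> T = 0" "\<eta> 0 = 0" using supp a e by auto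
      ultimately have "((\<lambda>x. \<eta>1 x * p x + \<eta> x * p' x) has_integral 0) {0<..<T}"
        using has_integral_open_interval[of "\<lambda>x. \<eta>1 x * p x + \<eta> x * p' x" 0 0 T] by simp
      then have "(LINT x|lebesgue_on {0<..<T}. \<eta>1 x * p x + \<eta> x * p' x) = 0"
        using int by (subst lebesgue_integral_eq_integral) (auto simp: integral_unique)
      then have "(LINT x|lebesgue_on {0<..<T}. \<eta>1 x * p x) = - (LINT x|lebesgue_on {0<..<T}. \<eta> x * p' x)"
        using int by simp
      then have "(LINT x|lebesgue_on {0<..<T}. \<eta> x * p' x) = (LINT x|lebesgue_on {0<..<T}. \<eta> x * G x)"
        using weak[OF tf] unfolding deriv by simp
      then have "(LINT x|lebesgue_on {0<..<T}. \<eta> x * (p' x - G x)) = 0"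
        using int by (simp add: right_diff_distrib)
      then show "(LINT x|lebesgue_on {0<..<T}. (\<rho> ((x - a) / e) / e) *\<^sub>R (p' x - G x)) = 0"
        by (simp add: \<eta>_def)
    qed (use a in auto)
    ultimately have "((\<lambda>e::real. 0) \<longlongrightarrow> p' a - G a) (at_right 0)"
      by (rule Lim_transform_eventually)
    from tendsto_unique[OF _ this tendsto_const] show ?thesis by simp
  qed
  have "p' t - G t = 0"
  proof (rule continuous_constant_on_closure[where f="\<lambda>t. p' t - G t" and S="{0<..<T}"])
    show "continuous_on (closure {0<..<T}) (\<lambda>t. p' t - G t)" using T by (simp add: continuous_on_diff p' G)
  qed (use inner_eq T t in auto)
  then show ?thesis by simp
qed

section \<open>The Ritz projection\<close>

text \<open>
  The form need not be symmetric, so Gram--Schmidt does not apply directly. Instead one spanning vector \<open>w\<close> is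
  added at a time: subtracting from \<open>w\<close> the solution \<open>q\<close> for the functional \<open>b w\<close> leaves a vector \<open>e\<close> with
  \<open>b e \<psi> = 0\<close> on the old span. A multiple of \<open>e\<close> thus corrects the old solution in the new direction
  without disturbing the old equations.
\<close>

lemma coercive_bilinear_solvable_on_span:
  fixes b :: "'v::real_inner \<Rightarrow> 'v \<Rightarrow> real"
  assumes bil: "bilinear b" and pos: "\<And>x. x \<noteq> 0 \<Longrightarrow> 0 < b x x"
    and fin: "finite B" and lin: "linear g"
  shows "\<exists>p\<in>span B. \<forall>\<psi>\<in>span B. b p \<psi> = g \<psi>"
  using fin lin
proof (induction B arbitrary: g rule: finite_induct)
  case empty
  then show ?case using bil by (auto simp: bilinear_lzero linear_0)
next
  case (insert w B)
  have linb: "linear (b x)" for x using bil by (auto simp: bilinear_def)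
  obtain q where q: "q \<in> span B" "\<And>\<psi>. \<psi> \<in> span B \<Longrightarrow> b q \<psi> = b w \<psi>" using insert.IH[OF linb[of w]] by blast
  obtain p where p: "p \<in> span B" "\<And>\<psi>. \<psi> \<in> span B \<Longrightarrow> b p \<psi> = g \<psi>" using insert.IH[OF insert.prems] by blast
  define e where "e = w - q"
  have e_orth: "b e \<psi> = 0" if "\<psi> \<in> span B" for \<psi>
    using q(2)[OF that] bil by (simp add: e_def bilinear_lsub)
  have span_sub: "span B \<subseteq> span (insert w B)" by (intro span_mono) auto
  have e_in: "e \<in> span (insert w B)" unfolding e_def
    using q(1) span_sub by (intro span_diff) (auto intro: span_base)
  define c where "c = (if e = 0 then 0 else (g e - b p e) / b e e)"
  show ?case
  proof (intro bexI ballI)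
    show "p + c *\<^sub>R e \<in> span (insert w B)"
      using p(1) span_sub e_in by (intro span_add span_scale) auto
    fix \<psi> assume "\<psi> \<in> span (insert w B)"
    then obtain k where k: "\<psi> - k *\<^sub>R w \<in> span B" using span_breakdown_eq by blast
    define x0 where "x0 = (\<psi> - k *\<^sub>R w) + k *\<^sub>R q"
    have x0: "x0 \<in> span B" "\<psi> = x0 + k *\<^sub>R e"
      unfolding x0_def using k q(1) by (auto simp: e_def scaleR_diff_right intro!: span_add span_scale)
    have "b (p + c *\<^sub>R e) e = g e"
    proof (cases "e = 0")
      case True
      then show ?thesis using bil insert.prems by (simp add: bilinear_rzero linear_0)
    next
      case False
      then have "b e e \<noteq> 0" using pos[OF False] by simp
      then show ?thesis using False bil by (simp add: bilinear_ladd bilinear_lmul c_def)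
    qed
    moreover have "b (p + c *\<^sub>R e) x0 = g x0"
      using p(2)[OF x0(1)] e_orth[OF x0(1)] bil by (simp add: bilinear_ladd bilinear_lmul)
    ultimately show "b (p + c *\<^sub>R e) \<psi> = g \<psi>"
      using bil insert.prems unfolding x0(2) by (simp add: bilinear_radd bilinear_rmul linear_add linear_scale)
  qed
qed

text \<open>
  The Ritz projection onto a finite-dimensional space for a bounded coercive form. The form is \<open>a\<close> at a
  fixed parameter.
\<close>

locale ritz =
  fixes a :: "'v::real_inner \<Rightarrow> 'v \<Rightarrow> real \<Rightarrow> real" and \<mu> \<beta> \<kappa> :: real and B :: "'v set"
  assumes bil: "bilinear (\<lambda>x y. a x y \<mu>)" and \<kappa>: "0 < \<kappa>"
    and bounded: "\<And>x y. \<bar>a x y \<mu>\<bar> \<le> \<beta> * norm x * norm y"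
    and coercive: "\<And>x. \<kappa> * (norm x)\<^sup>2 \<le> a x x \<mu>"
    and fin: "finite B"
begin

abbreviation R :: "'v \<Rightarrow> 'v" where "R \<equiv> ritz_projection a \<mu> (span B)"

lemma form_pos: "x \<noteq> 0 \<Longrightarrow> 0 < a x x \<mu>"
  using coercive[of x] \<kappa> by (smt (verit) mult_pos_pos zero_less_norm_iff zero_less_power)

lemma ritz_unique:
  assumes "p \<in> span B" "\<And>\<psi>. \<psi> \<in> span B \<Longrightarrow> a p \<psi> \<mu> = a x \<psi> \<mu>"
    and "q \<in> span B" "\<And>\<psi>. \<psi> \<in> span B \<Longrightarrow> a q \<psi> \<mu> = a x \<psi> \<mu>"
  shows "p = q"
proof (rule ccontr)
  assume "p \<noteq> q"
  then have "0 < a (p - q) (p - q) \<mu>" by (intro form_pos) simp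
  also have "\<dots> = a p (p - q) \<mu> - a q (p - q) \<mu>" by (rule bilinear_lsub[OF bil])
  also have "\<dots> = 0" using assms by (simp add: span_diff)
  finally show False by simp
qed

lemma ritz_props: "R x \<in> span B" "\<psi> \<in> span B \<Longrightarrow> a (R x) \<psi> \<mu> = a x \<psi> \<mu>"
proof -
  have "linear (\<lambda>\<psi>. a x \<psi> \<mu>)" using bil by (auto simp: bilinear_def)
  then have "\<exists>p\<in>span B. \<forall>\<psi>\<in>span B. a p \<psi> \<mu> = a x \<psi> \<mu>"
    using coercive_bilinear_solvable_on_span[OF bil _ fin, of "\<lambda>\<psi>. a x \<psi> \<mu>"] form_pos by blast
  then have "\<exists>!p. p \<in> span B \<and> (\<forall>\<psi>\<in>span B. a p \<psi> \<mu> = a x \<psi> \<mu>)"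
    using ritz_unique by blast
  from theI'[OF this] show "R x \<in> span B" "\<psi> \<in> span B \<Longrightarrow> a (R x) \<psi> \<mu> = a x \<psi> \<mu>"
    unfolding ritz_projection_def by auto
qed

lemma ritz_eqI:
  assumes "p \<in> span B" "\<And>\<psi>. \<psi> \<in> span B \<Longrightarrow> a p \<psi> \<mu> = a x \<psi> \<mu>"
  shows "R x = p"
  using ritz_unique[OF ritz_props(1) ritz_props(2) assms] .

lemma ritz_diff: "R (x - y) = R x - R y"
  by (rule ritz_eqI) (auto simp: ritz_props span_diff bilinear_lsub[OF bil])

lemma ritz_scale: "R (c *\<^sub>R x) = c *\<^sub>R R x"
  by (rule ritz_eqI) (auto simp: ritz_props span_scale bilinear_lmul[OF bil])

lemma beta_nonneg: "0 \<le> \<beta>" if "(x::'v) \<noteq> 0"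
proof -
  have "0 < a x x \<mu>" using form_pos that .
  also have "\<dots> \<le> \<beta> * (norm x)\<^sup>2" using bounded[of x x] by (simp add: power2_eq_square mult.assoc)
  finally show ?thesis by (simp add: zero_less_mult_iff)
qed

lemma norm_ritz_le: "norm (R x) \<le> \<beta> / \<kappa> * norm x"
proof (cases "R x = 0")
  case True
  then show ?thesis using beta_nonneg[of x] \<kappa> by (cases "x = 0") auto
next
  case False
  have "\<kappa> * (norm (R x))\<^sup>2 \<le> a (R x) (R x) \<mu>" by (rule coercive)
  also have "\<dots> = a x (R x) \<mu>" using ritz_props by simp
  also have "\<dots> \<le> \<beta> * norm x * norm (R x)" using bounded[of x "R x"] by linarith
  finally show ?thesis using False \<kappa> by (simp add: power2_eq_square field_simps)
qed

text \<open>
  The error \<open>e = R x - x\<close> satisfies \<open>a e \<psi> \<mu> = 0\<close> for all \<open>\<psi>\<close> in the space, so in \<open>a e e \<mu>\<close> the second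
  argument may be replaced by \<open>s - x\<close>.
\<close>

lemma cea: 
  assumes "s \<in> span B"
  shows "norm (R x - x) \<le> \<beta> / \<kappa> * norm (x - s)"
proof (cases "R x - x = 0")
  case True
  then show ?thesis using beta_nonneg[of "x - s"] \<kappa> by (cases "x - s = 0") auto
next
  case False
  define e where "e = R x - x"
  have "\<kappa> * (norm e)\<^sup>2 \<le> a e e \<mu>" by (rule coercive)
  also have "\<dots> = a e (R x - s) \<mu> + a e (s - x) \<mu>"
    by (simp add: e_def bilinear_radd[OF bil, symmetric])
  also have "a e (R x - s) \<mu> = 0"
    using assms by (simp add: e_def bilinear_lsub[OF bil] span_diff ritz_props)
  also have "0 + a e (s - x) \<mu> \<le> \<beta> * norm e * norm (s - x)" using bounded[of e "s - x"] by linarith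
  finally show ?thesis using False \<kappa>
    by (simp add: e_def[symmetric] power2_eq_square field_simps norm_minus_commute)
qed

end

section \<open>The truncation error of proper orthogonal decomposition\<close>

text \<open>
  An orthonormal family is linearly independent, so it extends to a basis of the span of \<open>Y\<close>; the
  dimension leaves no room for further elements.
\<close>

lemma orthonormal_family_spans:
  fixes \<psi> :: "nat \<Rightarrow> 'v::real_inner"
  assumes orth: "\<And>j k. j \<in> {1..n} \<Longrightarrow> k \<in> {1..n} \<Longrightarrow> inner (\<psi> j) (\<psi> k) = (if j = k then 1 else 0)"
    and Y: "finite Y" and sub: "\<psi> ` {1..n} \<subseteq> span Y" and n: "n = dim (span Y)"
  shows "span Y \<subseteq> span (\<psi> ` {1..n})"
proof -
  define B where "B = \<psi> ` {1..n}"
  have inj: "inj_on \<psi> {1..n}"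
    by (rule inj_onI) (metis orth zero_neq_one)
  have "independent B"
  proof (rule pairwise_orthogonal_independent)
    show "pairwise real_inner_class.orthogonal B"
      unfolding pairwise_def real_inner_class.orthogonal_def B_def using orth by force
    show "0 \<notin> B" unfolding B_def using orth by (metis (no_types, lifting) imageE inner_zero_left zero_neq_one)
  qed
  then obtain B' where B': "B \<subseteq> B'" "B' \<subseteq> span Y" "independent B'" "span Y \<subseteq> span B'"
    using maximal_independent_subset_extend[of B "span Y"] sub B_def by blast
  have "finite B'" using independent_span_bound[OF Y B'(3,2)] by blast
  moreover have "card B' = n" using basis_card_eq_dim[OF B'(2,4,3)] n by simp
  moreover have "card B = n" unfolding B_def using card_image[OF inj] by simp
  ultimately have "B = B'" using B'(1) by (metis card_subset_eq)
  then show ?thesis using B' B_def by simp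
qed

lemma orthonormal_expansion:
  fixes \<psi> :: "nat \<Rightarrow> 'v::real_inner"
  assumes orth: "\<And>j k. j \<in> {1..n} \<Longrightarrow> k \<in> {1..n} \<Longrightarrow> inner (\<psi> j) (\<psi> k) = (if j = k then 1 else 0)"
    and y: "y \<in> span (\<psi> ` {1..n})"
  shows "y = (\<Sum>k=1..n. inner y (\<psi> k) *\<^sub>R \<psi> k)"
  using y
proof (induction rule: span_induct_alt)
  case (step c x y)
  then obtain j where j: "j \<in> {1..n}" "x = \<psi> j" by blast
  have "(\<Sum>k=1..n. inner x (\<psi> k) *\<^sub>R \<psi> k) = (\<Sum>k\<in>{1..n}. if k = j then \<psi> k else 0)"
    unfolding j(2) by (rule sum.cong) (use orth[OF j(1)] in auto)
  also have "\<dots> = x" using j by simp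
  finally have "(\<Sum>k=1..n. inner x (\<psi> k) *\<^sub>R \<psi> k) = x" .
  then show ?case using step.IH
    by (simp add: inner_add_left scaleR_add_left sum.distrib scaleR_scaleR[symmetric] scaleR_sum_right[symmetric] del: scaleR_scaleR)
qed auto

text \<open>
  The eigenvalue equations say that \<open>inner y\<^sub>j \<psi>\<^sub>k\<close> is \<open>sqrt ((2m+1) * lam k)\<close> times the \<open>j\<close>-th entry of the
  \<open>k\<close>-th eigenvector. Hence the POD basis is orthonormal and, having as many elements as the rank of the
  snapshots, it expands every snapshot. Truncating the expansion after \<open>l\<close> terms leaves the coefficients
  with index above \<open>l\<close>, and summing their squares over the snapshots uses only that the eigenvectors are
  unit vectors.
\<close>

lemma pod_projection_error:
  fixes u :: "real \<Rightarrow> 'v::real_inner"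
  assumes pod: "pod_eigensystem T m u lam v" and l: "l \<le> snapshot_rank T m u"
  obtains s where "\<And>j. j \<le> 2*m \<Longrightarrow> s j \<in> pod_space T m u lam v l"
    "(\<Sum>j=0..2*m. (norm (snapshot T m u j - s j))\<^sup>2) = real (2*m+1) * (\<Sum>k=l+1..snapshot_rank T m u. lam k)"
proof -
  define N where "N = 2 * m + 1"
  define y where "y = snapshot T m u"
  define n where "n = snapshot_rank T m u"
  define K where "K = correlation_matrix T m u"
  define \<psi> where "\<psi> = pod_basis T m u lam v"
  have N: "{0..2*m} = {0..<N}" "real (2*m+1) = real N" "0 < N" by (auto simp: N_def)
  have lam: "0 < lam k" if "k \<in> {1..n}" for k using pod that by (auto simp: pod_eigensystem_def Let_def n_def)
  have eig: "eigenvector K (v k) (lam k)" if "k \<in> {1..n}" for k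
    using pod that by (auto simp: pod_eigensystem_def Let_def n_def K_def)
  have orthv: "scalar_prod (v j) (v k) = (if j = k then 1 else 0)" if "j \<in> {1..n}" "k \<in> {1..n}" for j k
    using pod that by (auto simp: pod_eigensystem_def Let_def n_def)
  have dimK: "K \<in> carrier_mat N N" by (simp add: K_def correlation_matrix_def N_def)
  have vdim: "dim_vec (v k) = N" if "k \<in> {1..n}" for k
    using eig[OF that] dimK by (auto simp: eigenvector_def)
  define w where "w k = (\<Sum>j=0..<N. vec_index (v k) j *\<^sub>R y j)" for k
  have \<psi>w: "\<psi> k = (1 / sqrt (real N * lam k)) *\<^sub>R w k" for k
    by (simp only: \<psi>_def pod_basis_def w_def N y_def)
  \<comment> \<open>The eigenvalue equation read off in coordinate \<open>j\<close>.\<close>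
  have yw: "inner (y j) (w k) = real N * lam k * vec_index (v k) j" if "k \<in> {1..n}" "j < N" for j k
  proof -
    have "vec_index (K *\<^sub>v v k) j = lam k * vec_index (v k) j"
      using eig[OF that(1)] vdim[OF that(1)] that(2) by (simp add: eigenvector_def)
    moreover have "vec_index (K *\<^sub>v v k) j = (\<Sum>i=0..<N. inner (y j) (y i) / real N * vec_index (v k) i)"
      using dimK vdim[OF that(1)] that(2)
      by (simp add: scalar_prod_def K_def correlation_matrix_def y_def N_def)
    moreover have "(\<Sum>i=0..<N. inner (y j) (y i) / real N * vec_index (v k) i) = inner (y j) (w k) / real N"
      by (simp add: w_def inner_sum_right sum_divide_distrib mult.commute)
    ultimately show ?thesis using N(3) by (simp add: field_simps)
  qed
  have y\<psi>: "inner (y j) (\<psi> k) = sqrt (real N * lam k) * vec_index (v k) j" if "k \<in> {1..n}" "j < N" for j k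
  proof -
    have "0 < real N * lam k" using lam[OF that(1)] N(3) by simp
    then have "real N * lam k / sqrt (real N * lam k) = sqrt (real N * lam k)" by (simp add: real_div_sqrt)
    moreover have "inner (y j) (\<psi> k) = real N * lam k / sqrt (real N * lam k) * vec_index (v k) j"
      using yw[OF that] by (simp add: \<psi>w)
    ultimately show ?thesis by (simp only:)
  qed
  have orth: "inner (\<psi> j) (\<psi> k) = (if j = k then 1 else 0)" if "j \<in> {1..n}" "k \<in> {1..n}" for j k
  proof -
    have "inner (w j) (\<psi> k) = (\<Sum>i=0..<N. vec_index (v j) i * inner (y i) (\<psi> k))"
      by (simp add: w_def inner_sum_left)
    also have "\<dots> = sqrt (real N * lam k) * (\<Sum>i=0..<N. vec_index (v j) i * vec_index (v k) i)"
      using that y\<psi> by (simp add: sum_distrib_left mult_ac)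
    also have "(\<Sum>i=0..<N. vec_index (v j) i * vec_index (v k) i) = (if j = k then 1 else 0)"
      using orthv[OF that] vdim[OF that(2)] by (simp add: scalar_prod_def)
    finally have "inner (w j) (\<psi> k) = sqrt (real N * lam k) * (if j = k then 1 else 0)" .
    then show ?thesis using lam[OF that(2)] N(3) by (simp add: \<psi>w[of j])
  qed
  have y_span: "y j \<in> span (\<psi> ` {1..n})" if "j < N" for j
  proof -
    have "span (y ` {0..2*m}) \<subseteq> span (\<psi> ` {1..n})"
    proof (rule orthonormal_family_spans[OF orth])
      show "\<psi> ` {1..n} \<subseteq> span (y ` {0..2*m})"
        unfolding \<psi>w w_def N by (auto intro!: span_scale span_sum intro: span_base)
      show "n = dim (span (y ` {0..2 * m}))" by (simp add: n_def snapshot_rank_def y_def)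
    qed auto
    moreover have "y j \<in> span (y ` {0..2*m})" using that N by (intro span_base) auto
    ultimately show ?thesis by blast
  qed
  define s where "s j = (\<Sum>k=1..l. inner (y j) (\<psi> k) *\<^sub>R \<psi> k)" for j
  have ln: "l \<le> n" using l n_def by simp
  have err: "(norm (y j - s j))\<^sup>2 = (\<Sum>k=l+1..n. real N * lam k * (vec_index (v k) j)\<^sup>2)" if "j < N" for j
  proof -
    have "y j = (\<Sum>k=1..n. inner (y j) (\<psi> k) *\<^sub>R \<psi> k)"
      by (rule orthonormal_expansion[OF orth y_span[OF that]])
    also have "\<dots> = s j + (\<Sum>k=l+1..n. inner (y j) (\<psi> k) *\<^sub>R \<psi> k)"
      unfolding s_def using sum.ub_add_nat[of 1 l "\<lambda>k. inner (y j) (\<psi> k) *\<^sub>R \<psi> k" "n - l"] ln by simp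
    finally have "y j = s j + (\<Sum>k=l+1..n. inner (y j) (\<psi> k) *\<^sub>R \<psi> k)" .
    then have d: "y j - s j = (\<Sum>k=l+1..n. inner (y j) (\<psi> k) *\<^sub>R \<psi> k)"
      by (metis add_diff_cancel_left')
    have "(norm (y j - s j))\<^sup>2 = inner (y j - s j) (y j - s j)" by (simp add: power2_norm_eq_inner)
    also have "\<dots> = (\<Sum>k=l+1..n. inner (y j) (\<psi> k) * (\<Sum>i=l+1..n. inner (y j) (\<psi> i) * inner (\<psi> k) (\<psi> i)))"
      unfolding d by (simp add: inner_commute inner_sum_left inner_sum_right sum_distrib_left mult_ac)
    also have "\<dots> = (\<Sum>k=l+1..n. inner (y j) (\<psi> k) * inner (y j) (\<psi> k))"
    proof (rule sum.cong[OF refl])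
      fix k assume k: "k \<in> {l+1..n}"
      have "(\<Sum>i=l+1..n. inner (y j) (\<psi> i) * inner (\<psi> k) (\<psi> i)) = (\<Sum>i\<in>{l+1..n}. if i = k then inner (y j) (\<psi> i) else 0)"
        by (rule sum.cong) (use orth k in auto)
      then show "inner (y j) (\<psi> k) * (\<Sum>i=l+1..n. inner (y j) (\<psi> i) * inner (\<psi> k) (\<psi> i)) = inner (y j) (\<psi> k) * inner (y j) (\<psi> k)"
        using k by simp
    qed
    also have "\<dots> = (\<Sum>k=l+1..n. real N * lam k * (vec_index (v k) j)\<^sup>2)"
    proof (rule sum.cong[OF refl])
      fix k assume "k \<in> {l+1..n}"
      then have k: "k \<in> {1..n}" by auto
      then have "0 \<le> real N * lam k" using lam[OF k] by simp
      then have "sqrt (real N * lam k) * sqrt (real N * lam k) = real N * lam k" by simp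
      then show "inner (y j) (\<psi> k) * inner (y j) (\<psi> k) = real N * lam k * (vec_index (v k) j)\<^sup>2"
        unfolding y\<psi>[OF k that] power2_eq_square by (metis mult.assoc mult.left_commute)
    qed
    finally show ?thesis .
  qed
  have "(\<Sum>j=0..<N. (norm (y j - s j))\<^sup>2) = (\<Sum>j=0..<N. \<Sum>k=l+1..n. real N * lam k * (vec_index (v k) j)\<^sup>2)"
    using err by simp
  also have "\<dots> = (\<Sum>k=l+1..n. real N * lam k * (\<Sum>j=0..<N. (vec_index (v k) j)\<^sup>2))"
    by (subst sum.swap) (simp add: sum_distrib_left)
  also have "\<dots> = (\<Sum>k=l+1..n. real N * lam k)"
  proof (rule sum.cong[OF refl])
    fix k assume "k \<in> {l+1..n}"
    then have k: "k \<in> {1..n}" by auto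
    have "(\<Sum>j=0..<N. (vec_index (v k) j)\<^sup>2) = 1"
      using orthv[OF k k] vdim[OF k] by (simp add: scalar_prod_def power2_eq_square)
    then show "real N * lam k * (\<Sum>j=0..<N. (vec_index (v k) j)\<^sup>2) = real N * lam k" by simp
  qed
  finally have total: "(\<Sum>j=0..<N. (norm (y j - s j))\<^sup>2) = real N * (\<Sum>k=l+1..n. lam k)"
    by (simp add: sum_distrib_left)
  show ?thesis
  proof (rule that)
    show "s j \<in> pod_space T m u lam v l" for j
      unfolding s_def pod_space_def \<psi>_def[symmetric] by (intro span_sum span_scale span_base) auto
    show "(\<Sum>j=0..2*m. (norm (snapshot T m u j - s j))\<^sup>2) = real (2*m+1) * (\<Sum>k=l+1..snapshot_rank T m u. lam k)"
      unfolding N y_def[symmetric] n_def[symmetric] by (rule total)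
  qed
qed

section \<open>Energy and Gronwall inequalities\<close>

text \<open>
  Young's inequality, with the weights chosen so that the two terms containing \<open>x\<close> use up exactly the
  coercivity term. In the last product the square of \<open>y\<close> gets the small factor 1/4: the time step condition
  leaves room for this factor in the implicit Euler scheme.
\<close>

lemma energy_absorption:
  fixes \<kappa> A B L x y :: real
  assumes "0 < \<kappa>"
  shows "- \<kappa> * x\<^sup>2 + A * x + L * x * y + B * y \<le> A\<^sup>2 / (2 * \<kappa>) + L\<^sup>2 / (2 * \<kappa>) * y\<^sup>2 + B\<^sup>2 + y\<^sup>2 / 4"
proof -
  have young: "s * x \<le> \<kappa> / 2 * x\<^sup>2 + s\<^sup>2 / (2 * \<kappa>)" for s
  proof -
    have "0 \<le> (\<kappa> * x - s)\<^sup>2 / (2 * \<kappa>)" using assms by simp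
    also have "\<dots> = \<kappa> / 2 * x\<^sup>2 + s\<^sup>2 / (2 * \<kappa>) - s * x"
      using assms by (simp add: power2_diff field_simps power2_eq_square)
    finally show ?thesis by simp
  qed
  have "B * y \<le> B\<^sup>2 + y\<^sup>2 / 4"
    using zero_le_power2[of "B - y / 2"] by (simp add: power2_diff power_divide)
  moreover have "(L * y) * x \<le> \<kappa> / 2 * x\<^sup>2 + L\<^sup>2 / (2 * \<kappa>) * y\<^sup>2"
    using young[of "L * y"] by (simp add: power_mult_distrib)
  ultimately show ?thesis using young[of A] by (simp add: mult_ac)
qed

text \<open>
  For \<open>q \<le> 3/4\<close> the factor \<open>1 / (1 - q)\<close> of the implicit step is at most 4 and at most
  \<open>1 + 4 * q \<le> exp (4 * q)\<close>. The first bound is used for the source term, the second for the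
  accumulated error.
\<close>

lemma discrete_gronwall:
  fixes x b :: "nat \<Rightarrow> real"
  assumes q: "0 \<le> q" "q \<le> 3 / 4" and b: "\<And>k. k \<in> {1..m} \<Longrightarrow> 0 \<le> b k" and x: "\<And>k. 0 \<le> x k"
    and step: "\<And>k. k \<in> {1..m} \<Longrightarrow> (1 - q) * x k \<le> x (k - 1) + b k"
    and "k \<le> m"
  shows "x k \<le> exp (4 * q * real k) * (x 0 + 4 * (\<Sum>j=1..k. b j))"
  using \<open>k \<le> m\<close>
proof (induction k)
  case (Suc k)
  define s where "s = x 0 + 4 * (\<Sum>j=1..k. b j)"
  have bk: "0 \<le> b (Suc k)" using b Suc.prems by simp
  have IH: "x k \<le> exp (4 * q * real k) * s" using Suc s_def by simp
  have r: "1 / (1 - q) \<le> 1 + 4 * q"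
  proof -
    have "0 \<le> q * (3 - 4 * q)" using q by simp
    then have "1 \<le> (1 + 4 * q) * (1 - q)" by (simp add: algebra_simps)
    then show ?thesis using q by (simp add: divide_le_eq)
  qed
  have r4: "1 / (1 - q) \<le> 4" using q by (simp add: divide_le_eq)
  have re: "1 / (1 - q) \<le> exp (4 * q)" using r exp_ge_add_one_self[of "4 * q"] by linarith
  have "x (Suc k) \<le> (x k + b (Suc k)) * (1 / (1 - q))"
    using step[of "Suc k"] Suc.prems q by (simp add: field_simps)
  also have "\<dots> = x k * (1 / (1 - q)) + b (Suc k) * (1 / (1 - q))" by (simp add: distrib_right add_divide_distrib)
  also have "\<dots> \<le> x k * exp (4 * q) + b (Suc k) * 4"
    by (intro add_mono mult_left_mono re r4 x bk)
  also have "\<dots> \<le> exp (4 * q * real k) * s * exp (4 * q) + b (Suc k) * 4"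
    using IH by simp
  also have "\<dots> = exp (4 * q * real (Suc k)) * s + 4 * b (Suc k)"
    by (simp add: exp_add[symmetric] algebra_simps mult_exp_exp)
  also have "\<dots> \<le> exp (4 * q * real (Suc k)) * s + exp (4 * q * real (Suc k)) * (4 * b (Suc k))"
  proof -
    have "1 \<le> exp (4 * q * real (Suc k))" using q by simp
    from mult_right_mono[OF this, of "4 * b (Suc k)"] bk show ?thesis by simp
  qed
  also have "\<dots> = exp (4 * q * real (Suc k)) * (x 0 + 4 * (\<Sum>j=1..Suc k. b j))"
    by (simp add: s_def algebra_simps)
  finally show ?case .
qed simp

text \<open>
  The function \<open>exp (- A * t) * e t - B * t\<close> is nonincreasing and vanishes at 0.
\<close>

lemma gronwall_zero_initial:
  fixes e e' :: "real \<Rightarrow> real"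
  assumes der: "\<And>t. t \<in> {0..T} \<Longrightarrow> (e has_real_derivative e' t) (at t within {0..T})"
    and bound: "\<And>t. t \<in> {0..T} \<Longrightarrow> e' t \<le> A * e t + B"
    and AB: "0 \<le> A" "0 \<le> B" and e0: "e 0 = 0" and t: "t \<in> {0..T}"
  shows "e t \<le> B * T * exp (A * T)"
proof -
  define h where "h s = exp (- A * s) * e s - B * s" for s
  have dh: "(h has_real_derivative exp (- A * s) * (e' s - A * e s) - B) (at s within {0..T})" if "s \<in> {0..T}" for s
    unfolding h_def by (rule derivative_eq_intros refl der that | simp add: algebra_simps)+
  have "h t \<le> h 0"
  proof (cases "t = 0")
    case False
    show ?thesis
    proof (rule DERIV_nonpos_imp_decreasing_open[where f=h and a=0 and b=t])
      show "0 \<le> t" using t by simp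
      show "continuous_on {0..t} h"
        by (rule continuous_on_subset[OF DERIV_continuous_on[OF dh]]) (use t in auto)
      fix s assume s: "0 < s" "s < t"
      then have "(h has_real_derivative exp (- A * s) * (e' s - A * e s) - B) (at s)"
        using dh[of s] t at_within_Icc_at[of 0 s T] by auto
      moreover have "exp (- A * s) * (e' s - A * e s) - B \<le> 0"
      proof -
        have "exp (- A * s) * (e' s - A * e s) \<le> exp (- A * s) * B"
          using bound[of s] s t by (intro mult_left_mono) auto
        also have "\<dots> \<le> 1 * B" using AB s by (intro mult_right_mono) auto
        finally show ?thesis by simp
      qed
      ultimately show "\<exists>y. (h has_real_derivative y) (at s) \<and> y \<le> 0" by blast
    qed
  qed simp
  then have "exp (- A * t) * e t \<le> B * t" using e0 by (simp add: h_def)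
  then have "exp (A * t) * (exp (- A * t) * e t) \<le> exp (A * t) * (B * t)" by (intro mult_left_mono) auto
  then have "e t \<le> exp (A * t) * (B * t)" by (simp add: mult.assoc[symmetric] mult_exp_exp)
  also have "\<dots> \<le> exp (A * T) * (B * T)" using AB t by (intro mult_mono) (auto intro: mult_left_mono)
  finally show ?thesis by (simp add: mult_ac)
qed

lemma lipschitz_imp_continuous_on:
  fixes h :: "'a::real_normed_vector \<Rightarrow> 'b::real_normed_vector"
  assumes "0 \<le> K" "\<And>x y. norm (h x - h y) \<le> K * norm (x - y)"
  shows "continuous_on S h"
proof -
  have "K-lipschitz_on S h" by (rule lipschitz_onI) (use assms in \<open>auto simp: dist_norm\<close>)
  then show ?thesis by (rule lipschitz_on_continuous_on)
qed

section \<open>Regularity and parameter stability of the solutions\<close>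

text \<open>
  The parametrised problem with a coercivity constant \<open>\<kappa>\<close> and a Lipschitz constant \<open>L\<close> that are uniform in
  the parameter. Uniform constants keep the perturbation parameter out of all constants below.
\<close>

locale semilinear_family =
  fixes \<iota> :: "'v::{real_inner, banach, second_countable_topology} \<Rightarrow> 'h::{real_inner, banach, second_countable_topology}"
    and \<alpha> T :: real
    and P :: "real set"
    and f :: "real \<Rightarrow> 'h"
    and \<phi> :: 'v
    and a :: "'v \<Rightarrow> 'v \<Rightarrow> real \<Rightarrow> real"
    and F :: "'v \<Rightarrow> real \<Rightarrow> 'h"
    and \<beta> \<omega>a \<omega>F :: "real \<Rightarrow> real" and \<kappa> L :: real
    and u :: "real \<Rightarrow> real \<Rightarrow> 'v"
  assumes embedding: "bounded_linear \<iota>" "inj \<iota>"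
    and alpha: "\<alpha> > 0" "\<And>x. (norm (\<iota> x))\<^sup>2 \<le> \<alpha> * (norm x)\<^sup>2"
    and T: "T > 0"
    and f: "continuous_on {0..T} f"
    and a_bilinear: "\<And>\<mu>. \<mu> \<in> P \<Longrightarrow> bilinear (\<lambda>x y. a x y \<mu>)"
    and beta: "\<And>\<mu>. \<mu> \<in> P \<Longrightarrow> \<beta> \<mu> > 0"
    and kappa: "\<kappa> > 0" and L: "L \<ge> 0"
    and moduli: "\<And>r. r \<ge> 0 \<Longrightarrow> \<omega>a r \<ge> 0" "\<And>r. r \<ge> 0 \<Longrightarrow> \<omega>F r \<ge> 0"
    and A1: "\<And>\<mu> x y. \<mu> \<in> P \<Longrightarrow> \<bar>a x y \<mu>\<bar> \<le> \<beta> \<mu> * norm x * norm y"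
    and A2: "\<And>\<mu> x. \<mu> \<in> P \<Longrightarrow> a x x \<mu> \<ge> \<kappa> * (norm x)\<^sup>2"
    and A3: "\<And>\<mu> \<nu> x y. \<mu> \<in> P \<Longrightarrow> \<nu> \<in> P \<Longrightarrow> \<bar>a x y \<mu> - a x y \<nu>\<bar> \<le> \<omega>a \<bar>\<mu> - \<nu>\<bar> * norm x * norm y"
    and F1: "\<And>\<mu> x y. \<mu> \<in> P \<Longrightarrow> norm (F x \<mu> - F y \<mu>) \<le> L * norm (x - y)"
    and F2: "\<And>\<mu> \<nu> x. \<mu> \<in> P \<Longrightarrow> \<nu> \<in> P \<Longrightarrow> norm (F x \<mu> - F x \<nu>) \<le> \<omega>F \<bar>\<mu> - \<nu>\<bar> * (norm x + 1)"
    and solution: "\<And>\<mu>. \<mu> \<in> P \<Longrightarrow> weak_solution T \<iota> f \<phi> a F \<mu> (u \<mu>)"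
    and regularity: "\<And>\<mu>. \<mu> \<in> P \<Longrightarrow> W22 T (\<lambda>t. \<iota> (u \<mu> t))"
                    "\<And>\<mu>. \<mu> \<in> P \<Longrightarrow> continuous_on {0..T} (u \<mu>)"
begin

lemmas \<iota>_add = linear_add[OF bounded_linear.linear[OF embedding(1)]]
  and \<iota>_diff = linear_diff[OF bounded_linear.linear[OF embedding(1)]]
  and \<iota>_scale = linear_scale[OF bounded_linear.linear[OF embedding(1)]]

lemma norm_\<iota>: "norm (\<iota> x) \<le> sqrt \<alpha> * norm x"
  using real_sqrt_le_mono[OF alpha(2)[of x]] by (simp add: real_sqrt_mult)

lemma cont_\<iota>u: "\<mu> \<in> P \<Longrightarrow> continuous_on {0..T} (\<lambda>t. \<iota> (u \<mu> t))"
  using bounded_linear.continuous_on[OF embedding(1) regularity(2)] .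

text \<open>
  The initial condition speaks about the continuous representative of the class of \<open>u \<mu>\<close> in H. It agrees
  with \<open>\<iota> (u \<mu> t)\<close> almost everywhere, hence everywhere as both are continuous.
\<close>

lemma initial_value:
  assumes "\<mu> \<in> P"
  shows "u \<mu> 0 = \<phi>"
proof -
  obtain w where w: "continuous_on {0..T} w" "AE t in lebesgue_on {0<..<T}. w t = \<iota> (u \<mu> t)" "w 0 = \<iota> \<phi>"
    using solution[OF assms] unfolding weak_solution_def by blast
  have ae: "AE t in lebesgue. t \<in> {0<..<T} \<longrightarrow> w t = \<iota> (u \<mu> t)"
    using w(2) AE_restrict_space_iff[of "{0<..<T}" lebesgue "\<lambda>t. w t = \<iota> (u \<mu> t)"] by simp
  define d where "d t = w t - \<iota> (u \<mu> t)" for t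
  have cd: "continuous_on {0..T} d" unfolding d_def by (intro continuous_intros w cont_\<iota>u assms)
  have "d x = 0" if x: "x \<in> {0<..<T}" for x
  proof (rule ccontr)
    assume "d x \<noteq> 0"
    define Z where "Z = {0<..<T} \<inter> d -` (- {0})"
    have "continuous_on {0<..<T} d" using cd by (rule continuous_on_subset) auto
    then have Z: "open Z" unfolding Z_def by (intro continuous_open_preimage) auto
    have eq: "{t \<in> space lebesgue. \<not> (t \<in> {0<..<T} \<longrightarrow> w t = \<iota> (u \<mu> t))} = Z"
      by (auto simp: Z_def d_def)
    have "Z \<in> null_sets lebesgue"
      using AE_iff_null[of lebesgue "\<lambda>t. t \<in> {0<..<T} \<longrightarrow> w t = \<iota> (u \<mu> t)"] ae Z
      unfolding eq by simp
    moreover have "x \<in> Z" using x \<open>d x \<noteq> 0\<close> by (simp add: Z_def)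
    ultimately show False
      using open_not_negligible[OF Z] by (auto simp: negligible_iff_null_sets)
  qed
  then have "d 0 = 0"
    using continuous_constant_on_closure[of "{0<..<T}" d 0 0] T cd by simp
  then show ?thesis using w(3) embedding(2) by (simp add: d_def inj_eq)
qed

text \<open>
  The weak formulation holds for almost every time only, whereas the scheme is compared with it at grid
  points. For fixed \<open>\<psi>\<close> all terms other than the time derivative are continuous in time, so they are
  the classical derivative of \<open>inner (\<iota> (u \<mu> t)) (\<iota> \<psi>)\<close> everywhere.
\<close>

lemma pointwise_equation:
  assumes \<mu>: "\<mu> \<in> P" and v: "continuous_on {0..T} v"
    "\<And>t. t \<in> {0..T} \<Longrightarrow> ((\<lambda>t. \<iota> (u \<mu> t)) has_vector_derivative v t) (at t within {0..T})"
    and t: "t \<in> {0..T}"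
  shows "inner (v t) (\<iota> \<psi>) + a (u \<mu> t) \<psi> \<mu> + inner (F (u \<mu> t) \<mu>) (\<iota> \<psi>) = inner (f t) (\<iota> \<psi>)"
proof -
  obtain g where g: "L2_time T g" "has_weak_deriv_dual T \<iota> (u \<mu>) g" 
    "AE t in lebesgue_on {0<..<T}. \<forall>\<psi>.
           blinfun_apply (g t) \<psi> + a (u \<mu> t) \<psi> \<mu> + inner (F (u \<mu> t) \<mu>) (\<iota> \<psi>) = inner (f t) (\<iota> \<psi>)"
    using solution[OF \<mu>] unfolding weak_solution_def by blast
  define G where "G t = inner (f t) (\<iota> \<psi>) - a (u \<mu> t) \<psi> \<mu> - inner (F (u \<mu> t) \<mu>) (\<iota> \<psi>)" for t
  have ca: "continuous_on UNIV (\<lambda>x. a x \<psi> \<mu>)"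
  proof (rule lipschitz_imp_continuous_on[of "\<beta> \<mu> * norm \<psi>"])
    show "norm (a x \<psi> \<mu> - a y \<psi> \<mu>) \<le> \<beta> \<mu> * norm \<psi> * norm (x - y)" for x y
      using A1[OF \<mu>, of "x - y" \<psi>] by (simp add: bilinear_lsub[OF a_bilinear[OF \<mu>]] mult_ac)
  qed (use beta[OF \<mu>] in simp)
  have cF: "continuous_on UNIV (\<lambda>x. F x \<mu>)"
    by (rule lipschitz_imp_continuous_on[OF L F1[OF \<mu>]])
  have cG: "continuous_on {0..T} G" unfolding G_def
    by (intro continuous_intros f continuous_on_compose2[OF ca] continuous_on_compose2[OF cF] regularity(2)[OF \<mu>]) auto
  have gm: "(\<lambda>t. blinfun_apply (g t) \<psi>) \<in> borel_measurable (lebesgue_on {0<..<T})"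
  proof (rule measurable_compose[where g="\<lambda>h. blinfun_apply h \<psi>"])
    show "g \<in> borel_measurable (lebesgue_on {0<..<T})" using g(1) unfolding L2_time_def by blast
    show "(\<lambda>h. blinfun_apply h \<psi>) \<in> borel_measurable borel"
      by (intro borel_measurable_continuous_onI continuous_intros)
  qed
  have "inner (v t) (\<iota> \<psi>) = G t"
  proof (rule weak_derivative_eq_derivative[OF T _ _ cG _ t])
    show "((\<lambda>t. inner (\<iota> (u \<mu> t)) (\<iota> \<psi>)) has_real_derivative inner (v t) (\<iota> \<psi>)) (at t within {0..T})" if "t \<in> {0..T}" for t
      unfolding has_real_derivative_iff_has_vector_derivative
      using bounded_linear.has_vector_derivative[OF bounded_linear_inner_left v(2)[OF that]] .
    show "continuous_on {0..T} (\<lambda>t. inner (v t) (\<iota> \<psi>))" by (intro continuous_intros v)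
    fix \<eta> assume \<eta>: "test_function T \<eta>"
    then have "\<eta> differentiable (at x)" for x
      unfolding test_function_def by (metis funpow_0)
    then have c\<eta>: "continuous_on A \<eta>" for A
      by (meson continuous_at_imp_continuous_on differentiable_imp_continuous_within)
    have "\<eta> \<in> borel_measurable (lebesgue_on {0<..<T})"
      by (rule continuous_imp_measurable_on_sets_lebesgue[OF c\<eta>]) simp
    moreover have "G \<in> borel_measurable (lebesgue_on {0<..<T})"
      by (rule continuous_imp_measurable_on_sets_lebesgue[OF continuous_on_subset[OF cG]]) auto
    moreover have "AE t in lebesgue_on {0<..<T}. \<eta> t * blinfun_apply (g t) \<psi> = \<eta> t * G t"
      using g(3)
    proof eventually_elim
      case (elim t)
      from spec[OF elim, of \<psi>] have "blinfun_apply (g t) \<psi> = G t" by (simp add: G_def)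
      then show ?case by simp
    qed
    ultimately have "(LINT t|lebesgue_on {0<..<T}. \<eta> t * blinfun_apply (g t) \<psi>) = (LINT t|lebesgue_on {0<..<T}. \<eta> t * G t)"
      using gm by (intro integral_cong_AE) auto
    then show "(LINT t|lebesgue_on {0<..<T}. deriv \<eta> t * inner (\<iota> (u \<mu> t)) (\<iota> \<psi>)) = - (LINT t|lebesgue_on {0<..<T}. \<eta> t * G t)"
      using g(2) \<eta> unfolding has_weak_deriv_dual_def by simp
  qed
  then show ?thesis by (simp add: G_def)
qed

lemma solution_bound:
  assumes "\<mu> \<in> P"
  obtains M where "0 \<le> M" "\<And>t. t \<in> {0..T} \<Longrightarrow> norm (u \<mu> t) \<le> M"
proof -
  have "bounded (u \<mu> ` {0..T})"
    by (intro compact_imp_bounded compact_continuous_image regularity assms) auto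
  then obtain M where M: "\<And>t. t \<in> {0..T} \<Longrightarrow> norm (u \<mu> t) \<le> M" unfolding bounded_iff by blast
  moreover have "0 \<le> M" using M[of 0] T order_trans[OF norm_ge_zero[of "u \<mu> 0"]] by simp
  ultimately show ?thesis using that by blast
qed

text \<open>
  Subtract the equations for the two parameters and test with the difference \<open>d\<close> of the solutions. The
  change of the parameter in \<open>a\<close> and \<open>F\<close> is evaluated at the reference solution only, so that a bound
  of this single solution suffices and the constant does not depend on \<open>\<mu>1\<close>. Gronwall's inequality
  concludes, as both solutions start in \<open>\<phi>\<close>.
\<close>

lemma parameter_stability:
  assumes \<mu>0: "\<mu>0 \<in> P"
  shows "\<exists>C\<ge>0. \<forall>\<mu>1\<in>P. \<forall>t\<in>{0..T}. (norm (\<iota> (u \<mu>1 t - u \<mu>0 t)))\<^sup>2 \<le> C * (\<omega>a \<bar>\<mu>1 - \<mu>0\<bar> + \<omega>F \<bar>\<mu>1 - \<mu>0\<bar>)\<^sup>2"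
proof -
  obtain M where M: "0 \<le> M" "\<And>t. t \<in> {0..T} \<Longrightarrow> norm (u \<mu>0 t) \<le> M" using solution_bound[OF \<mu>0] by blast
  define A where "A = L\<^sup>2 / \<kappa> + 1 / 2"
  define C where "C = (M + 1)\<^sup>2 * (1 / \<kappa> + 2)"
  have A0: "0 \<le> A" and C0: "0 \<le> C" using kappa by (auto simp: A_def C_def)
  have "(norm (\<iota> (u \<mu>1 t - u \<mu>0 t)))\<^sup>2 \<le> C * T * exp (A * T) * (\<omega>a \<bar>\<mu>1 - \<mu>0\<bar> + \<omega>F \<bar>\<mu>1 - \<mu>0\<bar>)\<^sup>2"
    if \<mu>1: "\<mu>1 \<in> P" and t: "t \<in> {0..T}" for \<mu>1 t
  proof -
    define oa oF \<rho> where "oa = \<omega>a \<bar>\<mu>1 - \<mu>0\<bar>" and "oF = \<omega>F \<bar>\<mu>1 - \<mu>0\<bar>" and "\<rho> = oa + oF"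
    have o: "0 \<le> oa" "0 \<le> oF" using moduli by (auto simp: oa_def oF_def)
    obtain v0 where v0: "continuous_on {0..T} v0"
      "\<And>t. t \<in> {0..T} \<Longrightarrow> ((\<lambda>t. \<iota> (u \<mu>0 t)) has_vector_derivative v0 t) (at t within {0..T})"
      using W22_imp_C1[OF T cont_\<iota>u regularity(1)] \<mu>0 by metis
    obtain v1 where v1: "continuous_on {0..T} v1"
      "\<And>t. t \<in> {0..T} \<Longrightarrow> ((\<lambda>t. \<iota> (u \<mu>1 t)) has_vector_derivative v1 t) (at t within {0..T})"
      using W22_imp_C1[OF T cont_\<iota>u regularity(1)] \<mu>1 by metis
    define w where "w t = \<iota> (u \<mu>1 t) - \<iota> (u \<mu>0 t)" for t
    define e where "e t = (norm (w t))\<^sup>2" for t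
    define e' where "e' t = 2 * inner (v1 t - v0 t) (w t)" for t
    have de: "(e has_real_derivative e' t) (at t within {0..T})" if "t \<in> {0..T}" for t
    proof -
      have dw: "(w has_vector_derivative v1 t - v0 t) (at t within {0..T})"
        unfolding w_def by (intro has_vector_derivative_diff v0(2) v1(2) that)
      have "(e has_vector_derivative inner (w t) (v1 t - v0 t) + inner (v1 t - v0 t) (w t)) (at t within {0..T})"
        unfolding e_def power2_norm_eq_inner
        using bounded_bilinear.has_vector_derivative[OF bounded_bilinear_inner dw dw] .
      then show ?thesis
        by (simp add: has_real_derivative_iff_has_vector_derivative e'_def inner_commute)
    qed
    have bound: "e' t \<le> A * e t + C * \<rho>\<^sup>2" if t: "t \<in> {0..T}" for t
    proof -
      define x0 x1 d where "x0 = u \<mu>0 t" and "x1 = u \<mu>1 t" and "d = x1 - x0"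
      have wd: "w t = \<iota> d" by (simp add: w_def d_def x0_def x1_def \<iota>_diff)
      have eq0: "inner (v0 t) (\<iota> d) + a x0 d \<mu>0 + inner (F x0 \<mu>0) (\<iota> d) = inner (f t) (\<iota> d)"
        unfolding x0_def by (rule pointwise_equation[OF \<mu>0 v0 t])
      have eq1: "inner (v1 t) (\<iota> d) + a x1 d \<mu>1 + inner (F x1 \<mu>1) (\<iota> d) = inner (f t) (\<iota> d)"
        unfolding x1_def by (rule pointwise_equation[OF \<mu>1 v1 t])
      have ad: "a x1 d \<mu>1 = a x0 d \<mu>1 + a d d \<mu>1"
        using bilinear_ladd[OF a_bilinear[OF \<mu>1], of x0 d d] by (simp add: d_def)
      have "inner (v1 t - v0 t) (\<iota> d) = - a d d \<mu>1 - (a x0 d \<mu>1 - a x0 d \<mu>0)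
          - inner (F x1 \<mu>1 - F x0 \<mu>1) (\<iota> d) - inner (F x0 \<mu>1 - F x0 \<mu>0) (\<iota> d)"
        using eq0 eq1 ad by (simp add: inner_diff_left)
      moreover have "- a d d \<mu>1 \<le> - \<kappa> * (norm d)\<^sup>2" using A2[OF \<mu>1, of d] by simp
      moreover have "- (a x0 d \<mu>1 - a x0 d \<mu>0) \<le> (oa * M) * norm d"
      proof -
        have "\<bar>a x0 d \<mu>1 - a x0 d \<mu>0\<bar> \<le> oa * norm x0 * norm d" unfolding oa_def by (rule A3[OF \<mu>1 \<mu>0])
        also have "\<dots> \<le> oa * M * norm d"
          using M(2)[OF t] o by (intro mult_right_mono mult_left_mono) (auto simp: x0_def)
        finally show ?thesis by linarith
      qed
      moreover have "- inner (F x1 \<mu>1 - F x0 \<mu>1) (\<iota> d) \<le> L * norm d * norm (\<iota> d)"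
      proof -
        have "\<bar>inner (F x1 \<mu>1 - F x0 \<mu>1) (\<iota> d)\<bar> \<le> norm (F x1 \<mu>1 - F x0 \<mu>1) * norm (\<iota> d)" by (rule Cauchy_Schwarz_ineq2)
        also have "\<dots> \<le> L * norm d * norm (\<iota> d)" unfolding d_def by (intro mult_right_mono F1 \<mu>1) auto
        finally show ?thesis by linarith
      qed
      moreover have "- inner (F x0 \<mu>1 - F x0 \<mu>0) (\<iota> d) \<le> (oF * (M + 1)) * norm (\<iota> d)"
      proof -
        have "\<bar>inner (F x0 \<mu>1 - F x0 \<mu>0) (\<iota> d)\<bar> \<le> norm (F x0 \<mu>1 - F x0 \<mu>0) * norm (\<iota> d)" by (rule Cauchy_Schwarz_ineq2)
        also have "\<dots> \<le> oF * (norm x0 + 1) * norm (\<iota> d)" unfolding oF_def by (intro mult_right_mono F2 \<mu>1 \<mu>0) auto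
        also have "\<dots> \<le> oF * (M + 1) * norm (\<iota> d)"
          using M(2)[OF t] o by (intro mult_right_mono mult_left_mono) (auto simp: x0_def)
        finally show ?thesis by linarith
      qed
      ultimately have "inner (v1 t - v0 t) (\<iota> d) \<le> - \<kappa> * (norm d)\<^sup>2 + (oa * M) * norm d + L * norm d * norm (\<iota> d) + (oF * (M + 1)) * norm (\<iota> d)"
        by linarith
      also have "\<dots> \<le> (oa * M)\<^sup>2 / (2 * \<kappa>) + L\<^sup>2 / (2 * \<kappa>) * (norm (\<iota> d))\<^sup>2 + (oF * (M + 1))\<^sup>2 + (norm (\<iota> d))\<^sup>2 / 4"
        by (rule energy_absorption[OF kappa])
      finally have "e' t \<le> (oa * M)\<^sup>2 / \<kappa> + L\<^sup>2 / \<kappa> * e t + 2 * (oF * (M + 1))\<^sup>2 + e t / 2"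
        using kappa by (simp add: e'_def e_def wd field_simps)
      also have "\<dots> = A * e t + ((oa * M)\<^sup>2 / \<kappa> + 2 * (oF * (M + 1))\<^sup>2)" by (simp add: A_def algebra_simps)
      also have "(oa * M)\<^sup>2 / \<kappa> + 2 * (oF * (M + 1))\<^sup>2 \<le> (\<rho> * (M + 1))\<^sup>2 / \<kappa> + 2 * (\<rho> * (M + 1))\<^sup>2"
        using o M(1) kappa unfolding \<rho>_def
        by (intro add_mono divide_right_mono mult_left_mono power_mono mult_mono) auto
      also have "\<dots> = C * \<rho>\<^sup>2" unfolding C_def power_mult_distrib
        by (simp add: distrib_left distrib_right mult_ac)
      finally show ?thesis by simp
    qed
    have "e t \<le> (C * \<rho>\<^sup>2) * T * exp (A * T)"
      by (rule gronwall_zero_initial[OF de bound A0 _ _ t])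
        (use C0 initial_value \<mu>0 \<mu>1 in \<open>auto simp: e_def w_def\<close>)
    then show ?thesis by (simp add: e_def w_def \<iota>_diff \<rho>_def oa_def oF_def mult_ac)
  qed
  moreover have "0 \<le> C * T * exp (A * T)" using C0 T by simp
  ultimately show ?thesis by blast
qed

end

section \<open>The error of the reduced scheme\<close>

text \<open>
  The discrete counterpart of the derivative of half the squared norm; the defect is the
  nonnegative term \<open>(norm (x - y))\<^sup>2\<close>.
\<close>

lemma backward_difference_energy:
  fixes x y :: "'a::real_inner"
  assumes "0 < \<tau>"
  shows "((norm x)\<^sup>2 - (norm y)\<^sup>2) / (2 * \<tau>) \<le> inner ((1 / \<tau>) *\<^sub>R (x - y)) x"
proof -
  have "(norm x)\<^sup>2 - (norm y)\<^sup>2 \<le> 2 * inner (x - y) x"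
    using zero_le_power2[of "norm (x - y)"]
    by (simp add: power2_norm_eq_inner inner_diff_left inner_diff_right inner_commute)
  then have "((norm x)\<^sup>2 - (norm y)\<^sup>2) / (2 * \<tau>) \<le> 2 * inner (x - y) x / (2 * \<tau>)"
    using assms by (intro divide_right_mono) auto
  then show ?thesis by (simp only: inner_scaleR_left) simp
qed

lemma sum_four_squared_le: "(p + q + r + s)\<^sup>2 \<le> 4 * (p\<^sup>2 + q\<^sup>2 + r\<^sup>2 + (s::real)\<^sup>2)"
proof -
  have "0 \<le> (p - q)\<^sup>2 + (p - r)\<^sup>2 + (p - s)\<^sup>2 + (q - r)\<^sup>2 + (q - s)\<^sup>2 + (r - s)\<^sup>2" by simp
  then show ?thesis by (simp add: power2_eq_square algebra_simps)
qed

lemma sum_three_squared_le: "(p + q + r)\<^sup>2 \<le> 3 * (p\<^sup>2 + q\<^sup>2 + (r::real)\<^sup>2)"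
proof -
  have "0 \<le> (p - q)\<^sup>2 + (p - r)\<^sup>2 + (q - r)\<^sup>2" by simp
  then show ?thesis by (simp add: power2_eq_square algebra_simps)
qed

context semilinear_family
begin

text \<open>
  The solution values and the backward differences at the grid points are among the snapshots, so Cea's
  lemma reduces both sums to the POD error. The difference quotients are included in the snapshots
  precisely to control the second sum. The factor 3 bounds the ratio of \<open>2 * m + 1\<close> to \<open>m\<close>.
\<close>

lemma pod_ritz_error:
  assumes \<mu>0: "\<mu>0 \<in> P" and m: "0 < m" and pod: "pod_eigensystem T m (u \<mu>0) lam v"
    and l: "l \<le> snapshot_rank T m (u \<mu>0)"
  defines "R \<equiv> ritz_projection a \<mu>0 (pod_space T m (u \<mu>0) lam v l)"
    and "x \<equiv> \<lambda>k. u \<mu>0 (tgrid T m k)"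
    and "\<Lambda> \<equiv> (\<Sum>j=l+1..snapshot_rank T m (u \<mu>0). lam j)"
  shows "(\<Sum>k=1..m. (norm (R (x k) - x k))\<^sup>2) + (\<Sum>k=1..m. (norm (R (bdiff T m x k) - bdiff T m x k))\<^sup>2)
     \<le> 3 * real m * (\<beta> \<mu>0 / \<kappa>)\<^sup>2 * \<Lambda>" (is "?lhs \<le> _") and "0 \<le> \<Lambda>"
proof -
  interpret ritz a \<mu>0 "\<beta> \<mu>0" \<kappa> "pod_basis T m (u \<mu>0) lam v ` {1..l}"
    using a_bilinear A1 A2 \<mu>0 kappa by unfold_locales auto
  obtain s where s: "\<And>j. j \<le> 2*m \<Longrightarrow> s j \<in> pod_space T m (u \<mu>0) lam v l"
    "(\<Sum>j=0..2*m. (norm (snapshot T m (u \<mu>0) j - s j))\<^sup>2) = real (2*m+1) * \<Lambda>"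
    using pod_projection_error[OF pod l] unfolding \<Lambda>_def by blast
  show \<Lambda>0: "0 \<le> \<Lambda>"
    using pod unfolding \<Lambda>_def pod_eigensystem_def Let_def by (intro sum_nonneg) (auto intro: less_imp_le)
  define y where "y = snapshot T m (u \<mu>0)"
  define e where "e j = (norm (R (y j) - y j))\<^sup>2" for j
  have e: "e j \<le> (\<beta> \<mu>0 / \<kappa>)\<^sup>2 * (norm (y j - s j))\<^sup>2" if "j \<le> 2 * m" for j
  proof -
    have "norm (R (y j) - y j) \<le> \<beta> \<mu>0 / \<kappa> * norm (y j - s j)"
      using cea[of "s j" "y j"] s(1)[OF that] unfolding R_def pod_space_def by blast
    then show ?thesis unfolding e_def power_mult_distrib[symmetric] by (intro power_mono) auto
  qed
  have "(\<Sum>k=1..m. (norm (R (x k) - x k))\<^sup>2) = sum e {1..m}"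
    by (rule sum.cong) (auto simp: e_def y_def x_def snapshot_def)
  moreover have "(\<Sum>k=1..m. (norm (R (bdiff T m x k) - bdiff T m x k))\<^sup>2) = (\<Sum>k=1..m. e (k + m))"
    by (rule sum.cong) (auto simp: e_def y_def x_def snapshot_def)
  moreover have "(\<Sum>k=1..m. e (k + m)) = sum e {m+1..2*m}"
    using sum.shift_bounds_cl_nat_ivl[of e 1 m m] by (simp add: mult_2)
  moreover have "sum e {1..m} + sum e {m+1..2*m} = sum e {1..2*m}"
    using sum.ub_add_nat[of 1 m e m] by (simp add: mult_2)
  ultimately have "?lhs = sum e {1..2*m}" by simp
  also have "\<dots> \<le> sum e {0..2*m}" by (rule sum_mono2) (auto simp: e_def)
  also have "\<dots> \<le> (\<Sum>j=0..2*m. (\<beta> \<mu>0 / \<kappa>)\<^sup>2 * (norm (y j - s j))\<^sup>2)" by (intro sum_mono e) auto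
  also have "\<dots> = (\<beta> \<mu>0 / \<kappa>)\<^sup>2 * (real (2*m+1) * \<Lambda>)"
    using s(2) by (simp add: sum_distrib_left[symmetric] y_def)
  also have "\<dots> \<le> (\<beta> \<mu>0 / \<kappa>)\<^sup>2 * (3 * real m * \<Lambda>)"
    using m \<Lambda>0 by (intro mult_left_mono mult_right_mono) auto
  finally show "?lhs \<le> 3 * real m * (\<beta> \<mu>0 / \<kappa>)\<^sup>2 * \<Lambda>" by (simp add: mult_ac)
qed

text \<open>
  One step of the energy estimate for \<open>\<theta> k\<close>, the difference between the reduced solution at \<open>\<mu>1\<close> and the
  Ritz projection at \<open>\<mu>0\<close> of the reference solution. Both lie in the reduced space, so \<open>\<theta> k\<close> is an
  admissible test function. The residual collects four errors: the backward difference of the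
  reference solution, the Ritz projection of that backward difference, the change of parameter, and the
  Ritz projection inside the nonlinearity.
\<close>

lemma rom_error_step:
  assumes \<mu>: "\<mu>0 \<in> P" "\<mu>1 \<in> P" and k: "k \<in> {1..m}"
    and B: "finite B" and rom: "rom_solution T m \<iota> f \<phi> a F \<mu>1 (span B) U"
    and v: "continuous_on {0..T} v"
      "\<And>t. t \<in> {0..T} \<Longrightarrow> ((\<lambda>t. \<iota> (u \<mu>0 t)) has_vector_derivative v t) (at t within {0..T})"
    and M: "0 \<le> M" "\<And>t. t \<in> {0..T} \<Longrightarrow> norm (u \<mu>0 t) \<le> M"
  defines "R \<equiv> ritz_projection a \<mu>0 (span B)"
    and "x \<equiv> \<lambda>k. u \<mu>0 (tgrid T m k)"
    and "\<theta> \<equiv> \<lambda>k. U k - ritz_projection a \<mu>0 (span B) (u \<mu>0 (tgrid T m k))"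
    and "oa \<equiv> \<omega>a \<bar>\<mu>1 - \<mu>0\<bar>" and "oF \<equiv> \<omega>F \<bar>\<mu>1 - \<mu>0\<bar>"
  shows "(1 - (L\<^sup>2 / \<kappa> + 1 / 2) * tstep T m) * (norm (\<iota> (\<theta> k)))\<^sup>2 \<le> (norm (\<iota> (\<theta> (k - 1))))\<^sup>2 +
     tstep T m * ((oa * (\<beta> \<mu>0 / \<kappa> * M))\<^sup>2 / \<kappa>
       + 8 * ((norm (bdiff T m (\<lambda>k. \<iota> (x k)) k - v (tgrid T m k)))\<^sup>2
              + \<alpha> * (norm (R (bdiff T m x k) - bdiff T m x k))\<^sup>2
              + (oF * (M + 1))\<^sup>2 + L\<^sup>2 * (norm (R (x k) - x k))\<^sup>2))"
proof -
  interpret ritz a \<mu>0 "\<beta> \<mu>0" \<kappa> B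
    using a_bilinear A1 A2 \<mu> kappa B by unfold_locales auto
  define \<tau> where "\<tau> = tstep T m"
  define t where "t = tgrid T m k"
  have \<tau>: "0 < \<tau>" using T k by (simp add: \<tau>_def tstep_def)
  have t: "t \<in> {0..T}" using T k by (auto simp: t_def tgrid_def tstep_def field_simps)
  have o: "0 \<le> oa" "0 \<le> oF" using moduli by (auto simp: oa_def oF_def)
  define d where "d = \<theta> k"
  define X where "X = x k"
  have \<theta>: "\<theta> j = U j - R (x j)" for j by (simp add: \<theta>_def R_def x_def)
  have dB: "d \<in> span B"
    unfolding d_def \<theta> R_def using rom k ritz_props(1) by (auto simp: rom_solution_def intro!: span_diff)
  \<comment> \<open>The scheme, the equation at the grid point and the Ritz projection, all tested with \<open>\<theta> k\<close>.\<close>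
  have scheme: "inner (\<iota> (bdiff T m U k)) (\<iota> d) + a (U k) d \<mu>1 + inner (F (U k) \<mu>1) (\<iota> d) = inner (f t) (\<iota> d)"
    using rom k dB unfolding rom_solution_def t_def by blast
  have exact: "inner (v t) (\<iota> d) + a X d \<mu>0 + inner (F X \<mu>0) (\<iota> d) = inner (f t) (\<iota> d)"
    unfolding X_def x_def t_def[symmetric] by (rule pointwise_equation[OF \<mu>(1) v t])
  have Ritz: "a (R X) d \<mu>0 = a X d \<mu>0" unfolding R_def by (rule ritz_props(2)[OF dB])
  have aU: "a (U k) d \<mu>1 = a (R X) d \<mu>1 + a d d \<mu>1"
    using bilinear_ladd[OF a_bilinear[OF \<mu>(2)], of "R X" d d] by (simp add: d_def \<theta> X_def)
  define c where "c = bdiff T m (\<lambda>k. \<iota> (x k)) k - v t"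
  define b where "b = R (bdiff T m x k) - bdiff T m x k"
  have split: "\<iota> (bdiff T m U k) = (1 / \<tau>) *\<^sub>R (\<iota> (\<theta> k) - \<iota> (\<theta> (k - 1))) + \<iota> b + c + v t"
  proof -
    have "R (bdiff T m x k) = (1 / \<tau>) *\<^sub>R (R (x k) - R (x (k - 1)))"
      unfolding R_def bdiff_def \<tau>_def by (simp only: ritz_scale ritz_diff)
    then have "bdiff T m U k = (1 / \<tau>) *\<^sub>R (\<theta> k - \<theta> (k - 1)) + b + bdiff T m x k"
      by (simp add: b_def \<theta> bdiff_def \<tau>_def scaleR_diff_right[symmetric] scaleR_add_right[symmetric])
    moreover have "\<iota> (bdiff T m x k) = bdiff T m (\<lambda>k. \<iota> (x k)) k"
      by (simp add: bdiff_def \<iota>_scale \<iota>_diff)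
    ultimately show ?thesis by (simp add: c_def \<iota>_scale \<iota>_diff \<iota>_add)
  qed
  define y where "y = norm (\<iota> d)"
  define z where "z = norm (R X - X)"
  define Bk where "Bk = norm c + sqrt \<alpha> * norm b + oF * (M + 1) + L * z"
  have "inner ((1 / \<tau>) *\<^sub>R (\<iota> (\<theta> k) - \<iota> (\<theta> (k - 1)))) (\<iota> d) = - a d d \<mu>1 - (a (R X) d \<mu>1 - a (R X) d \<mu>0)
     - inner c (\<iota> d) - inner (\<iota> b) (\<iota> d) - inner (F X \<mu>1 - F X \<mu>0) (\<iota> d) - inner (F (U k) \<mu>1 - F X \<mu>1) (\<iota> d)"
    using scheme exact Ritz aU unfolding split by (simp add: inner_diff_left inner_add_left)
  moreover have "- a d d \<mu>1 \<le> - \<kappa> * (norm d)\<^sup>2" using A2[OF \<mu>(2), of d] by simp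
  moreover have "- (a (R X) d \<mu>1 - a (R X) d \<mu>0) \<le> (oa * (\<beta> \<mu>0 / \<kappa> * M)) * norm d"
  proof -
    have "norm (R X) \<le> \<beta> \<mu>0 / \<kappa> * norm X" unfolding R_def by (rule norm_ritz_le)
    also have "\<dots> \<le> \<beta> \<mu>0 / \<kappa> * M"
      using M(2)[OF t] beta[OF \<mu>(1)] kappa by (intro mult_left_mono) (auto simp: X_def x_def t_def)
    finally have RX: "norm (R X) \<le> \<beta> \<mu>0 / \<kappa> * M" .
    have "\<bar>a (R X) d \<mu>1 - a (R X) d \<mu>0\<bar> \<le> oa * norm (R X) * norm d" unfolding oa_def by (rule A3[OF \<mu>(2,1)])
    also have "\<dots> \<le> oa * (\<beta> \<mu>0 / \<kappa> * M) * norm d"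
      using RX o by (intro mult_right_mono mult_left_mono) auto
    finally show ?thesis by linarith
  qed
  moreover have "- inner c (\<iota> d) \<le> norm c * y"
    using Cauchy_Schwarz_ineq2[of c "\<iota> d"] unfolding y_def by linarith
  moreover have "- inner (\<iota> b) (\<iota> d) \<le> sqrt \<alpha> * norm b * y"
  proof -
    have "\<bar>inner (\<iota> b) (\<iota> d)\<bar> \<le> norm (\<iota> b) * y" unfolding y_def by (rule Cauchy_Schwarz_ineq2)
    also have "\<dots> \<le> sqrt \<alpha> * norm b * y" by (intro mult_right_mono norm_\<iota>) (simp add: y_def)
    finally show ?thesis by linarith
  qed
  moreover have "- inner (F X \<mu>1 - F X \<mu>0) (\<iota> d) \<le> oF * (M + 1) * y"
  proof -
    have "\<bar>inner (F X \<mu>1 - F X \<mu>0) (\<iota> d)\<bar> \<le> norm (F X \<mu>1 - F X \<mu>0) * y" unfolding y_def by (rule Cauchy_Schwarz_ineq2)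
    also have "\<dots> \<le> oF * (norm X + 1) * y" unfolding oF_def y_def by (intro mult_right_mono F2 \<mu>) auto
    also have "\<dots> \<le> oF * (M + 1) * y"
      using M(2)[OF t] o by (intro mult_right_mono mult_left_mono) (auto simp: X_def x_def t_def y_def)
    finally show ?thesis by linarith
  qed
  moreover have "- inner (F (U k) \<mu>1 - F X \<mu>1) (\<iota> d) \<le> L * norm d * y + L * z * y"
  proof -
    have "\<bar>inner (F (U k) \<mu>1 - F X \<mu>1) (\<iota> d)\<bar> \<le> norm (F (U k) \<mu>1 - F X \<mu>1) * y" unfolding y_def by (rule Cauchy_Schwarz_ineq2)
    also have "\<dots> \<le> L * norm (U k - X) * y" unfolding y_def by (intro mult_right_mono F1 \<mu>) auto
    also have "\<dots> \<le> L * (norm d + z) * y"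
    proof -
      have "U k - X = d + (R X - X)" by (simp add: d_def \<theta> X_def)
      then have "norm (U k - X) \<le> norm d + z" unfolding z_def by (metis norm_triangle_ineq)
      then show ?thesis using L by (intro mult_right_mono mult_left_mono) (auto simp: y_def)
    qed
    also have "\<dots> = L * norm d * y + L * z * y" by (simp add: algebra_simps)
    finally show ?thesis by linarith
  qed
  ultimately have "inner ((1 / \<tau>) *\<^sub>R (\<iota> (\<theta> k) - \<iota> (\<theta> (k - 1)))) (\<iota> d)
     \<le> - \<kappa> * (norm d)\<^sup>2 + (oa * (\<beta> \<mu>0 / \<kappa> * M)) * norm d + L * norm d * y + Bk * y"
    by (simp add: Bk_def distrib_right)
  also have "\<dots> \<le> (oa * (\<beta> \<mu>0 / \<kappa> * M))\<^sup>2 / (2 * \<kappa>) + L\<^sup>2 / (2 * \<kappa>) * y\<^sup>2 + Bk\<^sup>2 + y\<^sup>2 / 4"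
    by (rule energy_absorption[OF kappa])
  finally have "((norm (\<iota> (\<theta> k)))\<^sup>2 - (norm (\<iota> (\<theta> (k - 1))))\<^sup>2) / (2 * \<tau>) \<le> 
      (oa * (\<beta> \<mu>0 / \<kappa> * M))\<^sup>2 / (2 * \<kappa>) + L\<^sup>2 / (2 * \<kappa>) * y\<^sup>2 + Bk\<^sup>2 + y\<^sup>2 / 4"
    using backward_difference_energy[OF \<tau>, of "\<iota> (\<theta> k)" "\<iota> (\<theta> (k - 1))"] unfolding d_def by linarith
  from mult_left_mono[OF this, of "2 * \<tau>"] have
    "y\<^sup>2 - (norm (\<iota> (\<theta> (k - 1))))\<^sup>2 \<le> 2 * \<tau> * ((oa * (\<beta> \<mu>0 / \<kappa> * M))\<^sup>2 / (2 * \<kappa>) + L\<^sup>2 / (2 * \<kappa>) * y\<^sup>2 + Bk\<^sup>2 + y\<^sup>2 / 4)"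
    using \<tau> by (simp add: y_def d_def)
  also have "\<dots> = (L\<^sup>2 / \<kappa> + 1 / 2) * \<tau> * y\<^sup>2 + \<tau> * ((oa * (\<beta> \<mu>0 / \<kappa> * M))\<^sup>2 / \<kappa> + 2 * Bk\<^sup>2)"
    using kappa by (simp add: field_simps)
  also have "\<dots> \<le> (L\<^sup>2 / \<kappa> + 1 / 2) * \<tau> * y\<^sup>2 + \<tau> * ((oa * (\<beta> \<mu>0 / \<kappa> * M))\<^sup>2 / \<kappa> 
      + 8 * ((norm c)\<^sup>2 + \<alpha> * (norm b)\<^sup>2 + (oF * (M + 1))\<^sup>2 + L\<^sup>2 * z\<^sup>2))"
  proof -
    have "Bk\<^sup>2 \<le> 4 * ((norm c)\<^sup>2 + \<alpha> * (norm b)\<^sup>2 + (oF * (M + 1))\<^sup>2 + L\<^sup>2 * z\<^sup>2)"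
      using sum_four_squared_le[of "norm c" "sqrt \<alpha> * norm b" "oF * (M + 1)" "L * z"] alpha(1)
      unfolding Bk_def by (simp add: power_mult_distrib)
    then show ?thesis using \<tau> by (intro add_left_mono mult_left_mono) auto
  qed
  finally show ?thesis
    unfolding \<tau>_def[symmetric] t_def[symmetric] b_def c_def X_def z_def y_def d_def by (simp add: left_diff_distrib)
qed

text \<open>
  The total error splits into the change of the solution with the parameter, the Ritz projection error and
  \<open>\<theta> k\<close>. The discrete Gronwall inequality applies with \<open>q = A * \<tau>\<close>, where the two step size conditions
  give \<open>q \<le> 1/2 + 1/4\<close>. The initial value \<open>\<theta> 0\<close> is controlled by the error of the Ritz projection of
  \<open>\<phi>\<close>, since the scheme starts from the H-orthogonal projection of \<open>\<phi>\<close>.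
\<close>

lemma rom_error_bound:
  assumes \<mu>0: "\<mu>0 \<in> P"
  obtains C C' where "0 \<le> C" "0 \<le> C'"
    "\<And>\<mu>1 m lam v l U. \<mu>1 \<in> P \<Longrightarrow> 0 < m \<Longrightarrow>
      L\<^sup>2 / \<kappa> * tstep T m \<le> 1 / 2 \<Longrightarrow> tstep T m \<le> 1 / 2 \<Longrightarrow> pod_eigensystem T m (u \<mu>0) lam v \<Longrightarrow>
      l \<le> snapshot_rank T m (u \<mu>0) \<Longrightarrow>
      rom_solution T m \<iota> f \<phi> a F \<mu>1 (pod_space T m (u \<mu>0) lam v l) U \<Longrightarrow>
      1 / real m * (\<Sum>k=1..m. (norm (\<iota> (u \<mu>1 (tgrid T m k) - U k)))\<^sup>2)
        \<le> C * ((norm (\<iota> (\<phi> - ritz_projection a \<mu>0 (pod_space T m (u \<mu>0) lam v l) \<phi>)))\<^sup>2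
               + (\<Sum>j=l+1..snapshot_rank T m (u \<mu>0). lam j) + (tstep T m)\<^sup>2)
          + C' * (\<omega>a \<bar>\<mu>1 - \<mu>0\<bar> + \<omega>F \<bar>\<mu>1 - \<mu>0\<bar>)\<^sup>2"
proof -
  obtain M where M: "0 \<le> M" "\<And>t. t \<in> {0..T} \<Longrightarrow> norm (u \<mu>0 t) \<le> M" using solution_bound[OF \<mu>0] by blast
  obtain Cs where Cs: "0 \<le> Cs" "\<And>\<mu>1 t. \<mu>1 \<in> P \<Longrightarrow> t \<in> {0..T} \<Longrightarrow>
     (norm (\<iota> (u \<mu>1 t - u \<mu>0 t)))\<^sup>2 \<le> Cs * (\<omega>a \<bar>\<mu>1 - \<mu>0\<bar> + \<omega>F \<bar>\<mu>1 - \<mu>0\<bar>)\<^sup>2"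
    using parameter_stability[OF \<mu>0] by blast
  obtain v \<Psi> where v: "continuous_on {0..T} v"
      "\<And>t. t \<in> {0..T} \<Longrightarrow> ((\<lambda>t. \<iota> (u \<mu>0 t)) has_vector_derivative v t) (at t within {0..T})"
      and \<Psi>: "\<And>s t. 0 \<le> s \<Longrightarrow> s < t \<Longrightarrow> t \<le> T \<Longrightarrow> (norm (div_diff (\<lambda>t. \<iota> (u \<mu>0 t)) s t - v t))\<^sup>2 \<le> (t - s) * (\<Psi> t - \<Psi> s)"
    using W22_imp_C1[OF T cont_\<iota>u[OF \<mu>0] regularity(1)[OF \<mu>0]] by metis
  define K where "K = \<Psi> T - \<Psi> 0"
  have "0 \<le> T * K" unfolding K_def using \<Psi>[of 0 T] T by (auto intro: order_trans[OF zero_le_power2])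
  then have K0: "0 \<le> K" using T by (simp add: zero_le_mult_iff)
  define \<gamma> where "\<gamma> = \<beta> \<mu>0 / \<kappa>"
  have \<gamma>0: "0 \<le> \<gamma>" using beta[OF \<mu>0] kappa by (simp add: \<gamma>_def)
  define A where "A = L\<^sup>2 / \<kappa> + 1 / 2"
  have A0: "0 \<le> A" using kappa by (simp add: A_def)
  define E where "E = exp (4 * A * T)"
  have E1: "1 \<le> E" using A0 T by (simp add: E_def)
  define D1 where "D1 = 1 + 32 * (K + (\<alpha> + L\<^sup>2) * (3 * T * \<gamma>\<^sup>2))"
  define D2 where "D2 = 4 * T * ((\<gamma> * M)\<^sup>2 / \<kappa> + 8 * (M + 1)\<^sup>2)"
  have D0: "0 \<le> D1" "0 \<le> D2" using K0 alpha T kappa by (auto simp: D1_def D2_def)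
  define C where "C = 3 * E * D1 + 9 * \<alpha> * \<gamma>\<^sup>2"
  define C' where "C' = 3 * Cs + 3 * E * D2"
  have "1 / real m * (\<Sum>k=1..m. (norm (\<iota> (u \<mu>1 (tgrid T m k) - U k)))\<^sup>2)
        \<le> C * ((norm (\<iota> (\<phi> - ritz_projection a \<mu>0 (pod_space T m (u \<mu>0) lam w l) \<phi>)))\<^sup>2
               + (\<Sum>j=l+1..snapshot_rank T m (u \<mu>0). lam j) + (tstep T m)\<^sup>2)
          + C' * (\<omega>a \<bar>\<mu>1 - \<mu>0\<bar> + \<omega>F \<bar>\<mu>1 - \<mu>0\<bar>)\<^sup>2"
    if \<mu>1: "\<mu>1 \<in> P" and m: "0 < m" and step: "L\<^sup>2 / \<kappa> * tstep T m \<le> 1 / 2" "tstep T m \<le> 1 / 2"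
      and pod: "pod_eigensystem T m (u \<mu>0) lam w" and l: "l \<le> snapshot_rank T m (u \<mu>0)"
      and rom: "rom_solution T m \<iota> f \<phi> a F \<mu>1 (pod_space T m (u \<mu>0) lam w l) U"
    for \<mu>1 m lam w l U
  proof -
    define B where "B = pod_basis T m (u \<mu>0) lam w ` {1..l}"
    have B: "finite B" "pod_space T m (u \<mu>0) lam w l = span B" by (auto simp: B_def pod_space_def)
    interpret ritz a \<mu>0 "\<beta> \<mu>0" \<kappa> B
      using a_bilinear A1 A2 \<mu>0 kappa B by unfold_locales auto
    define \<tau> where "\<tau> = tstep T m"
    have \<tau>: "0 < \<tau>" "real m * \<tau> = T" using T m by (auto simp: \<tau>_def tstep_def)
    define x where "x k = u \<mu>0 (tgrid T m k)" for k
    define \<theta> where "\<theta> k = U k - R (x k)" for k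
    define \<Lambda> where "\<Lambda> = (\<Sum>j=l+1..snapshot_rank T m (u \<mu>0). lam j)"
    define oa oF \<rho> where "oa = \<omega>a \<bar>\<mu>1 - \<mu>0\<bar>" and "oF = \<omega>F \<bar>\<mu>1 - \<mu>0\<bar>" and "\<rho> = oa + oF"
    have o: "0 \<le> oa" "0 \<le> oF" using moduli by (auto simp: oa_def oF_def)
    define N where "N = (norm (\<iota> (\<phi> - R \<phi>)))\<^sup>2 + \<Lambda> + \<tau>\<^sup>2"
    define \<eta> where "\<eta> k = (norm (R (x k) - x k))\<^sup>2" for k
    define d\<eta> where "d\<eta> k = (norm (R (bdiff T m x k) - bdiff T m x k))\<^sup>2" for k
    define c where "c k = (norm (bdiff T m (\<lambda>k. \<iota> (x k)) k - v (tgrid T m k)))\<^sup>2" for k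
    have grid: "tgrid T m k \<in> {0..T}" if "k \<le> m" for k
      using that m T by (auto simp: tgrid_def tstep_def field_simps)
    have ritz_err: "sum \<eta> {1..m} + sum d\<eta> {1..m} \<le> 3 * real m * \<gamma>\<^sup>2 * \<Lambda>" and \<Lambda>0: "0 \<le> \<Lambda>"
      using pod_ritz_error[OF \<mu>0 m pod l] unfolding \<eta>_def d\<eta>_def \<gamma>_def \<Lambda>_def x_def B(2) by auto
    have \<eta>0: "0 \<le> \<eta> k" "0 \<le> d\<eta> k" "0 \<le> c k" for k by (auto simp: \<eta>_def d\<eta>_def c_def)
    have sums: "sum \<eta> {1..m} \<le> 3 * real m * \<gamma>\<^sup>2 * \<Lambda>" "sum d\<eta> {1..m} \<le> 3 * real m * \<gamma>\<^sup>2 * \<Lambda>"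
      using ritz_err sum_nonneg[of "{1..m}" \<eta>] sum_nonneg[of "{1..m}" d\<eta>] \<eta>0 by (auto intro: order_trans)
    have csum: "sum c {1..m} \<le> \<tau> * K"
    proof -
      have "c k \<le> \<tau> * (\<Psi> (tgrid T m k) - \<Psi> (tgrid T m (k - 1)))" if k: "k \<in> {1..m}" for k
      proof -
        have g: "tgrid T m k - tgrid T m (k - 1) = \<tau>"
          using k by (simp add: tgrid_def \<tau>_def of_nat_diff algebra_simps)
        have "bdiff T m (\<lambda>k. \<iota> (x k)) k = div_diff (\<lambda>t. \<iota> (u \<mu>0 t)) (tgrid T m (k - 1)) (tgrid T m k)"
          unfolding bdiff_def div_diff_def g \<tau>_def x_def ..
        then show ?thesis
          using \<Psi>[of "tgrid T m (k - 1)" "tgrid T m k"] grid[of k] grid[of "k - 1"] k g \<tau>(1) by (auto simp: c_def)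
      qed
      then have "sum c {1..m} \<le> (\<Sum>k=1..m. \<tau> * (\<Psi> (tgrid T m k) - \<Psi> (tgrid T m (k - 1))))" by (intro sum_mono) auto
      also have "\<dots> = \<tau> * (\<Psi> (tgrid T m m) - \<Psi> (tgrid T m 0))"
        using sum_telescope''[of 0 m "\<lambda>k. \<Psi> (tgrid T m k)"] by (simp add: sum_distrib_left[symmetric])
      also have "\<dots> = \<tau> * K" using m by (simp add: K_def tgrid_def tstep_def)
      finally show ?thesis .
    qed
    define b where "b k = \<tau> * ((oa * (\<gamma> * M))\<^sup>2 / \<kappa> + 8 * (c k + \<alpha> * d\<eta> k + (oF * (M + 1))\<^sup>2 + L\<^sup>2 * \<eta> k))" for k
    have b0: "0 \<le> b k" for k using \<tau> kappa \<eta>0 alpha by (auto simp: b_def intro!: mult_nonneg_nonneg add_nonneg_nonneg)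
    have bsum: "4 * sum b {1..m} \<le> (D1 - 1) * N + D2 * \<rho>\<^sup>2"
    proof -
      have "sum b {1..m} = real m * \<tau> * ((oa * (\<gamma> * M))\<^sup>2 / \<kappa> + 8 * (oF * (M + 1))\<^sup>2) 
          + 8 * (\<tau> * sum c {1..m} + \<alpha> * (\<tau> * sum d\<eta> {1..m}) + L\<^sup>2 * (\<tau> * sum \<eta> {1..m}))"
      proof -
        have "sum b {1..m} = \<tau> * ((\<Sum>k=1..m. (oa * (\<gamma> * M))\<^sup>2 / \<kappa>)
          + 8 * (sum c {1..m} + \<alpha> * sum d\<eta> {1..m} + (\<Sum>k=1..m. (oF * (M + 1))\<^sup>2) + L\<^sup>2 * sum \<eta> {1..m}))"
          unfolding b_def by (simp only: sum_distrib_left[symmetric] sum.distrib)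
        then show ?thesis by (simp add: algebra_simps)
      qed
      also have "\<dots> \<le> T * ((\<rho> * (\<gamma> * M))\<^sup>2 / \<kappa> + 8 * (\<rho> * (M + 1))\<^sup>2) 
          + 8 * (K * N + \<alpha> * (3 * T * \<gamma>\<^sup>2 * N) + L\<^sup>2 * (3 * T * \<gamma>\<^sup>2 * N))"
      proof (intro add_mono mult_left_mono)
        have \<Lambda>N: "\<Lambda> \<le> N" "\<tau>\<^sup>2 \<le> N" using \<Lambda>0 by (auto simp: N_def)
        have "\<tau> * (3 * real m * \<gamma>\<^sup>2 * \<Lambda>) = 3 * T * \<gamma>\<^sup>2 * \<Lambda>" using \<tau>(2) by (simp add: mult_ac flip: \<tau>(2))
        also have "\<dots> \<le> 3 * T * \<gamma>\<^sup>2 * N" using \<Lambda>N T by (intro mult_left_mono) auto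
        finally have t: "\<tau> * (3 * real m * \<gamma>\<^sup>2 * \<Lambda>) \<le> 3 * T * \<gamma>\<^sup>2 * N" .
        show "\<tau> * sum d\<eta> {1..m} \<le> 3 * T * \<gamma>\<^sup>2 * N" "\<tau> * sum \<eta> {1..m} \<le> 3 * T * \<gamma>\<^sup>2 * N"
          using mult_left_mono[OF sums(1), of \<tau>] mult_left_mono[OF sums(2), of \<tau>] \<tau>(1) t by linarith+
        have "\<tau> * sum c {1..m} \<le> \<tau> * (\<tau> * K)" using csum \<tau>(1) by (intro mult_left_mono) auto
        also have "\<dots> = K * \<tau>\<^sup>2" by (simp add: power2_eq_square)
        also have "\<dots> \<le> K * N" using \<Lambda>N K0 by (intro mult_left_mono) auto
        finally show "\<tau> * sum c {1..m} \<le> K * N" .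
        have "(oa * (\<gamma> * M))\<^sup>2 \<le> (\<rho> * (\<gamma> * M))\<^sup>2" "(oF * (M + 1))\<^sup>2 \<le> (\<rho> * (M + 1))\<^sup>2"
          using o M(1) \<gamma>0 unfolding \<rho>_def by (intro power_mono mult_right_mono; simp)+
        then have "(oa * (\<gamma> * M))\<^sup>2 / \<kappa> + 8 * (oF * (M + 1))\<^sup>2 \<le> (\<rho> * (\<gamma> * M))\<^sup>2 / \<kappa> + 8 * (\<rho> * (M + 1))\<^sup>2"
          using kappa by (intro add_mono divide_right_mono mult_left_mono) auto
        then show "real m * \<tau> * ((oa * (\<gamma> * M))\<^sup>2 / \<kappa> + 8 * (oF * (M + 1))\<^sup>2) \<le> T * ((\<rho> * (\<gamma> * M))\<^sup>2 / \<kappa> + 8 * (\<rho> * (M + 1))\<^sup>2)"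
          unfolding \<tau>(2) using T by (intro mult_left_mono) auto
      qed (use alpha in auto)
      also have "\<dots> = ((D1 - 1) * N + D2 * \<rho>\<^sup>2) / 4"
        unfolding D1_def D2_def power_mult_distrib by (simp add: field_simps)
      finally show ?thesis by simp
    qed
    have \<theta>_bound: "(norm (\<iota> (\<theta> k)))\<^sup>2 \<le> E * (D1 * N + D2 * \<rho>\<^sup>2)" if k: "k \<le> m" for k
    proof -
      have "A * \<tau> = L\<^sup>2 / \<kappa> * \<tau> + \<tau> / 2" by (simp add: A_def distrib_right)
      then have q: "A * \<tau> \<le> 3 / 4" using step unfolding \<tau>_def by linarith
      have q0: "0 \<le> A * \<tau>" using A0 \<tau>(1) by simp
      have "(norm (\<iota> (\<theta> k)))\<^sup>2 \<le> exp (4 * (A * \<tau>) * real k) * ((norm (\<iota> (\<theta> 0)))\<^sup>2 + 4 * sum b {1..k})"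
      proof (rule discrete_gronwall[OF q0 q _ _ _ k])
        fix j assume j: "j \<in> {1..m}"
        show "(1 - A * \<tau>) * (norm (\<iota> (\<theta> j)))\<^sup>2 \<le> (norm (\<iota> (\<theta> (j - 1))))\<^sup>2 + b j"
          using rom_error_step[OF \<mu>0 \<mu>1 j B(1) rom[unfolded B(2)] v M]
          unfolding b_def A_def \<theta>_def x_def c_def \<eta>_def d\<eta>_def oa_def oF_def \<gamma>_def \<tau>_def by simp
      qed (use b0 in auto)
      also have "\<dots> \<le> E * (D1 * N + D2 * \<rho>\<^sup>2)"
      proof (intro mult_mono)
        have "4 * (A * \<tau>) * real k \<le> 4 * A * T"
          using k A0 \<tau> mult_left_mono[of "real k" "real m" "4 * (A * \<tau>)"] by (simp add: mult_ac flip: \<tau>(2))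
        then show "exp (4 * (A * \<tau>) * real k) \<le> E" by (simp add: E_def)
        have x0: "x 0 = \<phi>" using initial_value[OF \<mu>0] by (simp add: x_def tgrid_def)
        have \<theta>0: "\<theta> 0 \<in> span B" unfolding \<theta>_def using rom ritz_props(1) unfolding rom_solution_def B(2) by (auto intro!: span_diff)
        have "(norm (\<iota> (\<theta> 0)))\<^sup>2 = inner (\<iota> (U 0)) (\<iota> (\<theta> 0)) - inner (\<iota> (R \<phi>)) (\<iota> (\<theta> 0))"
          by (simp add: power2_norm_eq_inner \<theta>_def x0 \<iota>_diff inner_diff_left)
        also have "inner (\<iota> (U 0)) (\<iota> (\<theta> 0)) = inner (\<iota> \<phi>) (\<iota> (\<theta> 0))"
          using rom \<theta>0 unfolding rom_solution_def B(2) by blast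
        also have "inner (\<iota> \<phi>) (\<iota> (\<theta> 0)) - inner (\<iota> (R \<phi>)) (\<iota> (\<theta> 0)) = inner (\<iota> (\<phi> - R \<phi>)) (\<iota> (\<theta> 0))"
          by (simp add: \<iota>_diff inner_diff_left)
        also have "\<dots> \<le> norm (\<iota> (\<phi> - R \<phi>)) * norm (\<iota> (\<theta> 0))" by (rule norm_cauchy_schwarz)
        finally have "norm (\<iota> (\<theta> 0)) \<le> norm (\<iota> (\<phi> - R \<phi>))"
          by (cases "\<iota> (\<theta> 0) = 0") (auto simp: power2_eq_square)
        then have "(norm (\<iota> (\<theta> 0)))\<^sup>2 \<le> (norm (\<iota> (\<phi> - R \<phi>)))\<^sup>2" by (intro power_mono) auto
        also have "\<dots> \<le> N" using \<Lambda>0 by (simp add: N_def)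
        finally have "(norm (\<iota> (\<theta> 0)))\<^sup>2 \<le> N" .
        moreover have "sum b {1..k} \<le> sum b {1..m}" using k b0 by (intro sum_mono2) auto
        ultimately show "(norm (\<iota> (\<theta> 0)))\<^sup>2 + 4 * sum b {1..k} \<le> D1 * N + D2 * \<rho>\<^sup>2"
          using bsum by (simp add: algebra_simps)
      qed (use E1 b0 in \<open>auto intro!: add_nonneg_nonneg sum_nonneg\<close>)
      finally show ?thesis .
    qed
    have "(\<Sum>k=1..m. (norm (\<iota> (u \<mu>1 (tgrid T m k) - U k)))\<^sup>2)
       \<le> (\<Sum>k=1..m. 3 * (Cs * \<rho>\<^sup>2 + \<alpha> * \<eta> k + E * (D1 * N + D2 * \<rho>\<^sup>2)))"
    proof (rule sum_mono)
      fix k assume "k \<in> {1..m}"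
      then have k: "k \<le> m" by simp
      define p q r where "p = \<iota> (u \<mu>1 (tgrid T m k) - x k)" and "q = \<iota> (x k - R (x k))" and "r = \<iota> (\<theta> k)"
      have "\<iota> (u \<mu>1 (tgrid T m k) - U k) = p + q - r" by (simp add: p_def q_def r_def \<theta>_def \<iota>_diff)
      then have "norm (\<iota> (u \<mu>1 (tgrid T m k) - U k)) \<le> norm p + norm q + norm r"
        using norm_triangle_ineq4[of "p + q" r] norm_triangle_ineq[of p q] by simp
      then have "(norm (\<iota> (u \<mu>1 (tgrid T m k) - U k)))\<^sup>2 \<le> (norm p + norm q + norm r)\<^sup>2" by (intro power_mono) auto
      also have "\<dots> \<le> 3 * ((norm p)\<^sup>2 + (norm q)\<^sup>2 + (norm r)\<^sup>2)" by (rule sum_three_squared_le)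
      also have "\<dots> \<le> 3 * (Cs * \<rho>\<^sup>2 + \<alpha> * \<eta> k + E * (D1 * N + D2 * \<rho>\<^sup>2))"
      proof (intro mult_left_mono add_mono)
        show "(norm p)\<^sup>2 \<le> Cs * \<rho>\<^sup>2"
          using Cs(2)[OF \<mu>1 grid[OF k]] by (simp add: p_def x_def \<rho>_def oa_def oF_def)
        show "(norm q)\<^sup>2 \<le> \<alpha> * \<eta> k"
          using alpha(2)[of "x k - R (x k)"] by (simp add: q_def \<eta>_def norm_minus_commute)
        show "(norm r)\<^sup>2 \<le> E * (D1 * N + D2 * \<rho>\<^sup>2)" unfolding r_def by (rule \<theta>_bound[OF k])
      qed simp
      finally show "(norm (\<iota> (u \<mu>1 (tgrid T m k) - U k)))\<^sup>2 \<le> 3 * (Cs * \<rho>\<^sup>2 + \<alpha> * \<eta> k + E * (D1 * N + D2 * \<rho>\<^sup>2))" .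
    qed
    also have "\<dots> = real m * (3 * (Cs * \<rho>\<^sup>2 + E * (D1 * N + D2 * \<rho>\<^sup>2))) + 3 * \<alpha> * sum \<eta> {1..m}"
      by (simp only: sum.distrib sum_distrib_left[symmetric]) (simp add: algebra_simps)
    also have "\<dots> \<le> real m * (3 * (Cs * \<rho>\<^sup>2 + E * (D1 * N + D2 * \<rho>\<^sup>2))) + 3 * \<alpha> * (3 * real m * \<gamma>\<^sup>2 * N)"
    proof -
      have "\<Lambda> \<le> N" by (simp add: N_def)
      then have "3 * real m * \<gamma>\<^sup>2 * \<Lambda> \<le> 3 * real m * \<gamma>\<^sup>2 * N" by (intro mult_left_mono) auto
      then have "sum \<eta> {1..m} \<le> 3 * real m * \<gamma>\<^sup>2 * N" using sums(1) by linarith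
      then show ?thesis using alpha(1) by (intro add_left_mono mult_left_mono) auto
    qed
    also have "\<dots> = real m * (C * N + C' * \<rho>\<^sup>2)" by (simp add: C_def C'_def algebra_simps)
    finally have "1 / real m * (\<Sum>k=1..m. (norm (\<iota> (u \<mu>1 (tgrid T m k) - U k)))\<^sup>2) \<le> C * N + C' * \<rho>\<^sup>2"
      using m by (simp add: field_simps)
    then show ?thesis by (simp add: N_def \<Lambda>_def \<tau>_def \<rho>_def oa_def oF_def B(2))
  qed
  note main = this
  have "0 \<le> C" "0 \<le> C'" using D0 E1 Cs(1) alpha(1) by (auto simp: C_def C'_def)
  then show ?thesis by (rule that[OF _ _ main])
qed

end

theorem theorem3p6:
  fixes \<iota> :: "'v::{real_inner, banach, second_countable_topology} \<Rightarrow> 'h::{real_inner, banach, second_countable_topology}"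
    and \<alpha> T \<mu>0 :: real
    and P :: "real set"
    and f :: "real \<Rightarrow> 'h"
    and \<phi> :: 'v
    and a :: "'v \<Rightarrow> 'v \<Rightarrow> real \<Rightarrow> real"
    and F :: "'v \<Rightarrow> real \<Rightarrow> 'h"
    and \<beta> \<kappa> LF \<omega>a \<omega>F :: "real \<Rightarrow> real"
    and u :: "real \<Rightarrow> real \<Rightarrow> 'v"
  assumes embedding: "dense_compact_embedding \<iota>"
    and alpha: "\<alpha> > 0" "\<And>x. (norm (\<iota> x))\<^sup>2 \<le> \<alpha> * (norm x)\<^sup>2"
    and T: "T > 0"
    and P: "compact P" "P \<subseteq> {0<..}"
    and f: "continuous_on {0..T} f"
    and a_bilinear: "\<And>\<mu>. \<mu> > 0 \<Longrightarrow> bilinear (\<lambda>x y. a x y \<mu>)"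
    and beta: "continuous_on P \<beta>" "\<And>\<mu>. \<mu> \<in> P \<Longrightarrow> \<beta> \<mu> > 0"
    and kappa: "continuous_on P \<kappa>" "\<And>\<mu>. \<mu> \<in> P \<Longrightarrow> \<kappa> \<mu> > 0"
    and LF: "continuous_on P LF" "\<And>\<mu>. \<mu> \<in> P \<Longrightarrow> LF \<mu> \<ge> 0"
    and moduli: "modulus_of_continuity \<omega>a" "modulus_of_continuity \<omega>F"
    and A1: "\<And>\<mu> x y. \<mu> \<in> P \<Longrightarrow> \<bar>a x y \<mu>\<bar> \<le> \<beta> \<mu> * norm x * norm y"
    and A2: "\<And>\<mu> x. \<mu> \<in> P \<Longrightarrow> a x x \<mu> \<ge> \<kappa> \<mu> * (norm x)\<^sup>2"
    and A3: "\<And>\<mu> \<nu> x y. \<mu> \<in> P \<Longrightarrow> \<nu> \<in> P \<Longrightarrow> \<bar>a x y \<mu> - a x y \<nu>\<bar> \<le> \<omega>a \<bar>\<mu> - \<nu>\<bar> * norm x * norm y"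
    and F1: "\<And>\<mu> x y. \<mu> \<in> P \<Longrightarrow> norm (F x \<mu> - F y \<mu>) \<le> LF \<mu> * norm (x - y)"
    and F2: "\<And>\<mu> \<nu> x. \<mu> \<in> P \<Longrightarrow> \<nu> \<in> P \<Longrightarrow> norm (F x \<mu> - F x \<nu>) \<le> \<omega>F \<bar>\<mu> - \<nu>\<bar> * (norm x + 1)"
    and solution: "\<And>\<mu>. \<mu> \<in> P \<Longrightarrow> weak_solution T \<iota> f \<phi> a F \<mu> (u \<mu>)"
    and uniqueness: "\<And>\<mu> w. \<mu> \<in> P \<Longrightarrow> weak_solution T \<iota> f \<phi> a F \<mu> w \<Longrightarrow>
                       AE t in lebesgue_on {0<..<T}. w t = u \<mu> t"
    and regularity: "\<And>\<mu>. \<mu> \<in> P \<Longrightarrow> W22 T (\<lambda>t. \<iota> (u \<mu> t))"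
                    "\<And>\<mu>. \<mu> \<in> P \<Longrightarrow> continuous_on {0..T} (u \<mu>)"
    and mu0: "\<mu>0 \<in> P"
  shows "\<exists>C>0. \<exists>C'>0. \<forall>\<mu>1\<in>P. \<forall>m>0. time_step_condition T m P \<kappa> LF \<mu>0 \<longrightarrow>
    (\<forall>lam v. pod_eigensystem T m (u \<mu>0) lam v \<longrightarrow>
      (\<forall>l\<in>{1..snapshot_rank T m (u \<mu>0)}. \<forall>U.
        rom_solution T m \<iota> f \<phi> a F \<mu>1 (pod_space T m (u \<mu>0) lam v l) U \<longrightarrow>
        sqrt (1 / real m * (\<Sum>k=1..m. (norm (\<iota> (u \<mu>1 (tgrid T m k) - U k)))\<^sup>2))
        \<le> sqrt C * sqrt ((norm (\<iota> (\<phi> - ritz_projection a \<mu>0 (pod_space T m (u \<mu>0) lam v l) \<phi>)))\<^sup>2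
                         + (\<Sum>j=l+1..snapshot_rank T m (u \<mu>0). lam j)
                         + (tstep T m)\<^sup>2)
          + C' * (\<omega>a \<bar>\<mu>1 - \<mu>0\<bar> + \<omega>F \<bar>\<mu>1 - \<mu>0\<bar>)))"
proof -
  define k0 where "k0 = (INF \<mu>\<in>P. \<kappa> \<mu>)"
  define L where "L = (SUP \<mu>\<in>P. LF \<mu>)"
  have ne: "P \<noteq> {}" using mu0 by blast
  have Ppos: "\<mu> > 0" if "\<mu> \<in> P" for \<mu> using P(2) that by auto
  obtain \<mu>' where \<mu>': "\<mu>' \<in> P" "\<And>\<mu>. \<mu> \<in> P \<Longrightarrow> \<kappa> \<mu>' \<le> \<kappa> \<mu>"
    using continuous_attains_inf[OF P(1) ne kappa(1)] by blast
  have k0_eq: "k0 = \<kappa> \<mu>'" unfolding k0_def by (rule cInf_eq_minimum) (use \<mu>' in auto)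
  then have k0: "0 < k0" "\<And>\<mu>. \<mu> \<in> P \<Longrightarrow> k0 \<le> \<kappa> \<mu>" using kappa(2) \<mu>' by auto
  obtain \<mu>'' where \<mu>'': "\<mu>'' \<in> P" "\<And>\<mu>. \<mu> \<in> P \<Longrightarrow> LF \<mu> \<le> LF \<mu>''"
    using continuous_attains_sup[OF P(1) ne LF(1)] by blast
  have L_eq: "L = LF \<mu>''" unfolding L_def by (rule cSup_eq_maximum) (use \<mu>'' in auto)
  then have L: "0 \<le> L" "\<And>\<mu>. \<mu> \<in> P \<Longrightarrow> LF \<mu> \<le> L" using LF(2) \<mu>'' by auto
  interpret family: semilinear_family \<iota> \<alpha> T P f \<phi> a F \<beta> \<omega>a \<omega>F k0 L u
  proof (rule semilinear_family.intro)
    show "bounded_linear \<iota>" "inj \<iota>" using embedding unfolding dense_compact_embedding_def by auto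
    show "\<omega>a r \<ge> 0" "\<omega>F r \<ge> 0" if "r \<ge> 0" for r
      using moduli that unfolding modulus_of_continuity_def by auto
    show "a x x \<mu> \<ge> k0 * (norm x)\<^sup>2" if "\<mu> \<in> P" for \<mu> x
      using A2[OF that, of x] mult_right_mono[OF k0(2)[OF that], of "(norm x)\<^sup>2"] by simp
    show "norm (F x \<mu> - F y \<mu>) \<le> L * norm (x - y)" if "\<mu> \<in> P" for \<mu> x y
      using F1[OF that, of x y] mult_right_mono[OF L(2)[OF that], of "norm (x - y)"] by simp
    show "bilinear (\<lambda>x y. a x y \<mu>)" if "\<mu> \<in> P" for \<mu>
      by (rule a_bilinear) (rule Ppos[OF that])
  qed (fact alpha T f beta(2) k0(1) L(1) A1 A3 F2 solution regularity)+
  obtain C C' where C: "0 \<le> C" "0 \<le> C'" and bound: "\<And>\<mu>1 m lam v l U. \<mu>1 \<in> P \<Longrightarrow> 0 < m \<Longrightarrow>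
     L\<^sup>2 / k0 * tstep T m \<le> 1 / 2 \<Longrightarrow> tstep T m \<le> 1 / 2 \<Longrightarrow> pod_eigensystem T m (u \<mu>0) lam v \<Longrightarrow>
     l \<le> snapshot_rank T m (u \<mu>0) \<Longrightarrow>
     rom_solution T m \<iota> f \<phi> a F \<mu>1 (pod_space T m (u \<mu>0) lam v l) U \<Longrightarrow>
        1 / real m * (\<Sum>k=1..m. (norm (\<iota> (u \<mu>1 (tgrid T m k) - U k)))\<^sup>2)
        \<le> C * ((norm (\<iota> (\<phi> - ritz_projection a \<mu>0 (pod_space T m (u \<mu>0) lam v l) \<phi>)))\<^sup>2
               + (\<Sum>j=l+1..snapshot_rank T m (u \<mu>0). lam j) + (tstep T m)\<^sup>2)
          + C' * (\<omega>a \<bar>\<mu>1 - \<mu>0\<bar> + \<omega>F \<bar>\<mu>1 - \<mu>0\<bar>)\<^sup>2"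
    by (fact family.rom_error_bound[OF mu0])
  \<comment> \<open>The constants of the estimate may vanish, hence the summand 1.\<close>
  show ?thesis
  proof (rule exI[of _ "C + 1"], intro exI[of _ "sqrt C' + 1"] conjI ballI allI impI)
    show "0 < C + 1" "0 < sqrt C' + 1" using C by (auto intro: add_nonneg_pos)
    fix \<mu>1 m lam v l U
    assume \<mu>1: "\<mu>1 \<in> P" and m: "(0::nat) < m" and step: "time_step_condition T m P \<kappa> LF \<mu>0"
      and pod: "pod_eigensystem T m (u \<mu>0) lam v" and l: "l \<in> {1..snapshot_rank T m (u \<mu>0)}"
      and rom: "rom_solution T m \<iota> f \<phi> a F \<mu>1 (pod_space T m (u \<mu>0) lam v l) U"
    define X where "X = (norm (\<iota> (\<phi> - ritz_projection a \<mu>0 (pod_space T m (u \<mu>0) lam v l) \<phi>)))\<^sup>2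
               + (\<Sum>j=l+1..snapshot_rank T m (u \<mu>0). lam j) + (tstep T m)\<^sup>2"
    define \<rho> where "\<rho> = \<omega>a \<bar>\<mu>1 - \<mu>0\<bar> + \<omega>F \<bar>\<mu>1 - \<mu>0\<bar>"
    define S where "S = 1 / real m * (\<Sum>k=1..m. (norm (\<iota> (u \<mu>1 (tgrid T m k) - U k)))\<^sup>2)"
    have \<tau>: "0 < tstep T m" using T m by (simp add: tstep_def)
    have \<rho>0: "0 \<le> \<rho>" using moduli unfolding modulus_of_continuity_def \<rho>_def by auto
    have X0: "0 \<le> X"
      using pod l unfolding X_def pod_eigensystem_def Let_def
      by (intro add_nonneg_nonneg sum_nonneg) (auto intro: less_imp_le)
    have step1: "L\<^sup>2 / k0 * tstep T m \<le> 1 / 2"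
      using step unfolding time_step_condition_def L_def k0_def by linarith
    have step2: "tstep T m \<le> 1 / 2"
    proof -
      have "1 \<le> 1 + LF \<mu>0 + (LF \<mu>0)\<^sup>2 / (2 * \<kappa> \<mu>0)" using LF(2)[OF mu0] kappa(2)[OF mu0] by simp
      then have "1 * tstep T m \<le> (1 + LF \<mu>0 + (LF \<mu>0)\<^sup>2 / (2 * \<kappa> \<mu>0)) * tstep T m"
        using \<tau> by (intro mult_right_mono) auto
      then show ?thesis using step unfolding time_step_condition_def by linarith
    qed
    have "S \<le> C * X + C' * \<rho>\<^sup>2"
      using bound[OF \<mu>1 m step1 step2 pod _ rom] l unfolding S_def X_def \<rho>_def by simp
    then have "sqrt S \<le> sqrt (C * X + C' * \<rho>\<^sup>2)" by simp
    also have "\<dots> \<le> sqrt (C * X) + sqrt (C' * \<rho>\<^sup>2)"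
      using C X0 by (intro sqrt_add_le_add_sqrt) auto
    also have "\<dots> = sqrt C * sqrt X + sqrt C' * \<rho>" using \<rho>0 by (simp add: real_sqrt_mult)
    also have "\<dots> \<le> sqrt (C + 1) * sqrt X + (sqrt C' + 1) * \<rho>"
      using X0 \<rho>0 by (intro add_mono mult_right_mono) auto
    finally show "sqrt (1 / real m * (\<Sum>k=1..m. (norm (\<iota> (u \<mu>1 (tgrid T m k) - U k)))\<^sup>2))
        \<le> sqrt (C + 1) * sqrt ((norm (\<iota> (\<phi> - ritz_projection a \<mu>0 (pod_space T m (u \<mu>0) lam v l) \<phi>)))\<^sup>2
                         + (\<Sum>j=l+1..snapshot_rank T m (u \<mu>0). lam j)
                         + (tstep T m)\<^sup>2)
          + (sqrt C' + 1) * (\<omega>a \<bar>\<mu>1 - \<mu>0\<bar> + \<omega>F \<bar>\<mu>1 - \<mu>0\<bar>)"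
      unfolding S_def X_def \<rho>_def .
  qed
qed

end
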